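(* Let $p$ be a prime, let $u \ge 0$ be an integer, and let $\alpha_n(1), \alpha_n(2), \ldots, \alpha_n(n+u) \in (0, 1/2]$ for every integer $n \ge 1$. Assume that for every $\epsilon>0$, $$\lim_{n \to \infty} \sum_{i=1}^{n+u} \exp \left( - \epsilon\, \alpha_n(i)\, n \right) = 0.$$ For each $n \ge 1$, let $A(n)$ be a random $n \times (n+u)$ matrix over $\mathbb{Z}_p$ with independent entries such that the $i$-th column is $\alpha_n(i)$-balanced for every $1 \le i \le n+u$. Then for every finite abelian $p$-group $G$, $$\lim_{n \to \infty} \mathbb{E}\bigl(\#\mathrm{Sur}(\mathrm{cok}(A(n)), G)\bigr) = \frac{1}{|G|^u}.$$
   Context: $\mathbb{Z}_p$ is the ring of $p$-adic integers. For an $n \times (n+u)$ matrix $A$ over $\mathbb{Z}_p$, regarded as a linear map $\mathbb{Z}_p^{n+u} \to \mathbb{Z}_p^n$, $\mathrm{cok}(A) = \mathbb{Z}_p^n / A\,\mathbb{Z}_p^{n+u}$ is its cokernel. For $\mathbb{Z}_p$-modules $M$ and $N$, $\mathrm{Sur}(M,N)$ is the set of surjective $\mathbb{Z}_p$-module homomorphisms from $M$ to $N$. For $\alpha \in (0,1/2]$, a random variable $y$ with values in $\mathbb{Z}_p$ is $\alpha$-balanced if $\mathbb{P}(y \equiv r \pmod{p}) \le 1-\alpha$ for every $r \in \mathbb{Z}_p/p\mathbb{Z}_p$. A random vector over $\mathbb{Z}_p$ is $\alpha$-balanced if its entries are independent and each entry is $\alpha$-balanced (the entries need not be identically distributed).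 *)

theory Defs
  imports "HOL-Probability.Probability" "HOL-Algebra.Module" "HOL-Algebra.QuotRing"
begin

text \<open>
  The ring of \<open>p\<close>-adic integers as the inverse limit of the rings \<open>\<int>/p\<^sup>k\<int>\<close>: an element is the
  sequence of its residues modulo \<open>p\<^sup>k\<close>, each represented in \<open>{0..<p\<^sup>k}\<close>.
\<close>

type_synonym padic = "nat \<Rightarrow> int"

definition Zp :: "nat \<Rightarrow> padic ring" where
  "Zp p = \<lparr>carrier = {x. \<forall>k. x k \<in> {0..<int p ^ k} \<and> x (Suc k) mod int p ^ k = x k},
           mult = (\<lambda>x y k. (x k * y k) mod int p ^ k),
           one = (\<lambda>k. 1 mod int p ^ k),
           zero = (\<lambda>k. 0),
           add = (\<lambda>x y k. (x k + y k) mod int p ^ k)\<rparr>"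

text \<open>
  The topology on \<^typ>\<open>nat \<Rightarrow> int\<close> is the product of the discrete topologies, so its restriction
  to the carrier is the profinite (i.e. \<open>p\<close>-adic) topology.
\<close>

definition Zp_borel :: "nat \<Rightarrow> padic measure" where
  "Zp_borel p = restrict_space borel (carrier (Zp p))"


text \<open>
  In the module records below, the ring fields \<^const>\<open>mult\<close> and \<^const>\<open>one\<close> play no role
  in the module structure and are left undefined.
\<close>

definition free_module :: "('a, 'r) ring_scheme \<Rightarrow> nat \<Rightarrow> ('a, nat \<Rightarrow> 'a) module" where
  "free_module R n =
     \<lparr>carrier = {1..n} \<rightarrow>\<^sub>E carrier R,
      mult = undefined,
      one = undefined,
      zero = (\<lambda>i\<in>{1..n}. \<zero>\<^bsub>R\<^esub>),
      add = (\<lambda>x y. \<lambda>i\<in>{1..n}. x i \<oplus>\<^bsub>R\<^esub> y i),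
      smult = (\<lambda>a x. \<lambda>i\<in>{1..n}. a \<otimes>\<^bsub>R\<^esub> x i)\<rparr>"

definition quotient_module ::
  "('a, 'm, 'x) module_scheme \<Rightarrow> 'm set \<Rightarrow> ('a, 'm set) module" where
  "quotient_module M N =
     \<lparr>carrier = a_rcosets\<^bsub>M\<^esub> N,
      mult = undefined,
      one = undefined,
      zero = N,
      add = set_add M,
      smult = (\<lambda>a X. \<Union>x\<in>X. N +>\<^bsub>M\<^esub> (a \<odot>\<^bsub>M\<^esub> x))\<rparr>"

text \<open>A matrix with \<open>n\<close> rows and \<open>m\<close> columns is a function of the row and column index, counted from 1.\<close>

definition mat_map ::
  "('a, 'r) ring_scheme \<Rightarrow> nat \<Rightarrow> nat \<Rightarrow> (nat \<Rightarrow> nat \<Rightarrow> 'a) \<Rightarrow> (nat \<Rightarrow> 'a) \<Rightarrow> (nat \<Rightarrow> 'a)" where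
  "mat_map R n m A x = (\<lambda>i\<in>{1..n}. \<Oplus>\<^bsub>R\<^esub>j\<in>{1..m}. A i j \<otimes>\<^bsub>R\<^esub> x j)"

definition cok ::
  "('a, 'r) ring_scheme \<Rightarrow> nat \<Rightarrow> nat \<Rightarrow> (nat \<Rightarrow> nat \<Rightarrow> 'a) \<Rightarrow> ('a, (nat \<Rightarrow> 'a) set) module" where
  "cok R n m A =
     quotient_module (free_module R n) (mat_map R n m A ` carrier (free_module R m))"

text \<open>Homomorphisms are extensional functions, so that each one is counted exactly once.\<close>

definition module_Hom ::
  "('a, 'r) ring_scheme \<Rightarrow> ('a, 'm, 'x) module_scheme \<Rightarrow> ('a, 'n, 'y) module_scheme \<Rightarrow> ('m \<Rightarrow> 'n) set" where
  "module_Hom R M N =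
     {f \<in> carrier M \<rightarrow>\<^sub>E carrier N.
        (\<forall>x\<in>carrier M. \<forall>y\<in>carrier M. f (x \<oplus>\<^bsub>M\<^esub> y) = f x \<oplus>\<^bsub>N\<^esub> f y) \<and>
        (\<forall>a\<in>carrier R. \<forall>x\<in>carrier M. f (a \<odot>\<^bsub>M\<^esub> x) = a \<odot>\<^bsub>N\<^esub> f x)}"

definition Sur ::
  "('a, 'r) ring_scheme \<Rightarrow> ('a, 'm, 'x) module_scheme \<Rightarrow> ('a, 'n, 'y) module_scheme \<Rightarrow> ('m \<Rightarrow> 'n) set" where
  "Sur R M N = {f \<in> module_Hom R M N. f ` carrier M = carrier N}"

text \<open>
  A finite abelian \<open>p\<close>-group of order \<open>p\<^sup>k\<close> (written multiplicatively) is annihilated by \<open>p\<^sup>k\<close>, hence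
  is a \<open>\<int>/p\<^sup>k\<int>\<close>-module, and thereby a module over \<^term>\<open>Zp p\<close> through the projection \<open>a \<mapsto> a k\<close>.
\<close>

definition pgroup_module :: "nat \<Rightarrow> ('g, 'c) monoid_scheme \<Rightarrow> (padic, 'g) module" where
  "pgroup_module p G =
     \<lparr>carrier = carrier G,
      mult = undefined,
      one = undefined,
      zero = \<one>\<^bsub>G\<^esub>,
      add = (\<lambda>x y. x \<otimes>\<^bsub>G\<^esub> y),
      smult = (\<lambda>a x. x [^]\<^bsub>G\<^esub> a (multiplicity p (order G)))\<rparr>"


definition balanced :: "nat \<Rightarrow> real \<Rightarrow> 'w measure \<Rightarrow> ('w \<Rightarrow> padic) \<Rightarrow> bool" where
  "balanced p \<alpha> M y \<longleftrightarrow>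
     y \<in> measurable M (Zp_borel p) \<and>
     (\<forall>r \<in> carrier (Zp p Quot (PIdl\<^bsub>Zp p\<^esub> ([p] \<cdot>\<^bsub>Zp p\<^esub> \<one>\<^bsub>Zp p\<^esub>))).
        measure M {\<omega> \<in> space M. y \<omega> \<in> r} \<le> 1 - \<alpha>)"

definition balanced_vector :: "nat \<Rightarrow> real \<Rightarrow> 'w measure \<Rightarrow> nat \<Rightarrow> (nat \<Rightarrow> 'w \<Rightarrow> padic) \<Rightarrow> bool" where
  "balanced_vector p \<alpha> M n v \<longleftrightarrow>
     prob_space.indep_vars M (\<lambda>_. Zp_borel p) v {1..n} \<and>
     (\<forall>i\<in>{1..n}. balanced p \<alpha> M (v i))"

end

theory Submission
  imports Defs "HOL-Number_Theory.Cong" "HOL-Algebra.Generated_Groups"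
    "HOL-Algebra.Multiplicative_Group" "HOL-Real_Asymp.Real_Asymp"
begin

text \<open>
  Write \<open>B\<close> for the order of \<open>G\<close>, a power \<open>p ^ K\<close>, and put \<open>N = p ^ (K + 1)\<close>. A homomorphism from
  the free module of rank \<open>n\<close> to \<open>G\<close> is a tuple \<open>g\<close> of \<open>n\<close> elements of \<open>G\<close>; it factors through the
  cokernel of \<open>A\<close> iff every column \<open>(a\<^sub>1, \<dots>, a\<^sub>n)\<close> of \<open>A\<close> satisfies \<open>g\<^sub>1 ^ a\<^sub>1 \<cdots> g\<^sub>n ^ a\<^sub>n = 1\<close>, and it
  is onto iff the entries of \<open>g\<close> generate \<open>G\<close>. Columns are independent, so the expected number of
  surjections is the sum, over the generating tuples \<open>g\<close>, of the product over the columns of the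
  probabilities that \<open>g\<close> kills the column (lemma \<open>expected_Sur_cok\<close>). There are about \<open>B ^ n\<close> tuples,
  and a typical one kills each of the \<open>n + u\<close> columns with probability about \<open>1 / B\<close>. This gives the
  limit \<open>1 / B ^ u\<close>; the work lies in the error terms and in the atypical tuples.

  Fix a small \<open>\<theta> > 0\<close>. An element of \<open>G\<close> is popular for \<open>g\<close> if it occurs at least \<open>\<theta> n\<close> times
  in \<open>g\<close>, the core \<open>H\<close> of \<open>g\<close> is the subgroup generated by the popular elements, and the stray indices
  are those \<open>i\<close> with \<open>g\<^sub>i\<close> outside \<open>H\<close>. Each unpopular value occurs fewer than \<open>\<theta> n\<close> times, so there are
  at most \<open>B \<theta> n\<close> stray indices. Two facts bound the probability that \<open>g\<close> kills an \<open>\<alpha>\<close>-balanced column.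

  \<^item> For each popular \<open>h\<close>, the exponents at the occurrences of \<open>h\<close> have a sum that is uniform
    modulo \<open>N\<close> up to \<open>e = exp (- \<alpha> \<theta> n / (2 N\<^sup>2))\<close>. Such exponents average any nonnegative
    function on \<open>G\<close> over the cosets of \<open>H\<close>, up to the factors \<open>(1 - N e) ^ B\<close> and \<open>(1 + N e) ^ B\<close> (lemma \<open>walk_mean_popular\<close>).

  \<^item> The \<open>w\<close> stray indices must contribute an element of \<open>H\<close>. By the pigeonhole principle one value
    outside \<open>H\<close> occurs at least \<open>w / B\<close> times, and the sum of its exponents avoids any given residue
    modulo its order in \<open>G / H\<close> with probability at least \<open>(1 - exp (- \<alpha> w / (2 N\<^sup>2 B))) / 2\<close>
    (lemma \<open>walk_mean_return_to_subgroup\<close>).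

  Both come from one estimate: on functions of mean zero on a cyclic group of order \<open>M = p ^ m\<close>,
  convolution with an \<open>\<alpha>\<close>-balanced law multiplies the squared Euclidean norm by at most
  \<open>1 - \<alpha> / M\<^sup>2\<close> (lemma \<open>balanced_convolution_contracts\<close>). This is a Poincare inequality, and no
  characters enter.

  If the core is all of \<open>G\<close>, each column has probability \<open>(1 / B) (1 + O(e))\<close>, and the errors \<open>e\<close> add
  up to \<open>o(1)\<close> over the columns by hypothesis. All but a vanishing proportion of the \<open>B ^ n\<close> tuples are of
  this kind, and they yield \<open>1 / B ^ u\<close>. If the core is a proper subgroup \<open>H\<close> and \<open>g\<close> generates \<open>G\<close>,
  the set \<open>W\<close> of stray indices is nonempty. For given \<open>H\<close> and \<open>W\<close> there are at most
  \<open>card H ^ n * B ^ card W\<close> such tuples, and up to a bounded factor each contributes at most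
  \<open>1 / card H ^ (n + u)\<close> times the product over the columns of the escape factors of the second fact.
  The hypothesis on the \<open>\<alpha>\<close> forces at least \<open>n / 2\<close> columns to be \<open>\<alpha>\<close>-balanced with \<open>\<alpha> n\<close> at least any
  given multiple of \<open>ln n\<close> (lemma \<open>many_balanced_columns\<close>), so that product is at most
  \<open>n ^ (- 3 card W) + exp (- n / 8)\<close>. Summing \<open>B ^ card W\<close> times this over all nonempty \<open>W\<close> with at most
  \<open>B \<theta> n\<close> elements gives a quantity that tends to \<open>0\<close> once \<open>\<theta>\<close> is small.
\<close>

section \<open>Convolution with balanced weights on a cyclic group\<close>

definition periodic :: "nat \<Rightarrow> (int \<Rightarrow> real) \<Rightarrow> bool" where
  "periodic M f \<longleftrightarrow> (\<forall>s. f (s + int M) = f s)"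

lemma periodic_mod:
  assumes "periodic M f"
  shows "f (s mod int M) = f s"
proof -
  have nat: "f (t + int M * int j) = f t" for t j
    by (induction j arbitrary: t)
       (use assms in \<open>auto simp: periodic_def algebra_simps\<close>, metis add.assoc add.commute)
  have "f (t + int M * z) = f t" for t z
  proof (cases "z \<ge> 0")
    case True
    then show ?thesis using nat[of t "nat z"] by simp
  next
    case False
    then show ?thesis using nat[of "t + int M * z" "nat (- z)"] by (simp add: algebra_simps)
  qed
  from this[of "s mod int M" "s div int M"] show ?thesis by simp
qed

lemma sum_periodic_shift:
  assumes "periodic M f"
  shows "(\<Sum>s\<in>{0..<int M}. f (s + c)) = (\<Sum>s\<in>{0..<int M}. f s)"
proof (cases "M = 0")
  case False
  then have M: "int M > 0" by simp
  have "(\<Sum>s\<in>{0..<int M}. f s) = (\<Sum>s\<in>{0..<int M}. f ((s + c) mod int M))"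
    by (rule sum.reindex_bij_witness[where i = "\<lambda>s. (s + c) mod int M" and j = "\<lambda>s. (s - c) mod int M"])
       (use M in \<open>auto simp: mod_simps\<close>)
  then show ?thesis using periodic_mod[OF assms] by simp
qed simp

text \<open>
  Multiplication by a unit permutes the residues modulo \<open>M\<close>.
\<close>

lemma sum_periodic_unit:
  assumes f: "periodic M f" and d: "coprime d (int M)"
  shows "(\<Sum>s\<in>{0..<int M}. f (s * d)) = (\<Sum>s\<in>{0..<int M}. f s)"
proof (cases "M = 0")
  case False
  then have M: "int M > 0" by simp
  obtain e where e: "[d * e = 1] (mod int M)"
    using d by (metis cong_solve_coprime_int)
  have inv: "(s * d mod int M) * e mod int M = s \<and> (s * e mod int M) * d mod int M = s"
    if "s \<in> {0..<int M}" for s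
  proof -
    have "[s * d * e = s * 1] (mod int M)" "[s * e * d = s * 1] (mod int M)"
      using cong_scalar_left[OF e, of s] by (simp_all add: ac_simps)
    then show ?thesis using that by (simp add: cong_def mod_simps)
  qed
  have "(\<Sum>s\<in>{0..<int M}. f s) = (\<Sum>s\<in>{0..<int M}. f ((s * d) mod int M))"
    by (rule sum.reindex_bij_witness[where i = "\<lambda>s. (s * d) mod int M" and j = "\<lambda>s. (s * e) mod int M"])
       (use M inv in auto)
  then show ?thesis using periodic_mod[OF f] by simp
qed simp

lemma sum_sq_shift_multiple_le:
  assumes f: "periodic M f"
  shows "(\<Sum>s\<in>{0..<int M}. (f (s + int j * d) - f s)\<^sup>2)
       \<le> (real j)\<^sup>2 * (\<Sum>s\<in>{0..<int M}. (f (s + d) - f s)\<^sup>2)"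
proof -
  let ?D = "\<Sum>s\<in>{0..<int M}. (f (s + d) - f s)\<^sup>2"
  have step: "(f (s + int j * d) - f s)\<^sup>2
      \<le> real j * (\<Sum>l<j. (f (s + int l * d + d) - f (s + int l * d))\<^sup>2)" for s
  proof -
    have "f (s + int j * d) - f s = (\<Sum>l<j. f (s + int l * d + d) - f (s + int l * d))"
      using sum_lessThan_telescope[of "\<lambda>l. f (s + int l * d)" j]
      by (simp add: algebra_simps)
    moreover have "(\<Sum>l<j. 1 * (f (s + int l * d + d) - f (s + int l * d)))\<^sup>2
       \<le> (\<Sum>l<j. 1\<^sup>2) * (\<Sum>l<j. (f (s + int l * d + d) - f (s + int l * d))\<^sup>2)"
      by (rule Cauchy_Schwarz_ineq_sum)
    ultimately show ?thesis by simp
  qed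
  have "(\<Sum>s\<in>{0..<int M}. (f (s + int j * d) - f s)\<^sup>2)
      \<le> (\<Sum>s\<in>{0..<int M}. real j * (\<Sum>l<j. (f (s + int l * d + d) - f (s + int l * d))\<^sup>2))"
    by (rule sum_mono) (rule step)
  also have "\<dots> = real j * (\<Sum>l<j. \<Sum>s\<in>{0..<int M}. (f (s + int l * d + d) - f (s + int l * d))\<^sup>2)"
    by (simp add: sum_distrib_left) (rule sum.swap)
  also have "(\<Sum>l<j. \<Sum>s\<in>{0..<int M}. (f (s + int l * d + d) - f (s + int l * d))\<^sup>2) = (\<Sum>l<j. ?D)"
  proof (rule sum.cong[OF refl])
    fix l
    have "periodic M (\<lambda>s. (f (s + d) - f s)\<^sup>2)"
      using f unfolding periodic_def by (metis add.assoc add.commute)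
    from sum_periodic_shift[OF this, of "int l * d"]
    show "(\<Sum>s\<in>{0..<int M}. (f (s + int l * d + d) - f (s + int l * d))\<^sup>2) = ?D" .
  qed
  finally show ?thesis by (simp add: power2_eq_square ac_simps)
qed

text \<open>
  Averaged over all shifts \<open>c\<close>, the squared distance from \<open>f\<close> to its shift by \<open>c\<close> is exactly twice the squared
  norm of \<open>f\<close>, because the correlations add up to the square of the vanishing sum of \<open>f\<close>. Every shift is
  a multiple of the unit \<open>d\<close> by fewer than \<open>M\<close>, and a multiple of a shift moves \<open>f\<close> at most that many
  times as far, so the shift by \<open>d\<close> alone already moves \<open>f\<close> by a definite amount.
\<close>

lemma cyclic_poincare:
  assumes f: "periodic M f" and zero: "(\<Sum>s\<in>{0..<int M}. f s) = 0"
    and d: "coprime d (int M)" and M: "M > 0"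
  shows "2 * (\<Sum>s\<in>{0..<int M}. (f s)\<^sup>2) \<le> (real M)\<^sup>2 * (\<Sum>s\<in>{0..<int M}. (f (s + d) - f s)\<^sup>2)"
proof -
  let ?I = "{0..<int M}"
  let ?E = "\<Sum>s\<in>?I. (f s)\<^sup>2"
  let ?D = "\<lambda>d. \<Sum>s\<in>?I. (f (s + d) - f s)\<^sup>2"
  have perE: "periodic M (\<lambda>s. (f s)\<^sup>2)" using f unfolding periodic_def by simp
  have perD: "periodic M ?D"
    unfolding periodic_def
  proof
    fix c show "?D (c + int M) = ?D c"
      using f unfolding periodic_def by (simp add: add.assoc[symmetric])
  qed
  have "(\<Sum>c\<in>?I. ?D c) = (\<Sum>c\<in>?I. \<Sum>s\<in>?I. (f (s + c))\<^sup>2 + (f s)\<^sup>2 - 2 * f (s + c) * f s)"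
    by (simp add: power2_diff algebra_simps)
  also have "\<dots> = (\<Sum>c\<in>?I. 2 * ?E) - 2 * (\<Sum>c\<in>?I. \<Sum>s\<in>?I. f (s + c) * f s)"
    using sum_periodic_shift[OF perE]
    by (simp add: sum.distrib sum_subtractf sum_distrib_left mult.assoc)
  also have "(\<Sum>c\<in>?I. \<Sum>s\<in>?I. f (s + c) * f s) = (\<Sum>s\<in>?I. (\<Sum>c\<in>?I. f (c + s)) * f s)"
    by (subst sum.swap) (simp add: sum_distrib_right add.commute)
  also have "\<dots> = 0" using sum_periodic_shift[OF f] zero by simp
  finally have tot: "(\<Sum>c\<in>?I. ?D c) = 2 * real M * ?E" by simp
  have "(\<Sum>c\<in>?I. ?D c) = (\<Sum>c\<in>?I. ?D (c * d))"
    using sum_periodic_unit[OF perD d] by simp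
  also have "\<dots> \<le> (\<Sum>c\<in>?I. (real M)\<^sup>2 * ?D d)"
  proof (rule sum_mono)
    fix c assume c: "c \<in> ?I"
    have "?D (int (nat c) * d) \<le> (real (nat c))\<^sup>2 * ?D d"
      by (rule sum_sq_shift_multiple_le[OF f])
    also have "\<dots> \<le> (real M)\<^sup>2 * ?D d"
      using c by (intro mult_right_mono power_mono sum_nonneg) auto
    finally show "?D (c * d) \<le> (real M)\<^sup>2 * ?D d" using c by simp
  qed
  also have "\<dots> = real M * ((real M)\<^sup>2 * ?D d)" by simp
  finally have "real M * (2 * ?E) \<le> real M * ((real M)\<^sup>2 * ?D d)" using tot by simp
  then show ?thesis using M by (simp del: mult.assoc)
qed

text \<open>
  The second moment minus the variance, with the variance written as half of the mean squared
  difference of two independent copies.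
\<close>

lemma square_weighted_mean:
  fixes \<mu> x :: "'a \<Rightarrow> real"
  assumes "sum \<mu> C = 1"
  shows "(\<Sum>a\<in>C. \<mu> a * x a)\<^sup>2
       = (\<Sum>a\<in>C. \<mu> a * (x a)\<^sup>2) - (\<Sum>a\<in>C. \<Sum>b\<in>C. \<mu> a * \<mu> b * (x a - x b)\<^sup>2) / 2"
proof -
  have "(\<Sum>a\<in>C. \<Sum>b\<in>C. \<mu> a * \<mu> b * (x a - x b)\<^sup>2)
      = (\<Sum>a\<in>C. \<Sum>b\<in>C. (\<mu> a * (x a)\<^sup>2) * \<mu> b + \<mu> a * (\<mu> b * (x b)\<^sup>2) - 2 * ((\<mu> a * x a) * (\<mu> b * x b)))"
    by (simp add: power2_eq_square algebra_simps)
  also have "\<dots> = 2 * (\<Sum>a\<in>C. \<mu> a * (x a)\<^sup>2) - 2 * (\<Sum>a\<in>C. \<mu> a * x a)\<^sup>2"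
    using assms
    by (simp add: sum.distrib sum_subtractf sum_distrib_left[symmetric] sum_distrib_right[symmetric]
        sum_product[symmetric] power2_eq_square)
  finally show ?thesis by (simp add: diff_divide_distrib)
qed

text \<open>
  The law of an \<open>\<alpha>\<close>-balanced integer with values in \<open>C\<close>.
\<close>

definition balanced_weights :: "nat \<Rightarrow> real \<Rightarrow> int set \<Rightarrow> (int \<Rightarrow> real) \<Rightarrow> bool" where
  "balanced_weights p \<alpha> C \<mu> \<longleftrightarrow> finite C \<and> (\<forall>c\<in>C. 0 \<le> \<mu> c) \<and> sum \<mu> C = 1 \<and>
     (\<forall>r. sum \<mu> {c \<in> C. [c = r] (mod int p)} \<le> 1 - \<alpha>)"

text \<open>
  By \<open>square_weighted_mean\<close> the loss of squared norm is half the expected squared distance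
  between the shifts of \<open>f\<close> by two independent samples \<open>a\<close>, \<open>b\<close> of the law. Balancedness says
  that \<open>a\<close> and \<open>b\<close> differ modulo \<open>p\<close> with probability at least \<open>\<alpha>\<close>. Then \<open>b - a\<close> is a unit modulo
  \<open>p ^ m\<close>, and \<open>cyclic_poincare\<close> bounds that distance from below.
\<close>

lemma balanced_convolution_contracts:
  assumes f: "periodic M f" and zero: "(\<Sum>s\<in>{0..<int M}. f s) = 0"
    and p: "prime p" and M: "M = p ^ m" and bal: "balanced_weights p \<alpha> C \<mu>"
  shows "(\<Sum>s\<in>{0..<int M}. (\<Sum>c\<in>C. \<mu> c * f (s - c))\<^sup>2)
       \<le> (1 - \<alpha> / (real M)\<^sup>2) * (\<Sum>s\<in>{0..<int M}. (f s)\<^sup>2)"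
proof -
  let ?I = "{0..<int M}"
  let ?E = "\<Sum>s\<in>?I. (f s)\<^sup>2"
  let ?D = "\<lambda>a b. \<Sum>s\<in>?I. (f (s - a) - f (s - b))\<^sup>2"
  have C: "finite C" "\<And>c. c \<in> C \<Longrightarrow> 0 \<le> \<mu> c" "sum \<mu> C = 1"
    and lim: "\<And>r. sum \<mu> {c \<in> C. [c = r] (mod int p)} \<le> 1 - \<alpha>"
    using bal by (auto simp: balanced_weights_def)
  have M0: "M > 0" using p M by (simp add: prime_gt_0_nat)
  have perE: "periodic M (\<lambda>s. (f s)\<^sup>2)" using f unfolding periodic_def by simp
  have E0: "0 \<le> ?E" by (simp add: sum_nonneg)
  have D: "2 * ?E / (real M)\<^sup>2 * of_bool (\<not> [b = a] (mod int p)) \<le> ?D a b" for a b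
  proof (cases "[b = a] (mod int p)")
    case True
    then show ?thesis by (simp add: sum_nonneg)
  next
    case False
    then have "\<not> int p dvd (b - a)" by (simp add: cong_iff_dvd_diff)
    then have "coprime (int p) (b - a)" using p by (simp add: prime_imp_coprime_int)
    then have cop: "coprime (b - a) (int M)" unfolding M by (simp add: coprime_commute)
    have "periodic M (\<lambda>s. (f (s + (b - a)) - f s)\<^sup>2)"
      using f unfolding periodic_def by (metis add.assoc add.commute)
    from sum_periodic_shift[OF this, of "- b"]
    have "?D a b = (\<Sum>s\<in>?I. (f (s + (b - a)) - f s)\<^sup>2)" by (simp add: algebra_simps)
    then have "2 * ?E \<le> (real M)\<^sup>2 * ?D a b" using cyclic_poincare[OF f zero cop M0] by simp
    then show ?thesis using False M0 by (simp add: divide_le_eq mult.commute)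
  qed
  have pairs: "\<alpha> \<le> (\<Sum>a\<in>C. \<Sum>b\<in>C. \<mu> a * \<mu> b * of_bool (\<not> [b = a] (mod int p)))"
  proof -
    have "\<alpha> = (\<Sum>a\<in>C. \<mu> a * \<alpha>)" using C by (simp add: sum_distrib_right[symmetric])
    also have "\<dots> \<le> (\<Sum>a\<in>C. \<mu> a * (\<Sum>b\<in>C. \<mu> b * of_bool (\<not> [b = a] (mod int p))))"
    proof (intro sum_mono mult_left_mono)
      fix a assume "a \<in> C"
      have "(\<Sum>b\<in>C. \<mu> b * of_bool (\<not> [b = a] (mod int p)))
          = (\<Sum>b\<in>C. \<mu> b - (if [b = a] (mod int p) then \<mu> b else 0))"
        by (intro sum.cong) auto
      also have "\<dots> = 1 - sum \<mu> {b \<in> C. [b = a] (mod int p)}"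
        using C by (simp add: sum_subtractf sum.inter_filter)
      finally show "\<alpha> \<le> (\<Sum>b\<in>C. \<mu> b * of_bool (\<not> [b = a] (mod int p)))"
        using lim[of a] by simp
    qed (use C in auto)
    finally show ?thesis by (simp add: sum_distrib_left mult.assoc)
  qed
  have "(\<Sum>s\<in>?I. (\<Sum>c\<in>C. \<mu> c * f (s - c))\<^sup>2)
     = (\<Sum>s\<in>?I. \<Sum>a\<in>C. \<mu> a * (f (s - a))\<^sup>2)
       - (\<Sum>s\<in>?I. \<Sum>a\<in>C. \<Sum>b\<in>C. \<mu> a * \<mu> b * (f (s - a) - f (s - b))\<^sup>2) / 2"
    by (simp add: square_weighted_mean[OF C(3)] sum_subtractf sum_divide_distrib)
  also have "(\<Sum>s\<in>?I. \<Sum>a\<in>C. \<mu> a * (f (s - a))\<^sup>2) = (\<Sum>a\<in>C. \<mu> a * (\<Sum>s\<in>?I. (f (s - a))\<^sup>2))"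
    by (subst sum.swap) (simp add: sum_distrib_left)
  also have "\<dots> = ?E"
    using sum_periodic_shift[OF perE, of "- _"] C by (simp add: sum_distrib_right[symmetric])
  also have "(\<Sum>s\<in>?I. \<Sum>a\<in>C. \<Sum>b\<in>C. \<mu> a * \<mu> b * (f (s - a) - f (s - b))\<^sup>2)
      = (\<Sum>a\<in>C. \<Sum>b\<in>C. \<mu> a * \<mu> b * ?D a b)"
    by (subst sum.swap, rule sum.cong[OF refl], subst sum.swap) (simp add: sum_distrib_left)
  finally have eq: "(\<Sum>s\<in>?I. (\<Sum>c\<in>C. \<mu> c * f (s - c))\<^sup>2)
      = ?E - (\<Sum>a\<in>C. \<Sum>b\<in>C. \<mu> a * \<mu> b * ?D a b) / 2" .
  have "2 * ?E / (real M)\<^sup>2 * \<alpha>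
      \<le> 2 * ?E / (real M)\<^sup>2 * (\<Sum>a\<in>C. \<Sum>b\<in>C. \<mu> a * \<mu> b * of_bool (\<not> [b = a] (mod int p)))"
    using pairs E0 by (intro mult_left_mono) auto
  also have "\<dots> = (\<Sum>a\<in>C. \<Sum>b\<in>C. \<mu> a * \<mu> b * (2 * ?E / (real M)\<^sup>2 * of_bool (\<not> [b = a] (mod int p))))"
    unfolding sum_distrib_left[of "2 * ?E / (real M)\<^sup>2"] by (simp only: ac_simps)
  also have "\<dots> \<le> (\<Sum>a\<in>C. \<Sum>b\<in>C. \<mu> a * \<mu> b * ?D a b)"
    using D C by (intro sum_mono mult_left_mono) auto
  finally show ?thesis unfolding eq by (simp add: algebra_simps)
qed

text \<open>
  A deviation \<open>x\<close> at one point is compensated by a total of \<open>- x\<close> on the other \<open>M - 1\<close> points, which by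
  Cauchy-Schwarz costs at least \<open>x\<^sup>2 / (M - 1)\<close> more in the squared norm. Keeping this term yields the
  factor \<open>1 - 1 / M\<close>: for \<open>\<kappa> = 1\<close> the bound then says only that \<open>\<pi> s \<le> 1\<close>, so that even a
  single weakly balanced summand gives a point bound below \<open>1\<close>.
\<close>

lemma deviation_from_uniform:
  fixes \<pi> :: "int \<Rightarrow> real"
  assumes M: "M > 0" and one: "(\<Sum>s\<in>{0..<int M}. \<pi> s) = 1" and s: "s \<in> {0..<int M}"
    and var: "(\<Sum>s\<in>{0..<int M}. (\<pi> s - 1 / real M)\<^sup>2) \<le> (1 - 1 / real M) * \<kappa>\<^sup>2" and \<kappa>: "\<kappa> \<ge> 0"
  shows "\<bar>\<pi> s - 1 / real M\<bar> \<le> (1 - 1 / real M) * \<kappa>"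
proof -
  let ?I = "{0..<int M}" and ?f = "\<lambda>s. \<pi> s - 1 / real M"
  define x where "x = ?f s"
  have "(\<Sum>t\<in>?I. ?f t) = 0" using one M by (simp add: sum_subtractf)
  then have rest: "(\<Sum>t\<in>?I - {s}. ?f t) = - x"
    using s by (simp add: sum.remove[of ?I s] x_def)
  have c: "real (card (?I - {s})) = real M - 1" using s M by (simp add: of_nat_diff)
  have "(\<Sum>t\<in>?I - {s}. 1 * ?f t)\<^sup>2 \<le> (\<Sum>t\<in>?I - {s}. 1\<^sup>2) * (\<Sum>t\<in>?I - {s}. (?f t)\<^sup>2)"
    by (rule Cauchy_Schwarz_ineq_sum)
  then have x1: "x\<^sup>2 \<le> (real M - 1) * (\<Sum>t\<in>?I - {s}. (?f t)\<^sup>2)" using rest c by simp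
  have split: "(\<Sum>t\<in>?I. (?f t)\<^sup>2) = x\<^sup>2 + (\<Sum>t\<in>?I - {s}. (?f t)\<^sup>2)"
    using s by (simp add: sum.remove[of ?I s] x_def)
  have M1: "real M \<ge> 1" using M by simp
  have "real M * x\<^sup>2 \<le> (real M - 1) * (\<Sum>t\<in>?I. (?f t)\<^sup>2)"
    using x1 split by (simp add: algebra_simps)
  also have "\<dots> \<le> (real M - 1) * ((1 - 1 / real M) * \<kappa>\<^sup>2)"
    using var M1 by (intro mult_left_mono) auto
  also have "\<dots> = real M * ((1 - 1 / real M) * \<kappa>)\<^sup>2"
    using M by (simp add: field_simps power2_eq_square)
  finally have "x\<^sup>2 \<le> ((1 - 1 / real M) * \<kappa>)\<^sup>2" using M by simp
  then have "\<bar>x\<bar> \<le> \<bar>(1 - 1 / real M) * \<kappa>\<bar>" by (simp add: abs_le_square_iff)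
  also have "\<dots> = (1 - 1 / real M) * \<kappa>" using \<kappa> M1 by (intro abs_of_nonneg mult_nonneg_nonneg) auto
  finally show ?thesis by (simp add: x_def)
qed

section \<open>Random products in a finite abelian group\<close>

text \<open>
  The expected value of \<open>f\<close> at \<open>x\<close> times the random product of the powers \<open>g i [^] c i\<close> over \<open>i \<in> I\<close>,
  where the exponents \<open>c i\<close> are independent with laws \<open>\<mu> i\<close> on \<open>C\<close>. With \<open>f\<close> the indicator of the
  identity and \<open>x\<close> the identity, it is the probability that the product is trivial.
\<close>

definition walk_mean ::
  "('g, 'c) monoid_scheme \<Rightarrow> int set \<Rightarrow> ('i \<Rightarrow> int \<Rightarrow> real) \<Rightarrow> ('i \<Rightarrow> 'g) \<Rightarrow> 'i set
     \<Rightarrow> ('g \<Rightarrow> real) \<Rightarrow> 'g \<Rightarrow> real" where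
  "walk_mean G C \<mu> g I f x =
     (\<Sum>c\<in>PiE I (\<lambda>_. C). (\<Prod>i\<in>I. \<mu> i (c i)) * f (x \<otimes>\<^bsub>G\<^esub> (\<Otimes>\<^bsub>G\<^esub>i\<in>I. g i [^]\<^bsub>G\<^esub> c i)))"

context comm_group
begin

lemma walk_mean_empty: "x \<in> carrier G \<Longrightarrow> walk_mean G C \<mu> g {} f x = f x"
  by (simp add: walk_mean_def)

lemma walk_mean_insert:
  fixes g :: "'i \<Rightarrow> 'a"
  assumes I: "finite I" "i \<notin> I" and g: "g i \<in> carrier G" "\<And>i. i \<in> I \<Longrightarrow> g i \<in> carrier G"
    and x: "x \<in> carrier G"
  shows "walk_mean G C \<mu> g (insert i I) f x = (\<Sum>c\<in>C. \<mu> i c * walk_mean G C \<mu> g I f (x \<otimes> g i [^] c))"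
proof -
  let ?P = "PiE I (\<lambda>_. C)"
  let ?X = "\<lambda>c. \<Otimes>i\<in>I. g i [^] c i"
  have upd: "(\<Prod>j\<in>insert i I. \<mu> j ((c(i := y)) j)) = \<mu> i y * (\<Prod>j\<in>I. \<mu> j (c j))"
    "(\<Otimes>j\<in>insert i I. g j [^] (c(i := y)) j) = g i [^] y \<otimes> ?X c" for c :: "'i \<Rightarrow> int" and y
  proof -
    have "(\<Prod>j\<in>I. \<mu> j ((c(i := y)) j)) = (\<Prod>j\<in>I. \<mu> j (c j))"
      using I by (intro prod.cong) auto
    then show "(\<Prod>j\<in>insert i I. \<mu> j ((c(i := y)) j)) = \<mu> i y * (\<Prod>j\<in>I. \<mu> j (c j))"
      using I by simp
    have "(\<Otimes>j\<in>I. g j [^] (c(i := y)) j) = ?X c"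
      using I g by (intro finprod_cong') auto
    moreover have "(\<Otimes>j\<in>insert i I. g j [^] (c(i := y)) j)
        = g i [^] (c(i := y)) i \<otimes> (\<Otimes>j\<in>I. g j [^] (c(i := y)) j)"
      using I g by (intro finprod_insert) auto
    ultimately show "(\<Otimes>j\<in>insert i I. g j [^] (c(i := y)) j) = g i [^] y \<otimes> ?X c" by simp
  qed
  have "walk_mean G C \<mu> g (insert i I) f x
      = (\<Sum>(y, c)\<in>C \<times> ?P. \<mu> i y * (\<Prod>j\<in>I. \<mu> j (c j)) * f (x \<otimes> (g i [^] y \<otimes> ?X c)))"
    unfolding walk_mean_def PiE_insert_eq sum.reindex[OF inj_combinator[OF I(2), of "\<lambda>_. C"]] o_def
    by (rule sum.cong[OF refl]) (simp only: split_def upd)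
  also have "\<dots> = (\<Sum>y\<in>C. \<Sum>c\<in>?P. \<mu> i y * (\<Prod>j\<in>I. \<mu> j (c j)) * f (x \<otimes> (g i [^] y \<otimes> ?X c)))"
    by (simp add: sum.cartesian_product)
  also have "\<dots> = (\<Sum>y\<in>C. \<mu> i y * walk_mean G C \<mu> g I f (x \<otimes> g i [^] y))"
    unfolding walk_mean_def sum_distrib_left
    using g x by (intro sum.cong refl) (simp add: m_assoc finprod_closed Pi_def mult.assoc)
  finally show ?thesis .
qed

lemma walk_mean_union:
  assumes "finite I" "finite J" "I \<inter> J = {}" and "\<And>i. i \<in> I \<union> J \<Longrightarrow> g i \<in> carrier G"
    and "x \<in> carrier G"
  shows "walk_mean G C \<mu> g (I \<union> J) f x = walk_mean G C \<mu> g I (walk_mean G C \<mu> g J f) x"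
  using assms
proof (induction I arbitrary: x rule: finite_induct)
  case empty
  then show ?case by (simp add: walk_mean_empty)
next
  case (insert i I)
  have "walk_mean G C \<mu> g (insert i (I \<union> J)) f x
      = (\<Sum>c\<in>C. \<mu> i c * walk_mean G C \<mu> g (I \<union> J) f (x \<otimes> g i [^] c))"
    by (rule walk_mean_insert) (use insert in auto)
  also have "\<dots> = (\<Sum>c\<in>C. \<mu> i c * walk_mean G C \<mu> g I (walk_mean G C \<mu> g J f) (x \<otimes> g i [^] c))"
    using insert by (intro sum.cong refl arg_cong2[where f = "(*)"]) auto
  also have "\<dots> = walk_mean G C \<mu> g (insert i I) (walk_mean G C \<mu> g J f) x"
    by (rule walk_mean_insert[symmetric]) (use insert in auto)
  finally show ?case by simp
qed

lemma walk_mean_nonneg: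
  assumes "\<And>i c. i \<in> I \<Longrightarrow> c \<in> C \<Longrightarrow> 0 \<le> \<mu> i c" and "\<And>i. i \<in> I \<Longrightarrow> g i \<in> carrier G"
    and "x \<in> carrier G" and "\<And>y. y \<in> carrier G \<Longrightarrow> 0 \<le> f y"
  shows "0 \<le> walk_mean G C \<mu> g I f x"
  unfolding walk_mean_def using assms
  by (intro sum_nonneg mult_nonneg_nonneg prod_nonneg) (auto simp: Pi_def PiE_def)

lemma sum_translate:
  assumes K: "subgroup K G" and a: "a \<in> K"
  shows "(\<Sum>x\<in>K. f (x \<otimes> a)) = (\<Sum>x\<in>K. f x)"
proof -
  have "K \<subseteq> carrier G" using K by (rule subgroup.subset)
  then have inv: "x \<otimes> inv a \<otimes> a = x" "x \<otimes> a \<otimes> inv a = x" if "x \<in> K" for x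
    using that a by (auto simp: m_assoc subset_iff)
  show ?thesis
    by (rule sum.reindex_bij_witness[where i = "\<lambda>x. x \<otimes> inv a" and j = "\<lambda>x. x \<otimes> a"])
       (use K a inv in \<open>auto simp: subgroup.m_closed subgroup.m_inv_closed\<close>)
qed

lemma sum_walk_mean:
  assumes "finite I" and "\<And>i. i \<in> I \<Longrightarrow> g i \<in> carrier G" and "\<And>i. i \<in> I \<Longrightarrow> sum (\<mu> i) C = 1"
  shows "(\<Sum>x\<in>carrier G. walk_mean G C \<mu> g I f x) = (\<Sum>x\<in>carrier G. f x)"
  using assms
proof (induction I rule: finite_induct)
  case empty
  then show ?case by (simp add: walk_mean_empty)
next
  case (insert i I)
  have "(\<Sum>x\<in>carrier G. walk_mean G C \<mu> g (insert i I) f x)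
      = (\<Sum>x\<in>carrier G. \<Sum>c\<in>C. \<mu> i c * walk_mean G C \<mu> g I f (x \<otimes> g i [^] c))"
    using insert by (intro sum.cong refl walk_mean_insert) auto
  also have "\<dots> = (\<Sum>c\<in>C. \<mu> i c * (\<Sum>x\<in>carrier G. walk_mean G C \<mu> g I f (x \<otimes> g i [^] c)))"
    by (subst sum.swap) (simp add: sum_distrib_left)
  also have "\<dots> = (\<Sum>c\<in>C. \<mu> i c * (\<Sum>x\<in>carrier G. walk_mean G C \<mu> g I f x))"
    using insert.prems by (simp add: sum_translate[OF subgroup_self])
  also have "\<dots> = (\<Sum>x\<in>carrier G. f x)"
    using insert by (simp add: sum_distrib_right[symmetric])
  finally show ?case .
qed

text \<open>
  When all entries of the block are the same element \<open>h\<close>, only the sum of the exponents matters, and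
  only modulo a period \<open>M\<close> of \<open>f\<close> along \<open>h\<close>. Here \<open>\<pi>\<close> is the law of that sum modulo \<open>M\<close>. Each further
  index convolves \<open>\<pi>\<close> with a balanced law, which contracts its distance from the uniform
  law.
\<close>

lemma walk_mean_block:
  assumes p: "prime p" and M: "M = p ^ m"
    and I: "finite I" and bal: "\<And>i. i \<in> I \<Longrightarrow> balanced_weights p \<alpha> C (\<mu> i)"
    and h: "h \<in> carrier G" and g: "\<And>i. i \<in> I \<Longrightarrow> g i = h"
    and f: "\<And>x. x \<in> carrier G \<Longrightarrow> f (x \<otimes> h [^] int M) = f x"
  shows "\<exists>\<pi>. periodic M \<pi> \<and> (\<Sum>s\<in>{0..<int M}. \<pi> s) = 1 \<and>
      (\<Sum>s\<in>{0..<int M}. (\<pi> s - 1 / real M)\<^sup>2)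
          \<le> (1 - 1 / real M) * (1 - \<alpha> / (real M)\<^sup>2) ^ card I \<and>
      (\<forall>x\<in>carrier G. walk_mean G C \<mu> g I f x = (\<Sum>s\<in>{0..<int M}. \<pi> s * f (x \<otimes> h [^] s)))"
  using I bal g
proof (induction I rule: finite_induct)
  case empty
  \<comment> \<open>The empty sum of exponents has a point mass as its law, at squared distance \<open>1 - 1 / M\<close> from uniform.\<close>
  let ?\<pi> = "\<lambda>s. of_bool (s mod int M = 0) :: real"
  have M0: "M > 0" using p M by (simp add: prime_gt_0_nat)
  have delta: "(\<Sum>s\<in>{0..<int M}. ?\<pi> s * F s) = F 0" for F
  proof -
    have "(\<Sum>s\<in>{0..<int M}. ?\<pi> s * F s) = (\<Sum>s\<in>{0..<int M}. if s = 0 then F s else 0)"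
      by (intro sum.cong) auto
    then show ?thesis using M0 by simp
  qed
  have "(\<Sum>s\<in>{0..<int M}. (?\<pi> s - 1 / real M)\<^sup>2)
      = (\<Sum>s\<in>{0..<int M}. ?\<pi> s * (1 - 2 / real M) + 1 / (real M)\<^sup>2)"
    by (intro sum.cong refl) (simp add: power2_eq_square algebra_simps)
  also have "\<dots> = (1 - 2 / real M) + real M * (1 / (real M)\<^sup>2)"
    unfolding sum.distrib delta by simp
  also have "\<dots> = 1 - 1 / real M"
    using M0 by (simp add: power2_eq_square field_simps)
  finally have "(\<Sum>s\<in>{0..<int M}. (?\<pi> s - 1 / real M)\<^sup>2) = 1 - 1 / real M" .
  then show ?case
    using delta[of "\<lambda>_. 1"] h
    by (intro exI[of _ ?\<pi>]) (auto simp: periodic_def walk_mean_empty delta)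
next
  case (insert i I)
  then obtain \<pi> where \<pi>: "periodic M \<pi>" "(\<Sum>s\<in>{0..<int M}. \<pi> s) = 1"
    and var: "(\<Sum>s\<in>{0..<int M}. (\<pi> s - 1 / real M)\<^sup>2)
          \<le> (1 - 1 / real M) * (1 - \<alpha> / (real M)\<^sup>2) ^ card I"
    and rep: "\<And>x. x \<in> carrier G \<Longrightarrow>
          walk_mean G C \<mu> g I f x = (\<Sum>s\<in>{0..<int M}. \<pi> s * f (x \<otimes> h [^] s))"
    by auto
  have M0: "M > 0" using p M by (simp add: prime_gt_0_nat)
  have bal: "balanced_weights p \<alpha> C (\<mu> i)" using insert by simp
  then have total: "sum (\<mu> i) C = 1" and C: "finite C" "\<And>c. c \<in> C \<Longrightarrow> 0 \<le> \<mu> i c"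
    by (auto simp: balanced_weights_def)
  have \<alpha>: "\<alpha> \<le> 1"
  proof -
    have "0 \<le> sum (\<mu> i) {c \<in> C. [c = 0] (mod int p)}" using C by (intro sum_nonneg) auto
    also have "\<dots> \<le> 1 - \<alpha>" using bal by (auto simp: balanced_weights_def)
    finally show ?thesis by simp
  qed
  define \<pi>' where "\<pi>' = (\<lambda>s. \<Sum>c\<in>C. \<mu> i c * \<pi> (s - c))"
  have shift_c: "\<pi> (s + int M - c) = \<pi> (s - c)" for s c
    using \<pi>(1) unfolding periodic_def by (metis add_diff_eq diff_add_eq)
  then have "periodic M \<pi>'" unfolding periodic_def \<pi>'_def by simp
  moreover have "(\<Sum>s\<in>{0..<int M}. \<pi>' s) = 1"
  proof -
    have "(\<Sum>s\<in>{0..<int M}. \<pi>' s) = (\<Sum>c\<in>C. \<mu> i c * (\<Sum>s\<in>{0..<int M}. \<pi> (s + - c)))"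
      unfolding \<pi>'_def by (subst sum.swap) (simp add: sum_distrib_left)
    then show ?thesis using total unfolding sum_periodic_shift[OF \<pi>(1)] \<pi>(2) by simp
  qed
  moreover have "(\<Sum>s\<in>{0..<int M}. (\<pi>' s - 1 / real M)\<^sup>2)
          \<le> (1 - 1 / real M) * (1 - \<alpha> / (real M)\<^sup>2) ^ card (insert i I)"
  proof -
    have "\<pi>' s - 1 / real M = (\<Sum>c\<in>C. \<mu> i c * (\<pi> (s - c) - 1 / real M))" for s
      using total by (simp add: \<pi>'_def right_diff_distrib sum_subtractf sum_divide_distrib[symmetric])
    then have "(\<Sum>s\<in>{0..<int M}. (\<pi>' s - 1 / real M)\<^sup>2)
        = (\<Sum>s\<in>{0..<int M}. (\<Sum>c\<in>C. \<mu> i c * (\<pi> (s - c) - 1 / real M))\<^sup>2)" by simp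
    also have "\<dots> \<le> (1 - \<alpha> / (real M)\<^sup>2) * (\<Sum>s\<in>{0..<int M}. (\<pi> s - 1 / real M)\<^sup>2)"
      by (rule balanced_convolution_contracts[OF _ _ p M bal])
         (use \<pi> M0 in \<open>simp_all add: periodic_def sum_subtractf\<close>)
    also have "\<dots> \<le> (1 - \<alpha> / (real M)\<^sup>2) *
        ((1 - 1 / real M) * (1 - \<alpha> / (real M)\<^sup>2) ^ card I)"
    proof (intro mult_left_mono var)
      have "1 \<le> (real M)\<^sup>2" using M0 by simp
      with \<alpha> have "\<alpha> \<le> (real M)\<^sup>2" by linarith
      then show "0 \<le> 1 - \<alpha> / (real M)\<^sup>2" using M0 by (simp add: divide_le_eq)
    qed
    also have "\<dots> = (1 - 1 / real M) * (1 - \<alpha> / (real M)\<^sup>2) ^ card (insert i I)"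
    proof -
      have c: "card (insert i I) = Suc (card I)" using insert.hyps by simp
      show ?thesis unfolding c power_Suc by (simp only: ac_simps)
    qed
    finally show ?thesis .
  qed
  moreover have "walk_mean G C \<mu> g (insert i I) f x = (\<Sum>s\<in>{0..<int M}. \<pi>' s * f (x \<otimes> h [^] s))"
    if x: "x \<in> carrier G" for x
  proof -
    have "periodic M (\<lambda>s. \<pi> (s - c) * f (x \<otimes> h [^] s))" for c
      unfolding periodic_def
    proof
      fix s
      have "f (x \<otimes> h [^] (s + int M)) = f (x \<otimes> h [^] s \<otimes> h [^] int M)"
        using x h by (simp add: int_pow_mult m_assoc)
      then show "\<pi> (s + int M - c) * f (x \<otimes> h [^] (s + int M)) = \<pi> (s - c) * f (x \<otimes> h [^] s)"
        using f x h shift_c by simp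
    qed
    note shift = sum_periodic_shift[OF this]
    have "walk_mean G C \<mu> g (insert i I) f x
        = (\<Sum>c\<in>C. \<mu> i c * walk_mean G C \<mu> g I f (x \<otimes> h [^] c))"
      using insert x h by (subst walk_mean_insert) auto
    also have "\<dots> = (\<Sum>c\<in>C. \<mu> i c * (\<Sum>s\<in>{0..<int M}. \<pi> (s + c - c) * f (x \<otimes> h [^] (s + c))))"
      using x h rep by (simp add: int_pow_mult m_ac)
    also have "\<dots> = (\<Sum>c\<in>C. \<mu> i c * (\<Sum>s\<in>{0..<int M}. \<pi> (s - c) * f (x \<otimes> h [^] s)))"
      unfolding shift ..
    also have "\<dots> = (\<Sum>s\<in>{0..<int M}. \<pi>' s * f (x \<otimes> h [^] s))"
      unfolding \<pi>'_def sum_distrib_left sum_distrib_right by (subst sum.swap) (simp add: mult.assoc)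
    finally show ?thesis .
  qed
  ultimately show ?case by blast
qed

lemma walk_mean_block_near_uniform:
  assumes p: "prime p" and M: "M = p ^ m" and I: "finite I"
    and bal: "\<And>i. i \<in> I \<Longrightarrow> balanced_weights p \<alpha> C (\<mu> i)"
    and h: "h \<in> carrier G" and g: "\<And>i. i \<in> I \<Longrightarrow> g i = h"
    and f: "\<And>x. x \<in> carrier G \<Longrightarrow> f (x \<otimes> h [^] int M) = f x"
    and \<alpha>: "\<alpha> \<le> 1"
  obtains \<pi> where
    "\<And>s. s \<in> {0..<int M} \<Longrightarrow>
       \<bar>\<pi> s - 1 / real M\<bar> \<le> (1 - 1 / real M) * exp (- \<alpha> * real (card I) / (2 * (real M)\<^sup>2))"
    "\<And>x. x \<in> carrier G \<Longrightarrow> walk_mean G C \<mu> g I f x = (\<Sum>s\<in>{0..<int M}. \<pi> s * f (x \<otimes> h [^] s))"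
proof -
  from walk_mean_block[where f = f and g = g and \<mu> = \<mu> and I = I, OF p M I bal h g f] obtain \<pi> where
    \<pi>: "(\<Sum>s\<in>{0..<int M}. \<pi> s) = 1"
    and var: "(\<Sum>s\<in>{0..<int M}. (\<pi> s - 1 / real M)\<^sup>2)
          \<le> (1 - 1 / real M) * (1 - \<alpha> / (real M)\<^sup>2) ^ card I"
    and rep: "\<forall>x\<in>carrier G. walk_mean G C \<mu> g I f x = (\<Sum>s\<in>{0..<int M}. \<pi> s * f (x \<otimes> h [^] s))"
    by auto
  have M0: "M > 0" using p M by (simp add: prime_gt_0_nat)
  let ?\<kappa> = "exp (- \<alpha> * real (card I) / (2 * (real M)\<^sup>2))"
  have "1 \<le> (real M)\<^sup>2" using M0 by simp
  with \<alpha> have "\<alpha> \<le> (real M)\<^sup>2" by linarith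
  then have nn: "0 \<le> 1 - \<alpha> / (real M)\<^sup>2" using M0 by (simp add: divide_le_eq)
  have "(1 - \<alpha> / (real M)\<^sup>2) ^ card I \<le> exp (- \<alpha> / (real M)\<^sup>2) ^ card I"
    using exp_ge_add_one_self[of "- \<alpha> / (real M)\<^sup>2"] nn by (intro power_mono) auto
  also have "\<dots> = ?\<kappa>\<^sup>2"
    by (simp add: exp_of_nat_mult[symmetric] field_simps)
  finally have "(1 - 1 / real M) * (1 - \<alpha> / (real M)\<^sup>2) ^ card I \<le> (1 - 1 / real M) * ?\<kappa>\<^sup>2"
    using M0 by (intro mult_left_mono) auto
  with var have var': "(\<Sum>s\<in>{0..<int M}. (\<pi> s - 1 / real M)\<^sup>2) \<le> (1 - 1 / real M) * ?\<kappa>\<^sup>2"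
    by linarith
  show thesis
    by (rule that[of \<pi>]) (use deviation_from_uniform[OF M0 \<pi> _ var'] rep in auto)
qed

text \<open>
  For each \<open>h \<in> Q\<close> the sum of the exponents at \<open>h\<close> is uniform modulo \<open>N\<close> up to \<open>e\<close>, so applying the
  block of \<open>h\<close> is, up to a factor between \<open>1 - N * e\<close> and \<open>1 + N * e\<close>, the same as averaging over the
  cosets of the cyclic group generated by \<open>h\<close>. The function \<open>F\<close> is the result of performing these exact
  averages for all \<open>h \<in> Q\<close>. It is therefore invariant under \<open>Q\<close>, and its sums over subgroups containing \<open>Q\<close>
  are those of \<open>f\<close>. These two properties determine \<open>F\<close> on the subgroup generated by \<open>Q\<close>.
\<close>

lemma walk_mean_popular:
  assumes p: "prime p" and N: "N = p ^ m" and I: "finite I" "\<And>i. i \<in> I \<Longrightarrow> g i \<in> carrier G"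
    and bal: "\<And>i. i \<in> I \<Longrightarrow> balanced_weights p \<alpha> C (\<mu> i)"
    and Q: "finite Q" "Q \<subseteq> carrier G" and ord: "\<And>h. h \<in> Q \<Longrightarrow> h [^] int N = \<one>"
    and \<alpha>: "\<alpha> \<le> 1" and e: "0 \<le> e"
    and pop: "\<And>h. h \<in> Q \<Longrightarrow> exp (- \<alpha> * real (card {i \<in> I. g i = h}) / (2 * (real N)\<^sup>2)) \<le> e"
    and f: "\<And>x. x \<in> carrier G \<Longrightarrow> 0 \<le> f x"
  shows "\<exists>F. (\<forall>x\<in>carrier G. 0 \<le> F x \<and>
          walk_mean G C \<mu> g {i \<in> I. g i \<in> Q} f x \<le> (1 + N * e) ^ card Q * F x \<and>
          (N * e \<le> 1 \<longrightarrow> (1 - N * e) ^ card Q * F x \<le> walk_mean G C \<mu> g {i \<in> I. g i \<in> Q} f x)) \<and>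
        (\<forall>h\<in>Q. \<forall>x\<in>carrier G. F (x \<otimes> h) = F x) \<and>
        (\<forall>K. subgroup K G \<longrightarrow> Q \<subseteq> K \<longrightarrow> (\<Sum>x\<in>K. F x) = (\<Sum>x\<in>K. f x))"
  using Q ord pop
proof (induction Q rule: finite_induct)
  case empty
  then show ?case using f by (intro exI[of _ f]) (auto simp: walk_mean_empty)
next
  case (insert h Q)
  let ?IQ = "{i \<in> I. g i \<in> Q}" and ?Ih = "{i \<in> I. g i = h}"
  let ?L = "walk_mean G C \<mu> g ?IQ f"
  obtain F where F0: "\<And>x. x \<in> carrier G \<Longrightarrow> 0 \<le> F x"
    and FU: "\<And>x. x \<in> carrier G \<Longrightarrow> ?L x \<le> (1 + N * e) ^ card Q * F x"
    and FL: "\<And>x. N * e \<le> 1 \<Longrightarrow> x \<in> carrier G \<Longrightarrow> (1 - N * e) ^ card Q * F x \<le> ?L x"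
    and Finv: "\<And>h x. h \<in> Q \<Longrightarrow> x \<in> carrier G \<Longrightarrow> F (x \<otimes> h) = F x"
    and Fsum: "\<And>K. subgroup K G \<Longrightarrow> Q \<subseteq> K \<Longrightarrow> (\<Sum>x\<in>K. F x) = (\<Sum>x\<in>K. f x)"
    using insert.IH insert.prems by auto blast
  have h: "h \<in> carrier G" "h [^] int N = \<one>" using insert by auto
  have N0: "N > 0" using p N by (simp add: prime_gt_0_nat)
  have balE: "0 \<le> \<mu> i c" if "i \<in> I" "c \<in> C" for i c
    using bal[OF that(1)] that(2) by (auto simp: balanced_weights_def)
  have L0: "0 \<le> ?L x" if "x \<in> carrier G" for x
    using that I f balE by (intro walk_mean_nonneg) auto
  obtain \<pi> where \<pi>: "\<And>s. s \<in> {0..<int N} \<Longrightarrow>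
       \<bar>\<pi> s - 1 / real N\<bar> \<le> (1 - 1 / real N) * exp (- \<alpha> * real (card ?Ih) / (2 * (real N)\<^sup>2))"
    and rep: "\<And>x. x \<in> carrier G \<Longrightarrow> walk_mean G C \<mu> g ?Ih ?L x = (\<Sum>s\<in>{0..<int N}. \<pi> s * ?L (x \<otimes> h [^] s))"
    by (rule walk_mean_block_near_uniform[OF p N, of ?Ih \<alpha> C \<mu> h g ?L]) (use I bal h \<alpha> in auto)
  have near: "\<bar>\<pi> s - 1 / real N\<bar> \<le> e" if "s \<in> {0..<int N}" for s
  proof -
    have "\<bar>\<pi> s - 1 / real N\<bar> \<le> (1 - 1 / real N) * exp (- \<alpha> * real (card ?Ih) / (2 * (real N)\<^sup>2))"
      using \<pi> that .
    also have "\<dots> \<le> 1 * exp (- \<alpha> * real (card ?Ih) / (2 * (real N)\<^sup>2))"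
      by (intro mult_right_mono) auto
    also have "\<dots> \<le> e" using insert.prems(3)[of h] by simp
    finally show ?thesis .
  qed
  have split: "walk_mean G C \<mu> g {i \<in> I. g i \<in> insert h Q} f x = (\<Sum>s\<in>{0..<int N}. \<pi> s * ?L (x \<otimes> h [^] s))"
    if "x \<in> carrier G" for x
  proof -
    have "{i \<in> I. g i \<in> insert h Q} = ?Ih \<union> ?IQ" by auto
    then show ?thesis
      using walk_mean_union[of ?Ih ?IQ g x C \<mu> f] that I insert.hyps rep[OF that] by auto
  qed
  \<comment> \<open>The exact average over the cosets of the cyclic group generated by \<open>h\<close>.\<close>
  define F' where "F' = (\<lambda>x. (\<Sum>s\<in>{0..<int N}. F (x \<otimes> h [^] s)) / real N)"
  have F'0: "0 \<le> F' x" if "x \<in> carrier G" for x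
    unfolding F'_def using that h F0 by (intro divide_nonneg_nonneg sum_nonneg) auto
  have upper: "walk_mean G C \<mu> g {i \<in> I. g i \<in> insert h Q} f x \<le> (1 + N * e) ^ card (insert h Q) * F' x"
    if x: "x \<in> carrier G" for x
  proof -
    have "(\<Sum>s\<in>{0..<int N}. \<pi> s * ?L (x \<otimes> h [^] s))
        \<le> (\<Sum>s\<in>{0..<int N}. ((1 + N * e) / N) * ((1 + N * e) ^ card Q * F (x \<otimes> h [^] s)))"
    proof (intro sum_mono mult_mono)
      fix s assume s: "s \<in> {0..<int N}"
      have "\<pi> s \<le> 1 / N + e" using near[OF s] by linarith
      then show "\<pi> s \<le> (1 + N * e) / N" using N0 by (simp add: field_simps)
    qed (use x h FU L0 e N0 in auto)
    also have "\<dots> = (1 + N * e) ^ card (insert h Q) * F' x"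
      using insert.hyps unfolding F'_def sum_distrib_left[symmetric] by simp
    finally show ?thesis using split[OF x] by simp
  qed
  have lower: "(1 - N * e) ^ card (insert h Q) * F' x \<le> walk_mean G C \<mu> g {i \<in> I. g i \<in> insert h Q} f x"
    if x: "x \<in> carrier G" and Ne: "N * e \<le> 1" for x
  proof -
    have "(1 - N * e) ^ card (insert h Q) * F' x
        = (\<Sum>s\<in>{0..<int N}. ((1 - N * e) / N) * ((1 - N * e) ^ card Q * F (x \<otimes> h [^] s)))"
      using insert.hyps unfolding F'_def sum_distrib_left[symmetric] by simp
    also have "\<dots> \<le> (\<Sum>s\<in>{0..<int N}. \<pi> s * ?L (x \<otimes> h [^] s))"
    proof (intro sum_mono mult_mono)
      fix s assume s: "s \<in> {0..<int N}"
      have "1 / N - e \<le> \<pi> s" using near[OF s] by linarith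
      then show a: "(1 - N * e) / N \<le> \<pi> s" using N0 by (simp add: field_simps)
      have "0 \<le> (1 - N * e) / N" using Ne by simp
      with a show "0 \<le> \<pi> s" by linarith
    qed (use x h FL F0 Ne in auto)
    finally show ?thesis using split[OF x] by simp
  qed
  have inv_h: "F' (x \<otimes> h) = F' x" if x: "x \<in> carrier G" for x
  proof -
    have "periodic N (\<lambda>s. F (x \<otimes> h [^] s))"
      unfolding periodic_def using h by (simp add: int_pow_mult)
    from sum_periodic_shift[OF this, of 1]
    have "(\<Sum>s\<in>{0..<int N}. F (x \<otimes> h [^] s)) = (\<Sum>s\<in>{0..<int N}. F (x \<otimes> h [^] (s + 1)))"
      by simp
    also have "\<dots> = (\<Sum>s\<in>{0..<int N}. F (x \<otimes> h \<otimes> h [^] s))"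
      using x h by (intro sum.cong refl arg_cong[where f = F]) (simp add: int_pow_mult m_ac)
    finally have "(\<Sum>s\<in>{0..<int N}. F (x \<otimes> h [^] s)) = (\<Sum>s\<in>{0..<int N}. F (x \<otimes> h \<otimes> h [^] s))" .
    then show ?thesis by (simp add: F'_def)
  qed
  have inv_Q: "F' (x \<otimes> a) = F' x" if x: "x \<in> carrier G" and a: "a \<in> Q" for x a
  proof -
    have ac: "a \<in> carrier G" using a insert.prems by auto
    have "F (x \<otimes> a \<otimes> h [^] s) = F (x \<otimes> h [^] s)" for s :: int
    proof -
      have "x \<otimes> a \<otimes> h [^] s = x \<otimes> h [^] s \<otimes> a"
        using x h ac by (simp add: m_ac)
      then show ?thesis using Finv[OF a] x h by simp
    qed
    then show ?thesis by (simp add: F'_def)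
  qed
  have sums: "(\<Sum>x\<in>K. F' x) = (\<Sum>x\<in>K. f x)" if K: "subgroup K G" and sub: "insert h Q \<subseteq> K" for K
  proof -
    have pw: "h [^] s \<in> K" for s :: int using K sub by (simp add: subgroup_int_pow_closed)
    have "(\<Sum>x\<in>K. F' x) = (\<Sum>s\<in>{0..<int N}. \<Sum>x\<in>K. F (x \<otimes> h [^] s)) / N"
      unfolding F'_def sum_divide_distrib[symmetric] by (subst sum.swap) simp
    also have "\<dots> = (\<Sum>x\<in>K. F x)" using N0 by (simp add: sum_translate[OF K pw])
    finally show ?thesis using Fsum[OF K] sub by simp
  qed
  show ?case
    using F'0 upper lower inv_h inv_Q sums by (intro exI[of _ F']) auto
qed

end

lemma (in comm_group) invariant_generate:
  assumes "Q \<subseteq> carrier G" and inv: "\<And>h x. h \<in> Q \<Longrightarrow> x \<in> carrier G \<Longrightarrow> F (x \<otimes> h) = F x"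
    and y: "y \<in> generate G Q" and x: "x \<in> carrier G"
  shows "F (x \<otimes> y) = F x"
  using y x
proof (induction arbitrary: x rule: generate.induct)
  case one
  then show ?case by simp
next
  case (incl h)
  then show ?case using inv by simp
next
  case (inv h)
  then have h: "h \<in> carrier G" using assms(1) by auto
  then have "F (x \<otimes> inv h) = F (x \<otimes> inv h \<otimes> h)" using assms(2) inv by simp
  also have "x \<otimes> inv h \<otimes> h = x" using h inv by (simp add: m_assoc)
  finally show ?case .
next
  case (eng h1 h2)
  then have "h1 \<in> carrier G" "h2 \<in> carrier G"
    using generate_in_carrier[OF assms(1)] by auto
  then show ?case using eng by (simp add: m_assoc[symmetric])
qed

context comm_group
begin

text \<open>
  The least positive exponent that sends \<open>h\<close> into \<open>H\<close> is the order of \<open>h\<close> in the quotient by \<open>H\<close>. It divides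
  \<open>N\<close>, hence is a power of \<open>p\<close>.
\<close>

lemma least_power_in_subgroup:
  assumes H: "subgroup H G" and h: "h \<in> carrier G" "h \<notin> H"
    and p: "prime p" and N: "N = p ^ k" and ord: "h [^] int N = \<one>"
  obtains m where "p ^ m > 1" "p ^ m \<le> N" "h [^] int (p ^ m) \<in> H"
    "\<And>d :: int. h [^] d \<in> H \<Longrightarrow> 0 \<le> d \<Longrightarrow> d < int (p ^ m) \<Longrightarrow> d = 0"
proof -
  have N0: "N > 0" using p N by (simp add: prime_gt_0_nat)
  define P where "P = (\<lambda>M. M > 0 \<and> h [^] int M \<in> H)"
  define M where "M = (LEAST M. P M)"
  have PN: "P N" using N0 ord H by (simp add: P_def subgroup.one_closed)
  then have PM: "P M" unfolding M_def by (rule LeastI)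
  have least: "\<not> P d" if "d < M" for d using that unfolding M_def by (rule not_less_Least)
  have small: "d = 0" if d: "h [^] d \<in> H" "0 \<le> d" "d < int M" for d :: int
  proof (rule ccontr)
    assume "d \<noteq> 0"
    then have "P (nat d)" using d by (simp add: P_def)
    moreover have "nat d < M" using d by linarith
    ultimately show False using least by blast
  qed
  have "int N mod int M = 0"
  proof (rule small)
    have "h [^] (int N mod int M) = h [^] (int N - int M * (int N div int M))"
      by (simp add: minus_mult_div_eq_mod)
    also have "\<dots> = h [^] int N \<otimes> inv ((h [^] int M) [^] (int N div int M))"
      using h by (simp add: int_pow_diff int_pow_pow)
    also have "\<dots> \<in> H"
      using PM ord H by (simp add: P_def subgroup.m_inv_closed subgroup_int_pow_closed
          subgroup.one_closed subgroup.m_closed)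
    finally show "h [^] (int N mod int M) \<in> H" .
  qed (use PM in \<open>auto simp: P_def\<close>)
  then have "M dvd p ^ k" unfolding N by (metis int_dvd_int_iff mod_0_imp_dvd)
  then obtain m where m: "M = p ^ m" using divides_primepow_nat[OF p] by blast
  have "M \<noteq> 1" using PM h by (auto simp: P_def)
  then have M1: "M > 1" using PM by (simp add: P_def)
  have "M \<le> N" using \<open>M dvd p ^ k\<close> N N0 by (simp add: dvd_imp_le)
  then show thesis using that[of m] M1 PM small unfolding m P_def by blast
qed

text \<open>
  Let \<open>M\<close> be the order of \<open>h\<close> modulo \<open>H\<close>. Whatever the factors in \<open>J\<close> do, the product lies in \<open>H\<close> for
  only one residue modulo \<open>M\<close> of the sum of the exponents at \<open>h\<close>, because \<open>h [^] s\<close> for \<open>0 \<le> s < M\<close>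
  lie in different cosets. The law of that sum is near uniform, and \<open>M \<ge> 2\<close> keeps it
  away from \<open>1\<close> at every point.
\<close>

lemma walk_mean_return_to_subgroup:
  assumes fin: "finite (carrier G)" and p: "prime p" and N: "N = p ^ k"
    and I: "finite I" "I \<inter> J = {}" and J: "finite J" "\<And>i. i \<in> J \<Longrightarrow> g i \<in> carrier G"
    and bal: "\<And>i. i \<in> I \<union> J \<Longrightarrow> balanced_weights p \<alpha> C (\<mu> i)"
    and H: "subgroup H G" and h: "h \<in> carrier G" "h \<notin> H" "h [^] int N = \<one>"
    and g: "\<And>i. i \<in> I \<Longrightarrow> g i = h" and \<alpha>: "0 \<le> \<alpha>" "\<alpha> \<le> 1"
  shows "(\<Sum>x\<in>H. walk_mean G C \<mu> g (I \<union> J) (\<lambda>x. of_bool (x = \<one>)) x)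
       \<le> 1 - (1 - exp (- \<alpha> * real (card I) / (2 * (real N)\<^sup>2))) / 2"
proof -
  obtain m where M1: "p ^ m > 1" and MN: "p ^ m \<le> N" and hM: "h [^] int (p ^ m) \<in> H"
    and small: "\<And>d :: int. h [^] d \<in> H \<Longrightarrow> 0 \<le> d \<Longrightarrow> d < int (p ^ m) \<Longrightarrow> d = 0"
    using least_power_in_subgroup[OF H h(1,2) p N h(3)] by blast
  define M where "M = p ^ m"
  define D where "D = walk_mean G C \<mu> g J (\<lambda>x. of_bool (x = \<one>))"
  \<comment> \<open>The probability that \<open>z\<close> times the product over \<open>J\<close> lies in \<open>H\<close>; it depends only on the coset of \<open>z\<close>.\<close>
  define \<Phi> where "\<Phi> = (\<lambda>z. \<Sum>x\<in>H. D (z \<otimes> x))"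
  let ?\<kappa> = "exp (- \<alpha> * real (card I) / (2 * (real N)\<^sup>2))"
  have Hc: "x \<in> carrier G" if "x \<in> H" for x using H that by (rule subgroup.mem_carrier)
  have weights: "0 \<le> \<mu> i c" "sum (\<mu> i) C = 1" if "i \<in> I \<union> J" "c \<in> C" for i c
    using bal[OF that(1)] that(2) by (auto simp: balanced_weights_def)
  have D0: "0 \<le> D x" if "x \<in> carrier G" for x
    unfolding D_def using that J weights by (intro walk_mean_nonneg) auto
  have D1: "(\<Sum>x\<in>carrier G. D x) = 1"
  proof -
    have "(\<Sum>x\<in>carrier G. D x) = (\<Sum>x\<in>carrier G. of_bool (x = \<one>))"
      unfolding D_def using J bal by (intro sum_walk_mean) (auto simp: balanced_weights_def)
    also have "\<dots> = 1" using fin by (simp add: of_bool_def)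
    finally show ?thesis .
  qed
  have per: "\<Phi> (x \<otimes> h [^] int M) = \<Phi> x" if x: "x \<in> carrier G" for x
  proof -
    have "\<Phi> (x \<otimes> h [^] int M) = (\<Sum>y\<in>H. D (x \<otimes> (y \<otimes> h [^] int M)))"
      unfolding \<Phi>_def using x h Hc by (intro sum.cong refl arg_cong[where f = D]) (simp add: m_ac)
    also have "\<dots> = \<Phi> x"
      unfolding \<Phi>_def by (rule sum_translate[OF H]) (use hM in \<open>simp add: M_def\<close>)
    finally show ?thesis .
  qed
  obtain \<pi> where \<pi>: "\<And>s. s \<in> {0..<int M} \<Longrightarrow>
       \<bar>\<pi> s - 1 / real M\<bar> \<le> (1 - 1 / real M) * exp (- \<alpha> * real (card I) / (2 * (real M)\<^sup>2))"
    and rep: "\<And>x. x \<in> carrier G \<Longrightarrow> walk_mean G C \<mu> g I \<Phi> x = (\<Sum>s\<in>{0..<int M}. \<pi> s * \<Phi> (x \<otimes> h [^] s))"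
    by (rule walk_mean_block_near_uniform[OF p M_def, of I \<alpha> C \<mu> h g \<Phi>]) (use I bal h g per \<alpha> in auto)
  have M: "M > 1" "M \<le> N" using M1 MN by (auto simp: M_def)
  have \<pi>le: "\<pi> s \<le> 1 - (1 - ?\<kappa>) / 2" if s: "s \<in> {0..<int M}" for s
  proof -
    have "exp (- \<alpha> * real (card I) / (2 * (real M)\<^sup>2)) \<le> ?\<kappa>"
    proof -
      have "\<alpha> * real (card I) / (2 * (real N)\<^sup>2) \<le> \<alpha> * real (card I) / (2 * (real M)\<^sup>2)"
        using M \<alpha> by (intro divide_left_mono mult_left_mono power_mono) auto
      then show ?thesis by simp
    qed
    then have "\<pi> s \<le> 1 / M + (1 - 1 / M) * ?\<kappa>"
      using \<pi>[OF s] M by (smt (verit) divide_le_eq_1_pos mult_left_mono of_nat_1 of_nat_less_iff)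
    also have "\<dots> = 1 - (1 - 1 / M) * (1 - ?\<kappa>)" by (simp add: algebra_simps)
    also have "\<dots> \<le> 1 - 1 / 2 * (1 - ?\<kappa>)"
    proof -
      have "1 / 2 \<le> 1 - 1 / real M" using M by (simp add: field_simps)
      moreover have "?\<kappa> \<le> 1" using \<alpha> by simp
      ultimately show ?thesis by (intro diff_left_mono mult_right_mono) auto
    qed
    finally show ?thesis by simp
  qed
  have pw: "h [^] s \<in> carrier G" for s :: int using h by simp
  have disj: "inj_on (\<lambda>(s, x). h [^] s \<otimes> x) ({0..<int M} \<times> H)"
  proof (rule inj_onI, clarify)
    fix s x s' x'
    assume a: "s \<in> {0..<int M}" "s' \<in> {0..<int M}" and x: "x \<in> H" "x' \<in> H"
      and eq: "h [^] s \<otimes> x = h [^] s' \<otimes> x'"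
    have aux: "t = t'" if "t \<in> {0..<int M}" "t' \<in> {0..<int M}" "t' \<le> t" "y \<in> H" "y' \<in> H"
      and e: "h [^] t \<otimes> y = h [^] t' \<otimes> y'" for t t' y y'
    proof -
      have "h [^] (t - t') = h [^] t \<otimes> y \<otimes> inv y \<otimes> inv (h [^] t')"
        using h(1) Hc[OF that(4)] by (simp add: int_pow_diff m_assoc)
      also have "\<dots> = y' \<otimes> inv y"
        unfolding e using pw[of t'] Hc[OF that(4)] Hc[OF that(5)] by (simp add: m_ac)
      also have "\<dots> \<in> H" using H that by (simp add: subgroup.m_closed subgroup.m_inv_closed)
      finally show ?thesis using small[of "t - t'"] that by (auto simp: M_def)
    qed
    have "s = s'" using aux[of s s' x x'] aux[of s' s x' x] a x eq by (cases "s' \<le> s") auto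
    moreover from this have "x = x'" using eq x h Hc by simp
    ultimately show "s = s' \<and> x = x'" by simp
  qed
  \<comment> \<open>The cosets of the powers of \<open>h\<close> are disjoint events for the product over \<open>J\<close>.\<close>
  have tot: "(\<Sum>s\<in>{0..<int M}. \<Phi> (h [^] s)) \<le> 1"
  proof -
    have "(\<Sum>s\<in>{0..<int M}. \<Phi> (h [^] s)) = (\<Sum>(s, x)\<in>{0..<int M} \<times> H. D (h [^] s \<otimes> x))"
      unfolding \<Phi>_def by (rule sum.cartesian_product)
    also have "\<dots> = (\<Sum>z\<in>(\<lambda>(s, x). h [^] s \<otimes> x) ` ({0..<int M} \<times> H). D z)"
      by (subst sum.reindex[OF disj]) (simp add: case_prod_unfold)
    also have "\<dots> \<le> (\<Sum>z\<in>carrier G. D z)"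
      using fin D0 h Hc by (intro sum_mono2) auto
    finally show ?thesis using D1 by simp
  qed
  have "(\<Sum>x\<in>H. walk_mean G C \<mu> g (I \<union> J) (\<lambda>x. of_bool (x = \<one>)) x) = (\<Sum>x\<in>H. walk_mean G C \<mu> g I D x)"
    unfolding D_def using I J h g Hc by (intro sum.cong refl walk_mean_union) auto
  also have "\<dots> = walk_mean G C \<mu> g I \<Phi> \<one>"
  proof -
    have X: "(\<Otimes>i\<in>I. g i [^] c i) \<in> carrier G" for c :: "_ \<Rightarrow> int"
      using g h by (intro finprod_closed) auto
    show ?thesis
      unfolding walk_mean_def \<Phi>_def sum_distrib_left
      by (subst sum.swap) (intro sum.cong refl, use X Hc in \<open>simp add: m_comm\<close>)
  qed
  also have "\<dots> = (\<Sum>s\<in>{0..<int M}. \<pi> s * \<Phi> (h [^] s))" using rep[of \<one>] h by simp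
  also have "\<dots> \<le> (\<Sum>s\<in>{0..<int M}. (1 - (1 - ?\<kappa>) / 2) * \<Phi> (h [^] s))"
    using \<pi>le D0 Hc h by (intro sum_mono mult_right_mono) (auto simp: \<Phi>_def intro!: sum_nonneg)
  also have "\<dots> = (1 - (1 - ?\<kappa>) / 2) * (\<Sum>s\<in>{0..<int M}. \<Phi> (h [^] s))"
    by (simp add: sum_distrib_left)
  also have "\<dots> \<le> (1 - (1 - ?\<kappa>) / 2) * 1"
  proof (rule mult_left_mono[OF tot])
    have nonneg: "0 \<le> 1 - (1 - t) / 2" if "0 < t" for t :: real
      using that by (simp add: field_simps)
    show "0 \<le> 1 - (1 - ?\<kappa>) / 2" by (rule nonneg) simp
  qed
  finally show ?thesis by simp
qed

text \<open>
  The pigeonhole principle: the indices with \<open>g i \<notin> H\<close> take at most \<open>order G\<close> values.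
\<close>

lemma popular_value_exists:
  assumes fin: "finite (carrier G)" and I: "finite I" "\<And>i. i \<in> I \<Longrightarrow> g i \<in> carrier G"
    and w: "{i \<in> I. g i \<notin> H} \<noteq> {}"
  shows "\<exists>h\<in>carrier G - H.
    real (card {i \<in> I. g i \<notin> H}) / real (order G) \<le> real (card {i \<in> I. g i = h})"
proof (rule ccontr)
  assume no: "\<not> ?thesis"
  let ?T = "carrier G - H" and ?w = "real (card {i \<in> I. g i \<notin> H})"
  have small: "real (card {i \<in> I. g i = h}) < ?w / real (order G)" if "h \<in> ?T" for h
    using no that by (auto simp: not_le)
  have "(\<Sum>h\<in>?T. card {i \<in> {i \<in> I. g i \<notin> H}. g i = h}) = card {i \<in> I. g i \<notin> H}"
    using sum.group[of "{i \<in> I. g i \<notin> H}" ?T g "\<lambda>_. 1 :: nat"] fin I by auto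
  moreover have "{i \<in> {i \<in> I. g i \<notin> H}. g i = h} = {i \<in> I. g i = h}" if "h \<in> ?T" for h
    using that by auto
  ultimately have "(\<Sum>h\<in>?T. card {i \<in> I. g i = h}) = card {i \<in> I. g i \<notin> H}" by simp
  from arg_cong[OF this, of real]
  have "?w = (\<Sum>h\<in>?T. real (card {i \<in> I. g i = h}))" by simp
  also have "\<dots> < (\<Sum>h\<in>?T. ?w / real (order G))"
    using small fin w I by (intro sum_strict_mono) auto
  also have "\<dots> = real (card ?T) * (?w / real (order G))" by simp
  also have "\<dots> \<le> real (order G) * (?w / real (order G))"
    using fin by (intro mult_right_mono) (auto simp: order_def intro: card_mono)
  also have "\<dots> \<le> ?w" by simp
  finally show False by simp
qed

text \<open>
  The indices with popular entries average over the cosets of \<open>H\<close>, so up to the factors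
  \<open>(1 \<plusminus> N * e) ^ order G\<close> the probability that the whole product is trivial is \<open>1 / card H\<close> times the
  probability that the remaining product lies in \<open>H\<close>. The latter is \<open>1\<close> when \<open>H\<close> is the whole group,
  and in general it is bounded through an element outside \<open>H\<close> that occurs often.
\<close>

lemma walk_mean_identity_bounds:
  fixes \<alpha> \<tau> e :: real
  assumes fin: "finite (carrier G)" and p: "prime p" and N: "N = p ^ k"
    and ord: "\<And>x. x \<in> carrier G \<Longrightarrow> x [^] int N = \<one>"
    and I: "finite I" "\<And>i. i \<in> I \<Longrightarrow> g i \<in> carrier G"
    and bal: "\<And>i. i \<in> I \<Longrightarrow> balanced_weights p \<alpha> C (\<mu> i)" and \<alpha>: "0 \<le> \<alpha>" "\<alpha> \<le> 1"
    and Q: "Q = {h \<in> carrier G. \<tau> \<le> real (card {i \<in> I. g i = h})}"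
    and H: "H = generate G Q"
    and e: "e = exp (- \<alpha> * \<tau> / (2 * (real N)\<^sup>2))"
  shows "walk_mean G C \<mu> g I (\<lambda>x. of_bool (x = \<one>)) \<one>
      \<le> (1 + N * e) ^ order G / card H *
        (1 - (1 - exp (- \<alpha> * card {i \<in> I. g i \<notin> H} / (2 * (real N)\<^sup>2 * order G))) / 2)"
      (is "?P \<le> _ * ?q")
    and "H = carrier G \<Longrightarrow> N * e \<le> 1 \<Longrightarrow>
      (1 - N * e) ^ order G / order G \<le> walk_mean G C \<mu> g I (\<lambda>x. of_bool (x = \<one>)) \<one>"
proof -
  let ?IQ = "{i \<in> I. g i \<in> Q}" and ?R = "{i \<in> I. g i \<notin> Q}"
  define L where "L = walk_mean G C \<mu> g ?R (\<lambda>x. of_bool (x = \<one>))"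
  have weights: "0 \<le> \<mu> i c" if "i \<in> I" "c \<in> C" for i c
    using bal[OF that(1)] that(2) by (auto simp: balanced_weights_def)
  have L0: "0 \<le> L x" if "x \<in> carrier G" for x
    unfolding L_def using that I weights by (intro walk_mean_nonneg) auto
  have L1: "(\<Sum>x\<in>carrier G. L x) = 1"
  proof -
    have "(\<Sum>x\<in>carrier G. L x) = (\<Sum>x\<in>carrier G. of_bool (x = \<one>))"
      unfolding L_def using I bal by (intro sum_walk_mean) (auto simp: balanced_weights_def)
    also have "\<dots> = 1" using fin by (simp add: of_bool_def)
    finally show ?thesis .
  qed
  have QG: "Q \<subseteq> carrier G" "finite Q" using fin by (auto simp: Q)
  have sub: "subgroup H G" unfolding H using QG by (intro generate_is_subgroup)
  have QH: "Q \<subseteq> H" unfolding H by (auto intro: generate.incl)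
  have HG: "H \<subseteq> carrier G" using sub by (rule subgroup.subset)
  have finH: "finite H" using HG fin by (rule finite_subset)
  have cardH: "card H > 0" using sub finH subgroup.one_closed by (auto simp: card_gt_0_iff)
  have cardQ: "card Q \<le> order G" using QG fin by (simp add: order_def card_mono)
  have N0: "N > 0" using p N by (simp add: prime_gt_0_nat)
  have e0: "0 \<le> e" by (simp add: e)
  have pop: "exp (- \<alpha> * real (card {i \<in> I. g i = h}) / (2 * (real N)\<^sup>2)) \<le> e" if "h \<in> Q" for h
    using that \<alpha> N0 unfolding e Q by (auto intro!: divide_right_mono mult_left_mono)
  have ordQ: "h [^] int N = \<one>" if "h \<in> Q" for h using that QG ord by auto
  have "\<exists>F. (\<forall>x\<in>carrier G. 0 \<le> F x \<and>
          walk_mean G C \<mu> g ?IQ L x \<le> (1 + N * e) ^ card Q * F x \<and>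
          (N * e \<le> 1 \<longrightarrow> (1 - N * e) ^ card Q * F x \<le> walk_mean G C \<mu> g ?IQ L x)) \<and>
        (\<forall>h\<in>Q. \<forall>x\<in>carrier G. F (x \<otimes> h) = F x) \<and>
        (\<forall>K. subgroup K G \<longrightarrow> Q \<subseteq> K \<longrightarrow> (\<Sum>x\<in>K. F x) = (\<Sum>x\<in>K. L x))"
    by (rule walk_mean_popular[OF p N I bal QG(2,1) ordQ \<alpha>(2) e0 pop L0])
  then obtain F where FB: "\<forall>x\<in>carrier G. 0 \<le> F x \<and>
          walk_mean G C \<mu> g ?IQ L x \<le> (1 + N * e) ^ card Q * F x \<and>
          (N * e \<le> 1 \<longrightarrow> (1 - N * e) ^ card Q * F x \<le> walk_mean G C \<mu> g ?IQ L x)"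
    and Finv: "\<forall>h\<in>Q. \<forall>x\<in>carrier G. F (x \<otimes> h) = F x"
    and Fsum: "\<forall>K. subgroup K G \<longrightarrow> Q \<subseteq> K \<longrightarrow> (\<Sum>x\<in>K. F x) = (\<Sum>x\<in>K. L x)"
    by (elim exE conjE) rule
  have FU: "walk_mean G C \<mu> g ?IQ L \<one> \<le> (1 + N * e) ^ card Q * F \<one>"
    and FL: "N * e \<le> 1 \<Longrightarrow> (1 - N * e) ^ card Q * F \<one> \<le> walk_mean G C \<mu> g ?IQ L \<one>"
    and F0: "0 \<le> F \<one>"
    using FB[rule_format, OF one_closed] by simp_all
  have P: "?P = walk_mean G C \<mu> g ?IQ L \<one>"
  proof -
    have "I = ?IQ \<union> ?R" by auto
    then show ?thesis unfolding L_def using walk_mean_union[of ?IQ ?R g \<one> C \<mu>] I by auto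
  qed
  have "(\<Sum>x\<in>H. F x) = (\<Sum>x\<in>H. F \<one>)"
  proof (rule sum.cong[OF refl])
    fix y assume y: "y \<in> H"
    then have "F (\<one> \<otimes> y) = F \<one>"
      unfolding H using invariant_generate[OF QG(1), of F y \<one>] Finv by auto
    then show "F y = F \<one>" using y HG by auto
  qed
  then have F1: "F \<one> = (\<Sum>x\<in>H. L x) / card H"
    using Fsum[rule_format, OF sub QH] cardH by (simp add: field_simps)
  have escape: "(\<Sum>x\<in>H. L x) \<le> ?q"
  proof (cases "{i \<in> I. g i \<notin> H} = {}")
    case True
    have "(\<Sum>x\<in>H. L x) \<le> (\<Sum>x\<in>carrier G. L x)"
      using fin HG L0 by (intro sum_mono2) auto
    then show ?thesis using L1 unfolding True by simp
  next
    case False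
    then obtain h where h: "h \<in> carrier G" "h \<notin> H"
      and big: "real (card {i \<in> I. g i \<notin> H}) / real (order G) \<le> real (card {i \<in> I. g i = h})"
      using popular_value_exists[of I g H] fin I by auto
    let ?Ih = "{i \<in> I. g i = h}" and ?J = "{i \<in> I. g i \<notin> Q \<and> g i \<noteq> h}"
    have R: "?R = ?Ih \<union> ?J" using h QH by auto
    have "(\<Sum>x\<in>H. L x) \<le> 1 - (1 - exp (- \<alpha> * real (card ?Ih) / (2 * (real N)\<^sup>2))) / 2"
      unfolding L_def R
      by (rule walk_mean_return_to_subgroup[OF fin p N _ _ _ _ _ sub h ord _ \<alpha>]) (use I bal h in auto)
    also have "\<dots> \<le> ?q"
    proof -
      have "\<alpha> / (2 * (real N)\<^sup>2) * (real (card {i \<in> I. g i \<notin> H}) / real (order G))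
          \<le> \<alpha> / (2 * (real N)\<^sup>2) * real (card ?Ih)"
        using \<alpha> by (intro mult_left_mono big) auto
      then show ?thesis by (simp add: field_simps)
    qed
    finally show ?thesis .
  qed
  have "?P \<le> (1 + N * e) ^ card Q * F \<one>" using P FU by simp
  also have "\<dots> \<le> (1 + N * e) ^ order G * F \<one>"
    using cardQ e0 F0 by (intro mult_right_mono power_increasing) auto
  also have "\<dots> \<le> (1 + N * e) ^ order G * (?q / card H)"
    unfolding F1 using escape e0 by (intro mult_left_mono divide_right_mono) auto
  finally show "?P \<le> (1 + N * e) ^ order G / card H * ?q" by simp
  assume HC: "H = carrier G" and Ne: "N * e \<le> 1"
  have F1': "F \<one> = 1 / order G" using F1 L1 HC by (simp add: order_def)
  have "(1 - N * e) ^ order G * F \<one> \<le> (1 - N * e) ^ card Q * F \<one>"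
    using cardQ e0 F0 Ne by (intro mult_right_mono power_decreasing) auto
  also have "\<dots> \<le> ?P" using P FL[OF Ne] by simp
  finally show "(1 - N * e) ^ order G / order G \<le> ?P" unfolding F1' by simp
qed

end

section \<open>Tuples, their popular entries and their stray indices\<close>

definition popular :: "('g, 'c) monoid_scheme \<Rightarrow> nat \<Rightarrow> real \<Rightarrow> (nat \<Rightarrow> 'g) \<Rightarrow> 'g set" where
  "popular G n \<theta> g = {h \<in> carrier G. \<theta> * real n \<le> real (card {i \<in> {1..n}. g i = h})}"

definition core :: "('g, 'c) monoid_scheme \<Rightarrow> nat \<Rightarrow> real \<Rightarrow> (nat \<Rightarrow> 'g) \<Rightarrow> 'g set" where
  "core G n \<theta> g = generate G (popular G n \<theta> g)"

definition stray :: "('g, 'c) monoid_scheme \<Rightarrow> nat \<Rightarrow> real \<Rightarrow> (nat \<Rightarrow> 'g) \<Rightarrow> nat set" where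
  "stray G n \<theta> g = {i \<in> {1..n}. g i \<notin> core G n \<theta> g}"

definition tuples :: "('g, 'c) monoid_scheme \<Rightarrow> nat \<Rightarrow> (nat \<Rightarrow> 'g) set" where
  "tuples G n = {1..n} \<rightarrow>\<^sub>E carrier G"

definition generating_tuples :: "('g, 'c) monoid_scheme \<Rightarrow> nat \<Rightarrow> (nat \<Rightarrow> 'g) set" where
  "generating_tuples G n = {g \<in> tuples G n. generate G (g ` {1..n}) = carrier G}"

text \<open>
  The probability that the tuple \<open>g\<close> kills a random column whose entries have the laws \<open>\<mu> i\<close>.
\<close>

definition kill_prob ::
  "('g, 'c) monoid_scheme \<Rightarrow> int set \<Rightarrow> nat \<Rightarrow> (nat \<Rightarrow> int \<Rightarrow> real) \<Rightarrow> (nat \<Rightarrow> 'g) \<Rightarrow> real" where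
  "kill_prob G C n \<mu> g = walk_mean G C \<mu> g {1..n} (\<lambda>x. of_bool (x = \<one>\<^bsub>G\<^esub>)) \<one>\<^bsub>G\<^esub>"

lemma sum_power_card_Pow:
  fixes x :: real
  assumes "finite A"
  shows "(\<Sum>W\<in>Pow A. x ^ card W) = (1 + x) ^ card A"
  using prod_add[OF assms, of "\<lambda>_. x" "\<lambda>_. 1"] assms
  by (simp add: add.commute)

lemma one_minus_exp_ge:
  fixes x :: real
  assumes "0 \<le> x"
  shows "min 1 x / 2 \<le> 1 - exp (- x)"
proof -
  have "exp (- x) = 1 / exp x" by (simp add: exp_minus inverse_eq_divide)
  also have "\<dots> \<le> 1 / (1 + x)"
    using assms exp_ge_add_one_self[of x] by (intro divide_left_mono) auto
  finally have "1 - 1 / (1 + x) \<le> 1 - exp (- x)" by simp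
  moreover have "min 1 x / 2 \<le> 1 - 1 / (1 + x)"
  proof (cases "x \<le> 1")
    case True
    then show ?thesis using assms by (simp add: field_simps mult_left_le)
  next
    case False
    then show ?thesis by (simp add: field_simps)
  qed
  ultimately show ?thesis by linarith
qed

text \<open>
  Chernoff's bound: each \<open>W\<close> of size at most \<open>\<delta> n\<close> satisfies \<open>(16 B) ^ card W \<le> exp (n / 32)\<close>, so the sum is
  at most \<open>exp (n / 32)\<close> times the sum of \<open>(1 / 16) ^ card W\<close> over all subsets, which is
  \<open>(1 + 1 / 16) ^ n \<le> exp (n / 16)\<close>.
\<close>

lemma sum_power_small_subsets_le:
  fixes B :: nat and \<delta> :: real
  assumes B: "B \<ge> 1" and \<delta>: "\<delta> * ln (16 * real B) \<le> 1 / 32"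
  shows "(\<Sum>W\<in>{W. W \<subseteq> {1..n} \<and> card W \<le> \<delta> * real n}. real B ^ card W) \<le> exp (3 * real n / 32)"
proof -
  let ?S = "{W. W \<subseteq> {1..n} \<and> card W \<le> \<delta> * real n}"
  have l0: "0 \<le> ln (16 * real B)" using B by simp
  have "(\<Sum>W\<in>?S. real B ^ card W) \<le> (\<Sum>W\<in>?S. exp (real n / 32) * (1 / 16) ^ card W)"
  proof (rule sum_mono)
    fix W assume W: "W \<in> ?S"
    have "(16 * real B) ^ card W = exp (card W * ln (16 * real B))"
      using B by (simp add: exp_of_nat_mult)
    also have "\<dots> \<le> exp (\<delta> * real n * ln (16 * real B))"
      using W l0 by (simp add: mult_right_mono)
    also have "\<dots> = exp (real n * (\<delta> * ln (16 * real B)))" by (simp add: ac_simps)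
    also have "\<dots> \<le> exp (real n * (1 / 32))"
      using \<delta> by (subst exp_le_cancel_iff) (rule mult_left_mono, auto)
    finally have "(16 * real B) ^ card W \<le> exp (real n / 32)" by simp
    then have le: "(16 * real B) ^ card W * (1 / 16) ^ card W \<le> exp (real n / 32) * (1 / 16) ^ card W"
      by (intro mult_right_mono) auto
    have "real B ^ card W = (16 * real B * (1 / 16)) ^ card W" by simp
    also have "\<dots> = (16 * real B) ^ card W * (1 / 16) ^ card W" by (rule power_mult_distrib)
    also note le
    finally show "real B ^ card W \<le> exp (real n / 32) * (1 / 16) ^ card W" .
  qed
  also have "\<dots> \<le> (\<Sum>W\<in>Pow {1..n}. exp (real n / 32) * (1 / 16) ^ card W)"
    by (intro sum_mono2) auto
  also have "\<dots> = exp (real n / 32) * (1 + 1 / 16) ^ n"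
    using sum_power_card_Pow[of "{1..n}" "1 / 16"] by (simp add: sum_distrib_left[symmetric])
  also have "\<dots> \<le> exp (real n / 32) * exp (1 / 16) ^ n"
    using exp_ge_add_one_self[of "1 / 16"] by (intro mult_left_mono power_mono) auto
  also have "\<dots> = exp (3 * real n / 32)"
    by (simp add: exp_of_nat_mult[symmetric] exp_add[symmetric])
  finally show ?thesis .
qed

text \<open>
  With \<open>x = a j * w / K\<close> each factor is at most \<open>exp (- min 1 x / 4)\<close>. For at least \<open>n / 2\<close> of the indices
  \<open>x\<close> is at least \<open>24 w ln n / n\<close>, so the product is at most \<open>exp (- min n (24 w ln n) / 8)\<close>, and the two
  terms on the right correspond to the two cases of the minimum. The number \<open>24\<close> makes the first
  one small enough to beat the choice of \<open>w\<close> stray indices among \<open>n\<close>.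
\<close>

lemma prod_escape_le:
  fixes a :: "nat \<Rightarrow> real" and n w m :: nat and K :: real
  assumes n: "n \<ge> 1" and K: "K > 0" and a: "\<And>j. j \<in> {1..m} \<Longrightarrow> 0 \<le> a j"
    and many: "real n / 2 \<le> real (card {j \<in> {1..m}. 24 * K * ln n \<le> a j * n})"
  shows "(\<Prod>j\<in>{1..m}. 1 - (1 - exp (- a j * w / K)) / 2) \<le> (1 / real n ^ 3) ^ w + exp (- real n / 8)"
proof -
  let ?J = "{j \<in> {1..m}. 24 * K * ln n \<le> a j * n}"
  let ?x = "\<lambda>j. a j * w / K"
  let ?y = "24 * real w * ln n / n"
  have ln0: "0 \<le> ln (real n)" using n by simp
  have x0: "0 \<le> ?x j" if "j \<in> {1..m}" for j using a[OF that] K by simp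
  have "(\<Prod>j\<in>{1..m}. 1 - (1 - exp (- ?x j)) / 2) \<le> (\<Prod>j\<in>{1..m}. exp (- (min 1 (?x j) / 4)))"
  proof (rule prod_mono, rule conjI)
    fix j assume j: "j \<in> {1..m}"
    have nonneg: "0 \<le> 1 - (1 - t) / 2" if "0 < t" for t :: real
      using that by (simp add: field_simps)
    show "0 \<le> 1 - (1 - exp (- ?x j)) / 2" by (rule nonneg) simp
    have "1 - (1 - exp (- ?x j)) / 2 \<le> 1 - min 1 (?x j) / 4"
      using one_minus_exp_ge[OF x0[OF j]] by simp
    also have "\<dots> \<le> exp (- (min 1 (?x j) / 4))"
      using exp_ge_add_one_self[of "- (min 1 (?x j) / 4)"] by simp
    finally show "1 - (1 - exp (- ?x j)) / 2 \<le> exp (- (min 1 (?x j) / 4))" .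
  qed
  also have "\<dots> = exp (- (\<Sum>j\<in>{1..m}. min 1 (?x j)) / 4)"
    by (simp add: exp_sum[symmetric] sum_negf sum_divide_distrib)
  also have "\<dots> \<le> exp (- (real n / 2 * min 1 ?y) / 4)"
  proof -
    have "real n / 2 * min 1 ?y \<le> real (card ?J) * min 1 ?y"
      using many ln0 by (intro mult_right_mono) auto
    also have "\<dots> = (\<Sum>j\<in>?J. min 1 ?y)" by simp
    also have "\<dots> \<le> (\<Sum>j\<in>?J. min 1 (?x j))"
    proof (rule sum_mono)
      fix j assume "j \<in> ?J"
      then have "24 * K * ln n * w \<le> a j * n * w" by (intro mult_right_mono) auto
      then have "?y \<le> ?x j" using K n by (simp add: field_simps)
      then show "min 1 ?y \<le> min 1 (?x j)" by simp
    qed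
    also have "\<dots> \<le> (\<Sum>j\<in>{1..m}. min 1 (?x j))"
      using x0 by (intro sum_mono2) auto
    finally show ?thesis by simp
  qed
  also have "\<dots> \<le> (1 / real n ^ 3) ^ w + exp (- real n / 8)"
  proof (cases "?y \<le> 1")
    case True
    have "exp (- (real n / 2 * min 1 ?y) / 4) = exp (real w * (- 3 * ln n))"
      using True n by (simp add: field_simps)
    also have "\<dots> = (exp (- 3 * ln n)) ^ w" by (rule exp_of_nat_mult)
    also have "exp (- 3 * ln n) = 1 / real n ^ 3"
      using n exp_of_nat_mult[of 3 "ln (real n)"] by (simp add: exp_minus inverse_eq_divide)
    finally show ?thesis by simp
  next
    case False
    then show ?thesis by simp
  qed
  finally show ?thesis by simp
qed

context comm_group
begin

lemma popular_subset: "popular G n \<theta> g \<subseteq> carrier G"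
  by (auto simp: popular_def)

lemma core_subgroup: "subgroup (core G n \<theta> g) G"
  unfolding core_def by (rule generate_is_subgroup[OF popular_subset])

lemma card_stray_le:
  fixes \<theta> :: real
  assumes fin: "finite (carrier G)" and g: "g \<in> tuples G n" and \<theta>: "0 \<le> \<theta>"
  shows "real (card (stray G n \<theta> g)) \<le> order G * \<theta> * real n"
proof -
  let ?T = "carrier G - core G n \<theta> g"
  have gc: "g i \<in> carrier G" if "i \<in> {1..n}" for i using g that by (auto simp: tuples_def)
  have "(\<Sum>h\<in>?T. card {i \<in> stray G n \<theta> g. g i = h}) = card (stray G n \<theta> g)"
    using sum.group[of "stray G n \<theta> g" ?T g "\<lambda>_. 1 :: nat"] fin gc by (auto simp: stray_def)
  from arg_cong[OF this, of real]
  have "real (card (stray G n \<theta> g)) = (\<Sum>h\<in>?T. real (card {i \<in> stray G n \<theta> g. g i = h}))"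
    by simp
  also have "\<dots> \<le> (\<Sum>h\<in>?T. \<theta> * real n)"
  proof (rule sum_mono)
    fix h assume h: "h \<in> ?T"
    then have "h \<notin> popular G n \<theta> g" by (auto simp: core_def intro: generate.incl)
    then have "real (card {i \<in> {1..n}. g i = h}) < \<theta> * real n" using h by (auto simp: popular_def)
    moreover have "card {i \<in> stray G n \<theta> g. g i = h} \<le> card {i \<in> {1..n}. g i = h}"
      by (intro card_mono) (auto simp: stray_def)
    ultimately show "real (card {i \<in> stray G n \<theta> g. g i = h}) \<le> \<theta> * real n" by linarith
  qed
  also have "\<dots> = real (card ?T) * (\<theta> * real n)" by simp
  also have "\<dots> \<le> order G * (\<theta> * real n)"
    using fin \<theta> by (intro mult_right_mono) (auto simp: order_def intro: card_mono)
  finally show ?thesis by simp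
qed

text \<open>
  Off \<open>W\<close> the entries lie in \<open>H\<close>, and on \<open>W\<close> they are arbitrary.
\<close>

lemma card_tuples_with_core_le:
  assumes fin: "finite (carrier G)" and H: "subgroup H G" and W: "W \<subseteq> {1..n}"
  shows "card {g \<in> tuples G n. core G n \<theta> g = H \<and> stray G n \<theta> g = W} \<le> card H ^ n * order G ^ card W"
proof -
  have HG: "H \<subseteq> carrier G" using H by (rule subgroup.subset)
  have finW: "finite W" using W finite_subset by blast
  have finH: "finite H" using HG fin by (rule finite_subset)
  have cardH: "card H \<ge> 1" using H finH subgroup.one_closed
    by (metis One_nat_def Suc_leI card_gt_0_iff empty_iff)
  let ?D = "\<lambda>i. if i \<in> W then carrier G else H"
  have "{g \<in> tuples G n. core G n \<theta> g = H \<and> stray G n \<theta> g = W} \<subseteq> PiE {1..n} ?D"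
    by (auto simp: tuples_def stray_def PiE_def Pi_def)
  then have "card {g \<in> tuples G n. core G n \<theta> g = H \<and> stray G n \<theta> g = W} \<le> card (PiE {1..n} ?D)"
    using fin finH by (intro card_mono finite_PiE) auto
  also have "\<dots> = (\<Prod>i\<in>{1..n}. if i \<in> W then order G else card H)"
    by (subst card_PiE) (auto simp: order_def intro!: prod.cong)
  also have "\<dots> = order G ^ card W * card H ^ card ({1..n} - W)"
  proof -
    have "{1..n} \<inter> {i. i \<in> W} = W" "{1..n} \<inter> - {i. i \<in> W} = {1..n} - W" using W by auto
    then show ?thesis by (subst prod.If_cases) auto
  qed
  also have "\<dots> \<le> order G ^ card W * card H ^ n"
    using cardH W finW by (intro mult_left_mono power_increasing) (auto simp: card_Diff_subset)
  finally show ?thesis by (simp add: mult.commute)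
qed

lemma sum_over_core_stray_le:
  fixes f :: "'a set \<Rightarrow> nat set \<Rightarrow> real"
  assumes fin: "finite (carrier G)" and X: "X \<subseteq> tuples G n"
    and \<H>: "\<And>g. g \<in> X \<Longrightarrow> core G n \<theta> g \<in> \<H>" "\<And>H. H \<in> \<H> \<Longrightarrow> subgroup H G"
    and \<W>: "\<And>g. g \<in> X \<Longrightarrow> stray G n \<theta> g \<in> \<W>" "\<And>W. W \<in> \<W> \<Longrightarrow> W \<subseteq> {1..n}"
    and f: "\<And>H W. H \<in> \<H> \<Longrightarrow> W \<in> \<W> \<Longrightarrow> 0 \<le> f H W"
  shows "(\<Sum>g\<in>X. f (core G n \<theta> g) (stray G n \<theta> g))
       \<le> (\<Sum>H\<in>\<H>. \<Sum>W\<in>\<W>. real (card H ^ n * order G ^ card W) * f H W)"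
proof -
  have "finite (tuples G n)" using fin by (auto simp: tuples_def intro: finite_PiE)
  then have finX: "finite X" using X finite_subset by blast
  have "\<H> \<subseteq> Pow (carrier G)" using \<H>(2) subgroup.subset by blast
  then have fin\<H>: "finite \<H>" using fin finite_subset by blast
  have "\<W> \<subseteq> Pow {1..n}" using \<W>(2) by blast
  then have fin\<W>: "finite \<W>" using finite_subset by blast
  let ?k = "\<lambda>g. (core G n \<theta> g, stray G n \<theta> g)"
  have "(\<Sum>g\<in>X. f (core G n \<theta> g) (stray G n \<theta> g))
      = (\<Sum>(H, W)\<in>\<H> \<times> \<W>. \<Sum>g\<in>{g \<in> X. ?k g = (H, W)}. f (core G n \<theta> g) (stray G n \<theta> g))"
  proof -
    have "?k ` X \<subseteq> \<H> \<times> \<W>" using \<H> \<W> by auto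
    from sum.group[OF finX finite_cartesian_product[OF fin\<H> fin\<W>] this,
        where h = "\<lambda>g. f (core G n \<theta> g) (stray G n \<theta> g)"]
    show ?thesis by (simp only: split_def prod.collapse)
  qed
  also have "\<dots> = (\<Sum>H\<in>\<H>. \<Sum>W\<in>\<W>. real (card {g \<in> X. ?k g = (H, W)}) * f H W)"
    unfolding sum.cartesian_product[symmetric] by (intro sum.cong refl) auto
  also have "\<dots> \<le> (\<Sum>H\<in>\<H>. \<Sum>W\<in>\<W>. real (card H ^ n * order G ^ card W) * f H W)"
  proof (intro sum_mono mult_right_mono f)
    fix H W assume HW: "H \<in> \<H>" "W \<in> \<W>"
    have "card {g \<in> X. ?k g = (H, W)} \<le> card {g \<in> tuples G n. core G n \<theta> g = H \<and> stray G n \<theta> g = W}"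
      using X \<open>finite (tuples G n)\<close> by (intro card_mono) auto
    also have "\<dots> \<le> card H ^ n * order G ^ card W"
      using fin \<H> \<W> HW by (intro card_tuples_with_core_le) auto
    finally show "real (card {g \<in> X. ?k g = (H, W)}) \<le> real (card H ^ n * order G ^ card W)"
      by (rule of_nat_mono)
  qed
  finally show ?thesis .
qed

lemma stray_nonempty:
  assumes g: "g \<in> generating_tuples G n" and H: "core G n \<theta> g \<noteq> carrier G"
  shows "stray G n \<theta> g \<noteq> {}"
proof
  assume "stray G n \<theta> g = {}"
  then have "g ` {1..n} \<subseteq> core G n \<theta> g" by (auto simp: stray_def)
  then have "generate G (g ` {1..n}) \<subseteq> core G n \<theta> g"
    using core_subgroup by (rule generate_subgroup_incl)
  then show False
    using g H subgroup.subset[OF core_subgroup[of n \<theta> g]] by (auto simp: generating_tuples_def)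
qed

lemma full_core_generating:
  fixes \<theta> :: real
  assumes g: "g \<in> tuples G n" and H: "core G n \<theta> g = carrier G" and \<theta>: "0 < \<theta> * real n"
  shows "g \<in> generating_tuples G n"
proof -
  have "popular G n \<theta> g \<subseteq> g ` {1..n}"
  proof
    fix h assume "h \<in> popular G n \<theta> g"
    then have "\<theta> * real n \<le> real (card {i \<in> {1..n}. g i = h})" by (simp add: popular_def)
    then have "0 < real (card {i \<in> {1..n}. g i = h})" using \<theta> by linarith
    then have "{i \<in> {1..n}. g i = h} \<noteq> {}" by (metis card.empty less_irrefl of_nat_0)
    then show "h \<in> g ` {1..n}" by auto
  qed
  then have "carrier G \<subseteq> generate G (g ` {1..n})" 
    using mono_generate[of "popular G n \<theta> g" "g ` {1..n}"] H by (simp add: core_def)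
  moreover have "generate G (g ` {1..n}) \<subseteq> carrier G"
    using g by (intro generate_incl) (auto simp: tuples_def)
  ultimately show ?thesis using g by (auto simp: generating_tuples_def)
qed

lemma proper_subgroup_card:
  assumes fin: "finite (carrier G)" and H: "subgroup H G" "H \<noteq> carrier G"
  shows "2 * card H \<le> order G"
proof -
  have HG: "H \<subseteq> carrier G" using H(1) by (rule subgroup.subset)
  have lag: "card (rcosets H) * card H = order G" using lagrange[OF H(1)] .
  have "card H < order G" using HG H(2) fin by (auto simp: order_def intro: psubset_card_mono)
  then have "card (rcosets H) \<noteq> 0" "card (rcosets H) \<noteq> 1"
    using lag by (metis mult_0 not_less_zero, metis mult_1 less_irrefl)
  then have "2 \<le> card (rcosets H)" by linarith
  then show ?thesis using lag by (metis mult_le_mono1)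
qed

text \<open>
  A proper subgroup \<open>H\<close> has at most half the order of \<open>G\<close>, and a tuple with core \<open>H\<close> has its entries in \<open>H\<close>
  except at few indices. The factor \<open>2 ^ (- n)\<close> lost in this way beats the number of choices
  of the stray indices and of their entries. There are at most \<open>2 ^ order G\<close> subgroups.
\<close>

lemma card_full_core_ge:
  fixes \<theta> :: real
  assumes fin: "finite (carrier G)" and n: "n \<ge> 1" and \<theta>: "0 \<le> \<theta>"
    and small: "order G * \<theta> * ln (16 * real (order G)) \<le> 1 / 32"
  shows "real (order G) ^ n * (1 - 2 ^ order G * exp (- real n / 32))
       \<le> real (card {g \<in> tuples G n. core G n \<theta> g = carrier G})"
proof -
  let ?B = "real (order G)" and ?\<delta> = "real (order G) * \<theta>"
  let ?bad = "{g \<in> tuples G n. core G n \<theta> g \<noteq> carrier G}"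
  let ?\<H> = "{H. subgroup H G \<and> H \<noteq> carrier G}"
  let ?\<W> = "{W. W \<subseteq> {1..n} \<and> card W \<le> ?\<delta> * real n}"
  have B1: "order G \<ge> 1" using fin order_gt_0_iff_finite by auto
  have fint: "finite (tuples G n)" using fin by (auto simp: tuples_def intro: finite_PiE)
  have "?\<H> \<subseteq> Pow (carrier G)" using subgroup.subset by blast
  then have "card ?\<H> \<le> card (Pow (carrier G))" using fin by (intro card_mono) auto
  then have c\<H>: "card ?\<H> \<le> 2 ^ order G" using fin by (simp add: card_Pow order_def)
  have "real (card ?bad) = (\<Sum>g\<in>?bad. 1)" by simp
  also have "\<dots> \<le> (\<Sum>H\<in>?\<H>. \<Sum>W\<in>?\<W>. real (card H ^ n * order G ^ card W) * 1)"
    by (rule sum_over_core_stray_le[OF fin, where f = "\<lambda>_ _. 1" and \<theta> = \<theta>])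
       (use core_subgroup fin \<theta> in \<open>auto simp: card_stray_le\<close>, auto simp: stray_def)
  also have "\<dots> = (\<Sum>H\<in>?\<H>. real (card H) ^ n * (\<Sum>W\<in>?\<W>. ?B ^ card W))"
    by (simp add: sum_distrib_left)
  also have "\<dots> \<le> (\<Sum>H\<in>?\<H>. (?B / 2) ^ n * exp (3 * real n / 32))"
  proof (intro sum_mono mult_mono power_mono)
    fix H assume "H \<in> ?\<H>"
    then have "2 * card H \<le> order G" using proper_subgroup_card[OF fin] by auto
    then show "real (card H) \<le> ?B / 2" by linarith
    show "(\<Sum>W\<in>?\<W>. ?B ^ card W) \<le> exp (3 * real n / 32)"
      by (rule sum_power_small_subsets_le[OF B1 small])
  qed (auto intro: sum_nonneg)
  also have "\<dots> = real (card ?\<H>) * (?B ^ n * ((1 / 2) ^ n * exp (3 * real n / 32)))"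
    by (simp add: power_divide)
  also have "\<dots> \<le> 2 ^ order G * (?B ^ n * (exp (- 1 / 8) ^ n * exp (3 * real n / 32)))"
  proof (intro mult_mono power_mono)
    show "real (card ?\<H>) \<le> 2 ^ order G" using of_nat_mono[OF c\<H>, where 'a = real] by simp
    have "(1 :: real) / 2 \<le> 1 + - 1 / 8" by simp
    also have "\<dots> \<le> exp (- 1 / 8)" by (rule exp_ge_add_one_self)
    finally show "(1 :: real) / 2 \<le> exp (- 1 / 8)" .
  qed auto
  also have "exp (- 1 / 8) ^ n * exp (3 * real n / 32) = exp (- real n / 32)"
    by (simp add: exp_of_nat_mult[symmetric] exp_add[symmetric])
  finally have bad: "real (card ?bad) \<le> 2 ^ order G * (?B ^ n * exp (- real n / 32))" .
  have "{g \<in> tuples G n. core G n \<theta> g = carrier G} = tuples G n - ?bad" by auto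
  then have "real (card {g \<in> tuples G n. core G n \<theta> g = carrier G}) = real (card (tuples G n)) - real (card ?bad)"
    using fint by (simp add: card_Diff_subset of_nat_diff card_mono)
  also have "real (card (tuples G n)) = ?B ^ n"
    by (simp add: tuples_def card_PiE order_def)
  finally show ?thesis using bad by (simp add: algebra_simps)
qed

lemma kill_prob_bounds:
  fixes a \<theta> e :: real
  assumes fin: "finite (carrier G)" and p: "prime p" and N: "N = p ^ k"
    and ord: "\<And>x. x \<in> carrier G \<Longrightarrow> x [^] int N = \<one>"
    and g: "g \<in> tuples G n" and bal: "\<And>i. i \<in> {1..n} \<Longrightarrow> balanced_weights p a C (\<mu> i)"
    and a: "0 \<le> a" "a \<le> 1"
  defines "e \<equiv> exp (- a * \<theta> * n / (2 * (real N)\<^sup>2))"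
  shows "kill_prob G C n \<mu> g \<le> exp (real (order G) * real N * e) / card (core G n \<theta> g) *
        (1 - (1 - exp (- a * card (stray G n \<theta> g) / (2 * (real N)\<^sup>2 * order G))) / 2)" (is ?U)
    and "0 \<le> kill_prob G C n \<mu> g"
    and "core G n \<theta> g = carrier G \<Longrightarrow> N * e \<le> 1 / 2 \<Longrightarrow>
      exp (- 2 * real (order G) * real N * e) / order G \<le> kill_prob G C n \<mu> g"
proof -
  have gc: "\<And>i. i \<in> {1..n} \<Longrightarrow> g i \<in> carrier G" using g by (auto simp: tuples_def)
  have e: "e = exp (- a * (\<theta> * real n) / (2 * (real N)\<^sup>2))" by (simp add: e_def mult.assoc)
  have e0: "0 \<le> e" by (simp add: e_def)
  let ?q = "1 - (1 - exp (- a * card (stray G n \<theta> g) / (2 * (real N)\<^sup>2 * order G))) / 2"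
  have nonneg: "0 \<le> 1 - (1 - t) / 2" if "0 < t" for t :: real
    using that by (simp add: field_simps)
  have q0: "0 \<le> ?q" by (rule nonneg) simp
  have "kill_prob G C n \<mu> g \<le> (1 + N * e) ^ order G / card (core G n \<theta> g) * ?q"
    unfolding kill_prob_def stray_def
    by (rule walk_mean_identity_bounds(1)[OF fin p N ord _ gc bal a popular_def core_def e]) auto
  also have "\<dots> \<le> exp (N * e) ^ order G / card (core G n \<theta> g) * ?q"
    using q0 e0 exp_ge_add_one_self[of "N * e"]
    by (intro mult_right_mono divide_right_mono power_mono) auto
  also have "exp (N * e) ^ order G = exp (real (order G) * real N * e)"
    by (simp add: exp_of_nat_mult[symmetric] mult.assoc)
  finally show ?U .
  show "0 \<le> kill_prob G C n \<mu> g"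
    unfolding kill_prob_def
    using bal gc by (intro walk_mean_nonneg) (auto simp: balanced_weights_def)
  assume full: "core G n \<theta> g = carrier G" and Ne: "N * e \<le> 1 / 2"
  have "exp (- 2 * (N * e)) \<le> 1 - N * e"
  proof -
    have x0: "0 \<le> N * e" using e0 by simp
    have "- 2 * (N * e) \<le> - (N * e) - 2 * (N * e)\<^sup>2"
      using mult_left_mono[OF Ne x0] unfolding power2_eq_square by linarith
    also have "\<dots> \<le> ln (1 - N * e)" by (rule ln_one_minus_pos_lower_bound[OF x0 Ne])
    finally have "exp (- 2 * (N * e)) \<le> exp (ln (1 - N * e))" by simp
    then show ?thesis using Ne by simp
  qed
  then have "exp (- 2 * (N * e)) ^ order G \<le> (1 - N * e) ^ order G" by (intro power_mono) auto
  moreover have "exp (- 2 * (N * e)) ^ order G = exp (- 2 * real (order G) * real N * e)"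
    by (simp add: exp_of_nat_mult[symmetric] algebra_simps)
  ultimately have "exp (- 2 * real (order G) * real N * e) / order G \<le> (1 - N * e) ^ order G / order G"
    by (simp add: divide_right_mono)
  also have "\<dots> \<le> kill_prob G C n \<mu> g"
    unfolding kill_prob_def
    by (rule walk_mean_identity_bounds(2)[OF fin p N ord _ gc bal a popular_def core_def e]) (use full Ne in auto)
  finally show "exp (- 2 * real (order G) * real N * e) / order G \<le> kill_prob G C n \<mu> g" .
qed

end

section \<open>The sum over generating tuples\<close>

context comm_group
begin

text \<open>
  Tuples with full core give the main term \<open>1 / order G ^ u\<close>. The remaining generating tuples are
  grouped by their core \<open>H\<close> and by their nonempty set \<open>W\<close> of stray indices. The number of tuples in a group
  carries the factor \<open>card H ^ n\<close>, their probability the factor \<open>1 / card H ^ (n + u)\<close>; what is left is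
  a sum over \<open>W\<close> that no longer depends on \<open>H\<close>.
\<close>

lemma surjection_sum_bounds:
  fixes a :: "nat \<Rightarrow> real" and \<mu> :: "nat \<Rightarrow> nat \<Rightarrow> int \<Rightarrow> real" and \<theta> S E :: real
  assumes fin: "finite (carrier G)" and p: "prime p" and N: "N = p ^ k"
    and ord: "\<And>x. x \<in> carrier G \<Longrightarrow> x [^] int N = \<one>" and n: "n \<ge> 1"
    and bal: "\<And>i j. i \<in> {1..n} \<Longrightarrow> j \<in> {1..n + u} \<Longrightarrow> balanced_weights p (a j) C (\<mu> j i)"
    and a: "\<And>j. j \<in> {1..n + u} \<Longrightarrow> 0 \<le> a j" "\<And>j. j \<in> {1..n + u} \<Longrightarrow> a j \<le> 1"
    and \<theta>: "0 < \<theta>" and small: "order G * \<theta> * ln (16 * real (order G)) \<le> 1 / 32"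
    and many: "real n / 2 \<le>
      real (card {j \<in> {1..n + u}. 24 * (2 * (real N)\<^sup>2 * order G) * ln n \<le> a j * n})"
    and S: "S = (\<Sum>g\<in>generating_tuples G n. \<Prod>j\<in>{1..n + u}. kill_prob G C n (\<mu> j) g)"
    and E: "E = (\<Sum>j\<in>{1..n + u}. exp (- a j * \<theta> * n / (2 * (real N)\<^sup>2)))"
  shows "S \<le> exp (real (order G) * real N * E) *
      (1 / real (order G) ^ u + 2 ^ order G * (exp (order G / (real n)\<^sup>2) - 1 + exp (- real n / 32)))"
    and "N * E \<le> 1 / 2 \<Longrightarrow>
      (1 - 2 ^ order G * exp (- real n / 32)) * exp (- 2 * real (order G) * real N * E) / real (order G) ^ u \<le> S"
proof -
  let ?B = "real (order G)" and ?m = "n + u" and ?\<delta> = "real (order G) * \<theta>"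
  let ?e = "\<lambda>j. exp (- a j * \<theta> * n / (2 * (real N)\<^sup>2))"
  let ?q = "\<lambda>w j. 1 - (1 - exp (- a j * real w / (2 * (real N)\<^sup>2 * order G))) / 2"
  let ?P = "\<lambda>g. \<Prod>j\<in>{1..?m}. kill_prob G C n (\<mu> j) g"
  let ?\<psi> = "\<lambda>w :: nat. \<Prod>j\<in>{1..?m}. ?q w j"
  let ?full = "{g \<in> tuples G n. core G n \<theta> g = carrier G}"
  let ?bad = "{g \<in> generating_tuples G n. core G n \<theta> g \<noteq> carrier G}"
  let ?\<H> = "{H. subgroup H G}"
  let ?\<W> = "{W. W \<subseteq> {1..n} \<and> W \<noteq> {} \<and> card W \<le> ?\<delta> * real n}"
  have B1: "order G \<ge> 1" using fin order_gt_0_iff_finite by auto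
  have N0: "N > 0" using p N by (simp add: prime_gt_0_nat)
  have fint: "finite (tuples G n)" using fin by (auto simp: tuples_def intro: finite_PiE)
  have cardt: "real (card (tuples G n)) = ?B ^ n"
    by (simp add: tuples_def card_PiE order_def)
  have full_gen: "?full \<subseteq> generating_tuples G n"
    using full_core_generating[of _ n \<theta>] \<theta> n by auto
  have gen_tuples: "generating_tuples G n \<subseteq> tuples G n" by (auto simp: generating_tuples_def)
  have "?\<H> \<subseteq> Pow (carrier G)" using subgroup.subset by blast
  then have "card ?\<H> \<le> card (Pow (carrier G))" using fin by (intro card_mono) auto
  then have "card ?\<H> \<le> 2 ^ order G" using fin by (simp add: card_Pow order_def)
  from of_nat_mono[OF this, where 'a = real]
  have c\<H>: "real (card ?\<H>) \<le> 2 ^ order G" by simp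
  have nonneg: "0 \<le> 1 - (1 - t) / 2" if "0 < t" for t :: real
    using that by (simp add: field_simps)
  have q0: "0 \<le> ?q w j" for w j by (rule nonneg) simp
  have \<psi>0: "0 \<le> ?\<psi> w" for w by (intro prod_nonneg ballI q0)
  have kp1: "kill_prob G C n (\<mu> j) g
      \<le> exp (?B * N * ?e j) / real (card (core G n \<theta> g)) * ?q (card (stray G n \<theta> g)) j"
    if g: "g \<in> tuples G n" and j: "j \<in> {1..?m}" for g j
    by (rule kill_prob_bounds(1)[OF fin p N ord g bal[OF _ j] a(1)[OF j] a(2)[OF j]]; assumption)
  have kp2: "0 \<le> kill_prob G C n (\<mu> j) g" if g: "g \<in> tuples G n" and j: "j \<in> {1..?m}" for g j
    by (rule kill_prob_bounds(2)[OF fin p N ord g bal[OF _ j] a(1)[OF j] a(2)[OF j]]; assumption)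
  have kp3: "exp (- 2 * ?B * N * ?e j) / ?B \<le> kill_prob G C n (\<mu> j) g"
    if g: "g \<in> tuples G n" and j: "j \<in> {1..?m}" and "core G n \<theta> g = carrier G" "N * ?e j \<le> 1 / 2"
    for g j
    by (rule kill_prob_bounds(3)[OF fin p N ord g bal[OF _ j] a(1)[OF j] a(2)[OF j]]) (use that in auto)
  have P_le: "?P g \<le> exp (?B * N * E) / real (card (core G n \<theta> g)) ^ ?m * ?\<psi> (card (stray G n \<theta> g))"
    if g: "g \<in> tuples G n" for g
  proof -
    have "?P g \<le> (\<Prod>j\<in>{1..?m}. exp (?B * N * ?e j) / real (card (core G n \<theta> g)) * ?q (card (stray G n \<theta> g)) j)"
      using g by (intro prod_mono conjI kp1 kp2) auto
    also have "\<dots> = exp (?B * N * E) / real (card (core G n \<theta> g)) ^ ?m * ?\<psi> (card (stray G n \<theta> g))"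
      by (simp add: prod.distrib prod_dividef exp_sum[symmetric] E sum_distrib_left)
    finally show ?thesis .
  qed
  have split: "S = (\<Sum>g\<in>?full. ?P g) + (\<Sum>g\<in>?bad. ?P g)"
  proof -
    have "generating_tuples G n = ?full \<union> ?bad" using full_gen gen_tuples by auto
    then have "S = (\<Sum>g\<in>?full \<union> ?bad. ?P g)" unfolding S by simp
    also have "\<dots> = (\<Sum>g\<in>?full. ?P g) + (\<Sum>g\<in>?bad. ?P g)"
      using fint finite_subset[OF gen_tuples fint] by (intro sum.union_disjoint) auto
    finally show ?thesis .
  qed
  have full_le: "(\<Sum>g\<in>?full. ?P g) \<le> exp (?B * N * E) * (1 / ?B ^ u)"
  proof -
    have "(\<Sum>g\<in>?full. ?P g) \<le> (\<Sum>g\<in>?full. exp (?B * N * E) / ?B ^ ?m)"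
    proof (rule sum_mono)
      fix g assume g: "g \<in> ?full"
      then have "stray G n \<theta> g = {}" by (auto simp: stray_def tuples_def)
      then show "?P g \<le> exp (?B * N * E) / ?B ^ ?m"
        using P_le[of g] g by (simp add: order_def)
    qed
    also have "\<dots> = real (card ?full) * (exp (?B * N * E) / ?B ^ ?m)" by simp
    also have "\<dots> \<le> ?B ^ n * (exp (?B * N * E) / ?B ^ ?m)"
      unfolding cardt[symmetric] using fint by (intro mult_right_mono of_nat_mono card_mono) auto
    also have "\<dots> = exp (?B * N * E) * (1 / ?B ^ u)"
      using B1 by (simp add: power_add field_simps)
    finally show ?thesis .
  qed
  have bad_le: "(\<Sum>g\<in>?bad. ?P g)
      \<le> exp (?B * N * E) * (2 ^ order G * (exp (?B / (real n)\<^sup>2) - 1 + exp (- real n / 32)))"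
  proof -
    let ?f = "\<lambda>H W. exp (?B * N * E) / real (card H) ^ ?m * ?\<psi> (card W)"
    have "(\<Sum>g\<in>?bad. ?P g) \<le> (\<Sum>g\<in>?bad. ?f (core G n \<theta> g) (stray G n \<theta> g))"
      using gen_tuples by (intro sum_mono P_le) auto
    also have "\<dots> \<le> (\<Sum>H\<in>?\<H>. \<Sum>W\<in>?\<W>. real (card H ^ n * order G ^ card W) * ?f H W)"
    proof (rule sum_over_core_stray_le[OF fin])
      show "?bad \<subseteq> tuples G n" using gen_tuples by auto
      show "core G n \<theta> g \<in> ?\<H>" for g using core_subgroup by simp
      show "stray G n \<theta> g \<in> ?\<W>" if "g \<in> ?bad" for g
        using that gen_tuples stray_nonempty card_stray_le[OF fin, of g n \<theta>] \<theta>
        by (auto simp: stray_def)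
      show "0 \<le> ?f H W" for H W using \<psi>0 by simp
    qed auto
    also have "\<dots> \<le> (\<Sum>H\<in>?\<H>. \<Sum>W\<in>?\<W>. exp (?B * N * E) * (?B ^ card W * ((1 / real n ^ 3) ^ card W + exp (- real n / 8))))"
    proof (intro sum_mono)
      fix H W assume H: "H \<in> ?\<H>"
      have "finite H" using H fin subgroup.subset finite_subset by blast
      moreover have "H \<noteq> {}" using H subgroup.one_closed by auto
      ultimately have "card H > 0" by (simp add: card_gt_0_iff)
      then have H1: "real (card H) \<ge> 1" by linarith
      have \<psi>_le: "?\<psi> (card W) \<le> (1 / real n ^ 3) ^ card W + exp (- real n / 8)"
        by (rule prod_escape_le[OF n _ a(1) many]) (use N0 B1 in auto)
      have le: "exp (?B * N * E) * (?B ^ card W * ?\<psi> (card W))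
          \<le> exp (?B * N * E) * (?B ^ card W * ((1 / real n ^ 3) ^ card W + exp (- real n / 8)))"
        by (intro mult_left_mono \<psi>_le) auto
      have "real (card H ^ n * order G ^ card W) * ?f H W
          = exp (?B * N * E) * (?B ^ card W * ?\<psi> (card W)) / real (card H) ^ u"
        using H1 by (simp add: power_add)
      also have "\<dots> \<le> exp (?B * N * E) * (?B ^ card W * ?\<psi> (card W)) / 1"
        using H1 \<psi>0 by (intro divide_left_mono) (auto intro: one_le_power)
      also note le
      finally show "real (card H ^ n * order G ^ card W) * ?f H W
          \<le> exp (?B * N * E) * (?B ^ card W * ((1 / real n ^ 3) ^ card W + exp (- real n / 8)))"
        by simp
    qed
    also have "\<dots> = real (card ?\<H>) * (exp (?B * N * E) *
        ((\<Sum>W\<in>?\<W>. (?B / real n ^ 3) ^ card W) + exp (- real n / 8) * (\<Sum>W\<in>?\<W>. ?B ^ card W)))"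
      by (simp add: sum_distrib_left[symmetric] sum.distrib sum_distrib_right[symmetric] distrib_left
          power_mult_distrib[symmetric] mult.commute[of "exp (- real n / 8)"])
    also have "\<dots> \<le> 2 ^ order G * (exp (?B * N * E) * ((exp (?B / (real n)\<^sup>2) - 1) + exp (- real n / 32)))"
    proof (intro mult_mono add_mono c\<H>)
      let ?x = "?B / real n ^ 3"
      have "?\<W> \<subseteq> Pow {1..n} - {{}}" by auto
      then have "(\<Sum>W\<in>?\<W>. ?x ^ card W) \<le> (\<Sum>W\<in>Pow {1..n} - {{}}. ?x ^ card W)"
        by (intro sum_mono2) auto
      also have "\<dots> = (1 + ?x) ^ n - 1"
        using sum_power_card_Pow[of "{1..n}" ?x] by (simp add: sum_diff1)
      also have "(1 + ?x) ^ n \<le> exp ?x ^ n"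
        using exp_ge_add_one_self[of ?x] by (intro power_mono) auto
      also have "exp ?x ^ n = exp (?B / (real n)\<^sup>2)"
        using n by (simp add: exp_of_nat_mult[symmetric] power2_eq_square power3_eq_cube)
      finally show "(\<Sum>W\<in>?\<W>. ?x ^ card W) \<le> exp (?B / (real n)\<^sup>2) - 1" by simp
      have "(\<Sum>W\<in>?\<W>. ?B ^ card W) \<le> (\<Sum>W\<in>{W. W \<subseteq> {1..n} \<and> card W \<le> ?\<delta> * real n}. ?B ^ card W)"
        by (intro sum_mono2) auto
      also have "\<dots> \<le> exp (3 * real n / 32)" by (rule sum_power_small_subsets_le[OF B1 small])
      finally have "exp (- real n / 8) * (\<Sum>W\<in>?\<W>. ?B ^ card W) \<le> exp (- real n / 8) * exp (3 * real n / 32)"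
        by (intro mult_left_mono) auto
      also have "\<dots> = exp (- real n / 32)" by (simp add: exp_add[symmetric])
      finally show "exp (- real n / 8) * (\<Sum>W\<in>?\<W>. ?B ^ card W) \<le> exp (- real n / 32)" .
    qed (auto intro!: sum_nonneg add_nonneg_nonneg mult_nonneg_nonneg)
    finally show ?thesis by (simp add: mult.left_commute)
  qed
  show "S \<le> exp (?B * N * E) *
      (1 / real (order G) ^ u + 2 ^ order G * (exp (?B / (real n)\<^sup>2) - 1 + exp (- real n / 32)))"
    unfolding split using full_le bad_le by (simp add: distrib_left)
  assume NE: "N * E \<le> 1 / 2"
  have P_ge: "exp (- 2 * ?B * N * E) / ?B ^ ?m \<le> ?P g" if g: "g \<in> ?full" for g
  proof -
    have Ne: "N * ?e j \<le> 1 / 2" if "j \<in> {1..?m}" for j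
    proof -
      have "?e j \<le> E" unfolding E by (rule member_le_sum[OF that]) auto
      then have "N * ?e j \<le> N * E" by (intro mult_left_mono) auto
      then show ?thesis using NE by linarith
    qed
    have "exp (- 2 * ?B * N * E) / ?B ^ ?m = (\<Prod>j\<in>{1..?m}. exp (- 2 * ?B * N * ?e j) / ?B)"
      by (simp add: prod_dividef exp_sum[symmetric] E sum_distrib_left sum_negf)
    also have "\<dots> \<le> ?P g"
      using g Ne by (intro prod_mono conjI kp3) auto
    finally show ?thesis .
  qed
  have bad0: "0 \<le> (\<Sum>g\<in>?bad. ?P g)"
    using gen_tuples by (intro sum_nonneg prod_nonneg ballI kp2) auto
  have "(1 - 2 ^ order G * exp (- real n / 32)) * exp (- 2 * ?B * N * E) / ?B ^ u
      = (?B ^ n * (1 - 2 ^ order G * exp (- real n / 32))) * (exp (- 2 * ?B * N * E) / ?B ^ ?m)"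
    using B1 by (simp add: power_add)
  also have "\<dots> \<le> real (card ?full) * (exp (- 2 * ?B * N * E) / ?B ^ ?m)"
    using \<theta> by (intro mult_right_mono card_full_core_ge[OF fin n _ small]) auto
  also have "\<dots> = (\<Sum>g\<in>?full. exp (- 2 * ?B * N * E) / ?B ^ ?m)" by simp
  also have "\<dots> \<le> (\<Sum>g\<in>?full. ?P g)" by (intro sum_mono P_ge)
  also have "\<dots> \<le> S" using split bad0 by simp
  finally show "(1 - 2 ^ order G * exp (- real n / 32)) * exp (- 2 * ?B * N * E) / real (order G) ^ u \<le> S"
    by simp
qed

text \<open>
  A column with \<open>\<alpha> n j * n < L * ln n\<close> contributes at least \<open>1 / n\<close> to the sum that tends to \<open>0\<close>.
\<close>

lemma many_balanced_columns:
  fixes \<alpha> :: "nat \<Rightarrow> nat \<Rightarrow> real" and L :: real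
  assumes \<alpha>: "\<And>n j. n \<ge> 1 \<Longrightarrow> j \<in> {1..n + u} \<Longrightarrow> 0 \<le> \<alpha> n j"
    and lim: "(\<lambda>n. \<Sum>j=1..n + u. exp (- (1 / L) * \<alpha> n j * real n)) \<longlonglongrightarrow> 0" and L: "L > 0"
  shows "\<forall>\<^sub>F n in sequentially. real n / 2 \<le> real (card {j \<in> {1..n + u}. L * ln n \<le> \<alpha> n j * n})"
proof -
  have "\<forall>\<^sub>F n in sequentially. (\<Sum>j=1..n + u. exp (- (1 / L) * \<alpha> n j * real n)) < 1 / 2"
    using order_tendstoD(2)[OF lim, of "1 / 2"] by simp
  then show ?thesis using eventually_ge_at_top[of 1]
  proof eventually_elim
    case (elim n)
    let ?g = "{j \<in> {1..n + u}. L * ln n \<le> \<alpha> n j * n}" and ?b = "{j \<in> {1..n + u}. \<not> L * ln n \<le> \<alpha> n j * n}"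
    have "real (card ?b) * (1 / n) = (\<Sum>j\<in>?b. 1 / real n)" by simp
    also have "\<dots> \<le> (\<Sum>j\<in>?b. exp (- (1 / L) * \<alpha> n j * real n))"
    proof (rule sum_mono)
      fix j assume "j \<in> ?b"
      then have "- ln (real n) \<le> - (1 / L) * \<alpha> n j * real n" using L by (simp add: field_simps)
      then have "exp (- ln (real n)) \<le> exp (- (1 / L) * \<alpha> n j * real n)" by simp
      then show "1 / real n \<le> exp (- (1 / L) * \<alpha> n j * real n)"
        using elim(2) by (simp add: exp_minus inverse_eq_divide)
    qed
    also have "\<dots> \<le> (\<Sum>j=1..n + u. exp (- (1 / L) * \<alpha> n j * real n))"
      by (intro sum_mono2) auto
    finally have "real (card ?b) * (1 / n) < 1 / 2" using elim(1) by linarith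
    then have b: "real (card ?b) < real n / 2" using elim(2) by (simp add: field_simps)
    have "card ?g + card ?b = card (?g \<union> ?b)" by (subst card_Un_disjoint) auto
    also have "?g \<union> ?b = {1..n + u}" by auto
    finally have "real (card ?g) + real (card ?b) = real n + real u" by simp
    then show "real n / 2 \<le> real (card ?g)" using b by linarith
  qed
qed

text \<open>
  The threshold \<open>\<theta>\<close> depends on the group only, so the bounds hold for all large \<open>n\<close> with the same \<open>\<theta>\<close>, and
  their error \<open>E\<close> is the sum in the hypothesis at \<open>\<epsilon> = \<theta> / (2 * N\<^sup>2)\<close>.
\<close>

theorem surjection_sum_tendsto:
  fixes \<alpha> :: "nat \<Rightarrow> nat \<Rightarrow> real" and \<mu> :: "nat \<Rightarrow> nat \<Rightarrow> nat \<Rightarrow> int \<Rightarrow> real"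
  assumes fin: "finite (carrier G)" and p: "prime p" and N: "N = p ^ k"
    and ord: "\<And>x. x \<in> carrier G \<Longrightarrow> x [^] int N = \<one>"
    and bal: "\<And>n i j. n \<ge> 1 \<Longrightarrow> i \<in> {1..n} \<Longrightarrow> j \<in> {1..n + u} \<Longrightarrow> balanced_weights p (\<alpha> n j) C (\<mu> n j i)"
    and \<alpha>: "\<And>n j. n \<ge> 1 \<Longrightarrow> j \<in> {1..n + u} \<Longrightarrow> 0 \<le> \<alpha> n j \<and> \<alpha> n j \<le> 1"
    and lim: "\<And>\<epsilon>. \<epsilon> > 0 \<Longrightarrow> (\<lambda>n. \<Sum>j=1..n + u. exp (- \<epsilon> * \<alpha> n j * real n)) \<longlonglongrightarrow> 0"
  shows "(\<lambda>n. \<Sum>g\<in>generating_tuples G n. \<Prod>j\<in>{1..n + u}. kill_prob G C n (\<mu> n j) g)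
      \<longlonglongrightarrow> 1 / real (order G) ^ u"
proof -
  let ?B = "real (order G)"
  let ?S = "\<lambda>n. \<Sum>g\<in>generating_tuples G n. \<Prod>j\<in>{1..n + u}. kill_prob G C n (\<mu> n j) g"
  have B1: "order G \<ge> 1" using fin order_gt_0_iff_finite by auto
  have N0: "N > 0" using p N by (simp add: prime_gt_0_nat)
  have l0: "0 < ln (16 * ?B)" using B1 by simp
  \<comment> \<open>The largest threshold for which \<open>sum_power_small_subsets_le\<close> applies to the at most \<open>order G * \<theta> * n\<close> stray indices.\<close>
  define \<theta> where "\<theta> = 1 / (32 * ?B * ln (16 * ?B))"
  have \<theta>: "\<theta> > 0" using B1 l0 by (simp add: \<theta>_def)
  have small: "?B * \<theta> * ln (16 * ?B) \<le> 1 / 32" using B1 l0 by (simp add: \<theta>_def)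
  define E where "E = (\<lambda>n. \<Sum>j\<in>{1..n + u}. exp (- \<alpha> n j * \<theta> * n / (2 * (real N)\<^sup>2)))"
  have "\<theta> / (2 * (real N)\<^sup>2) > 0" using \<theta> N0 by simp
  from lim[OF this] have E0: "E \<longlonglongrightarrow> 0" by (simp add: E_def mult.commute mult.left_commute)
  \<comment> \<open>The constant that \<open>prod_escape_le\<close> needs for the escape factors in \<open>kill_prob_bounds\<close>.\<close>
  define L where "L = 24 * (2 * (real N)\<^sup>2 * ?B)"
  have L: "L > 0" using N0 B1 by (simp add: L_def)
  have many: "\<forall>\<^sub>F n in sequentially. real n / 2 \<le> real (card {j \<in> {1..n + u}. L * ln n \<le> \<alpha> n j * n})"
    by (rule many_balanced_columns[OF _ lim L]) (use \<alpha> L in auto)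
  define up where "up = (\<lambda>n. exp (?B * N * E n) *
      (1 / ?B ^ u + 2 ^ order G * (exp (?B / (real n)\<^sup>2) - 1 + exp (- real n / 32))))"
  define lo where "lo = (\<lambda>n. (1 - 2 ^ order G * exp (- real n / 32)) * exp (- 2 * ?B * N * E n) / ?B ^ u)"
  have "\<forall>\<^sub>F n in sequentially. ?S n \<le> up n"
    using many eventually_ge_at_top[of 1]
  proof eventually_elim
    case (elim n)
    show ?case unfolding up_def
      by (rule surjection_sum_bounds(1)[where a = "\<alpha> n" and \<mu> = "\<mu> n" and E = "E n",
          OF fin p N ord elim(2) bal[OF elim(2)] _ _ \<theta> small _ refl])
         (use elim \<alpha> in \<open>auto simp: E_def L_def\<close>)
  qed
  moreover have "\<forall>\<^sub>F n in sequentially. lo n \<le> ?S n"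
  proof -
    have "(\<lambda>n. N * E n) \<longlonglongrightarrow> real N * 0" by (intro tendsto_intros E0)
    then have "\<forall>\<^sub>F n in sequentially. N * E n < 1 / 2"
      by (intro order_tendstoD(2)) auto
    with many show ?thesis using eventually_ge_at_top[of 1]
    proof eventually_elim
      case (elim n)
      have NE: "N * E n \<le> 1 / 2" using elim(2) by simp
      show ?case unfolding lo_def
        by (rule surjection_sum_bounds(2)[where a = "\<alpha> n" and \<mu> = "\<mu> n" and E = "E n",
            OF fin p N ord elim(3) bal[OF elim(3)] _ _ \<theta> small _ refl])
           (use elim \<alpha> NE in \<open>auto simp: E_def L_def\<close>)
    qed
  qed
  moreover have "lo \<longlonglongrightarrow> (1 - 2 ^ order G * 0) * exp (- 2 * ?B * N * 0) / ?B ^ u"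
    unfolding lo_def using B1
    by (intro tendsto_intros E0) (real_asymp | simp)+
  moreover have "up \<longlonglongrightarrow> exp (?B * N * 0) * (1 / ?B ^ u + 2 ^ order G * (1 - 1 + 0))"
  proof -
    have "(\<lambda>n. exp (?B / (real n)\<^sup>2)) \<longlonglongrightarrow> 1" by real_asymp
    moreover have "(\<lambda>n. exp (- real n / 32)) \<longlonglongrightarrow> 0" by real_asymp
    ultimately show ?thesis unfolding up_def by (intro tendsto_intros E0)
  qed
  ultimately show ?thesis
    using tendsto_sandwich[of lo ?S sequentially up "1 / ?B ^ u"] by simp
qed

end

section \<open>The p-adic integers and the cokernel\<close>

lemma Zp_carrier_mod:
  assumes "x \<in> carrier (Zp p)" and "k \<le> l"
  shows "x l mod int p ^ k = x k"
  using assms(2)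
proof (induction l rule: dec_induct)
  case base
  have "x k \<in> {0..<int p ^ k}" using assms(1) by (simp add: Zp_def)
  then show ?case by simp
next
  case (step l)
  have "x (Suc l) mod int p ^ l = x l" using assms(1) by (simp add: Zp_def)
  moreover have "int p ^ k dvd int p ^ l" using step by (simp add: le_imp_power_dvd)
  ultimately show ?case using step.IH by (metis mod_mod_cancel)
qed

text \<open>
  A sequence of integers whose successive terms agree modulo the powers of \<open>p\<close> defines a \<open>p\<close>-adic integer.
\<close>

lemma Zp_memI:
  assumes p: "p > 0" and "\<And>k. z (Suc k) mod int p ^ k = z k mod int p ^ k"
  shows "(\<lambda>k. z k mod int p ^ k) \<in> carrier (Zp p)"
  using assms by (simp add: Zp_def mod_mod_cancel)

lemma Zp_lift_sum:
  assumes "x \<in> carrier (Zp p)" "y \<in> carrier (Zp p)"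
  shows "(x (Suc k) + y (Suc k)) mod int p ^ k = (x k + y k) mod int p ^ k"
    and "(x (Suc k) * y (Suc k)) mod int p ^ k = (x k * y k) mod int p ^ k"
    and "(- x (Suc k)) mod int p ^ k = (- x k) mod int p ^ k"
  using assms Zp_carrier_mod[OF assms(1), of k "Suc k"] Zp_carrier_mod[OF assms(2), of k "Suc k"]
  by (metis le_Suc_eq mod_add_eq order_refl, metis le_Suc_eq mod_mult_eq order_refl,
      metis le_Suc_eq mod_minus_eq order_refl)

lemma cring_Zp:
  assumes p: "p > 0"
  shows "cring (Zp p)"
proof (rule cringI)
  have zero: "\<zero>\<^bsub>Zp p\<^esub> \<in> carrier (Zp p)" using p by (simp add: Zp_def)
  have add: "x \<oplus>\<^bsub>Zp p\<^esub> y \<in> carrier (Zp p)" if "x \<in> carrier (Zp p)" "y \<in> carrier (Zp p)" for x y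
    using Zp_memI[OF p, of "\<lambda>k. x k + y k"] Zp_lift_sum(1)[OF that] by (simp add: Zp_def)
  have mod_id: "x k mod int p ^ k = x k" if "x \<in> carrier (Zp p)" for x k
    using Zp_carrier_mod[OF that, of k k] by simp
  show "abelian_group (Zp p)"
  proof (rule abelian_groupI)
    show "\<exists>y\<in>carrier (Zp p). y \<oplus>\<^bsub>Zp p\<^esub> x = \<zero>\<^bsub>Zp p\<^esub>" if x: "x \<in> carrier (Zp p)" for x
    proof
      show "(\<lambda>k. (- x k) mod int p ^ k) \<in> carrier (Zp p)"
        by (rule Zp_memI[OF p]) (rule Zp_lift_sum(3)[OF x x])
      show "(\<lambda>k. (- x k) mod int p ^ k) \<oplus>\<^bsub>Zp p\<^esub> x = \<zero>\<^bsub>Zp p\<^esub>"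
        by (auto simp: Zp_def mod_simps)
    qed
  qed (use zero add mod_id in \<open>auto simp: Zp_def mod_simps ac_simps fun_eq_iff\<close>)
  show "Group.comm_monoid (Zp p)"
  proof (rule comm_monoidI)
    show "x \<otimes>\<^bsub>Zp p\<^esub> y \<in> carrier (Zp p)" if "x \<in> carrier (Zp p)" "y \<in> carrier (Zp p)" for x y
      using Zp_memI[OF p, of "\<lambda>k. x k * y k"] Zp_lift_sum(2)[OF that] by (simp add: Zp_def)
    show "\<one>\<^bsub>Zp p\<^esub> \<in> carrier (Zp p)"
      using Zp_memI[OF p, of "\<lambda>k. 1"] by (simp add: Zp_def)
  qed (use mod_id in \<open>auto simp: Zp_def mod_simps ac_simps fun_eq_iff\<close>)
qed (auto simp: Zp_def mod_simps fun_eq_iff algebra_simps)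

lemma Zp_add_apply: "(x \<oplus>\<^bsub>Zp p\<^esub> y) k = (x k + y k) mod int p ^ k"
  and Zp_mult_apply: "(x \<otimes>\<^bsub>Zp p\<^esub> y) k = (x k * y k) mod int p ^ k"
  and Zp_zero_apply: "\<zero>\<^bsub>Zp p\<^esub> k = 0"
  and Zp_one_apply: "\<one>\<^bsub>Zp p\<^esub> k = 1 mod int p ^ k"
  by (simp_all add: Zp_def)

lemma mod_sum_cong:
  fixes f g :: "'a \<Rightarrow> int"
  assumes "\<And>j. j \<in> J \<Longrightarrow> f j mod q = g j mod q"
  shows "sum f J mod q = sum g J mod q"
proof -
  have "sum f J mod q = (\<Sum>j\<in>J. f j mod q) mod q" by (rule mod_sum_eq[symmetric])
  also have "(\<Sum>j\<in>J. f j mod q) = (\<Sum>j\<in>J. g j mod q)" by (rule sum.cong[OF refl assms])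
  also have "\<dots> mod q = sum g J mod q" by (rule mod_sum_eq)
  finally show ?thesis .
qed

lemma finsum_Zp_apply:
  assumes p: "p > 0" and "finite J" and "\<And>j. j \<in> J \<Longrightarrow> f j \<in> carrier (Zp p)"
  shows "(\<Oplus>\<^bsub>Zp p\<^esub>j\<in>J. f j) k = (\<Sum>j\<in>J. f j k) mod int p ^ k"
  using assms(2,3)
proof (induction J rule: finite_induct)
  case empty
  interpret cring "Zp p" by (rule cring_Zp[OF p])
  show ?case by (simp add: Zp_zero_apply)
next
  case (insert j J)
  interpret cring "Zp p" by (rule cring_Zp[OF p])
  have "(\<Oplus>\<^bsub>Zp p\<^esub>j\<in>insert j J. f j) = f j \<oplus>\<^bsub>Zp p\<^esub> (\<Oplus>\<^bsub>Zp p\<^esub>j\<in>J. f j)"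
    using insert by (intro finsum_insert) auto
  then have "(\<Oplus>\<^bsub>Zp p\<^esub>j\<in>insert j J. f j) k = (f j k + (\<Oplus>\<^bsub>Zp p\<^esub>j\<in>J. f j) k) mod int p ^ k"
    by (simp add: Zp_def)
  then show ?case using insert by (simp add: mod_simps)
qed

lemma free_module_simps:
  "carrier (free_module R n) = {1..n} \<rightarrow>\<^sub>E carrier R"
  "\<zero>\<^bsub>free_module R n\<^esub> = (\<lambda>i\<in>{1..n}. \<zero>\<^bsub>R\<^esub>)"
  "x \<oplus>\<^bsub>free_module R n\<^esub> y = (\<lambda>i\<in>{1..n}. x i \<oplus>\<^bsub>R\<^esub> y i)"
  "a \<odot>\<^bsub>free_module R n\<^esub> x = (\<lambda>i\<in>{1..n}. a \<otimes>\<^bsub>R\<^esub> x i)"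
  by (simp_all add: free_module_def)

lemma abelian_group_free_module:
  assumes "cring R"
  shows "abelian_group (free_module R n)"
proof -
  interpret cring R by fact
  have mem: "x i \<in> carrier R" if "x \<in> carrier (free_module R n)" "i \<in> {1..n}" for x i
    using that by (auto simp: free_module_simps)
  show ?thesis
  proof (rule abelian_groupI)
    fix x y z
    assume x: "x \<in> carrier (free_module R n)" and y: "y \<in> carrier (free_module R n)"
      and z: "z \<in> carrier (free_module R n)"
    show "x \<oplus>\<^bsub>free_module R n\<^esub> y \<in> carrier (free_module R n)"
      using mem[OF x] mem[OF y] unfolding free_module_simps by auto
    show "x \<oplus>\<^bsub>free_module R n\<^esub> y \<oplus>\<^bsub>free_module R n\<^esub> z
        = x \<oplus>\<^bsub>free_module R n\<^esub> (y \<oplus>\<^bsub>free_module R n\<^esub> z)"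
      unfolding free_module_simps
      by (rule restrict_ext) (simp add: a_assoc mem[OF x] mem[OF y] mem[OF z])
    show "x \<oplus>\<^bsub>free_module R n\<^esub> y = y \<oplus>\<^bsub>free_module R n\<^esub> x"
      unfolding free_module_simps by (rule restrict_ext) (rule a_comm[OF mem[OF x] mem[OF y]])
  next
    fix x assume x: "x \<in> carrier (free_module R n)"
    show "\<zero>\<^bsub>free_module R n\<^esub> \<oplus>\<^bsub>free_module R n\<^esub> x = x"
    proof
      fix i show "(\<zero>\<^bsub>free_module R n\<^esub> \<oplus>\<^bsub>free_module R n\<^esub> x) i = x i"
        using x mem[OF x, of i] unfolding free_module_simps
        by (auto simp: PiE_def extensional_def)
    qed
    show "\<exists>y\<in>carrier (free_module R n). y \<oplus>\<^bsub>free_module R n\<^esub> x = \<zero>\<^bsub>free_module R n\<^esub>"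
    proof
      show "(\<lambda>i\<in>{1..n}. \<ominus>\<^bsub>R\<^esub> x i) \<in> carrier (free_module R n)"
        using mem[OF x] unfolding free_module_simps by auto
      show "(\<lambda>i\<in>{1..n}. \<ominus>\<^bsub>R\<^esub> x i) \<oplus>\<^bsub>free_module R n\<^esub> x = \<zero>\<^bsub>free_module R n\<^esub>"
        unfolding free_module_simps by (rule restrict_ext) (simp add: l_neg mem[OF x])
    qed
  qed (simp add: free_module_simps)
qed

locale zp_matrix =
  fixes p n m :: nat and A :: "nat \<Rightarrow> nat \<Rightarrow> padic"
  assumes p: "p > 0"
    and A: "\<And>i j. i \<in> {1..n} \<Longrightarrow> j \<in> {1..m} \<Longrightarrow> A i j \<in> carrier (Zp p)"
begin

sublocale R: cring "Zp p" by (rule cring_Zp[OF p])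
sublocale F: abelian_group "free_module (Zp p) n" by (rule abelian_group_free_module) (rule R.is_cring)
sublocale D: abelian_group "free_module (Zp p) m" by (rule abelian_group_free_module) (rule R.is_cring)

abbreviation "F \<equiv> free_module (Zp p) n"
abbreviation "im \<equiv> mat_map (Zp p) n m A ` carrier (free_module (Zp p) m)"

lemma mat_map_apply:
  assumes "x \<in> carrier (free_module (Zp p) m)" "i \<in> {1..n}"
  shows "mat_map (Zp p) n m A x i k = (\<Sum>j\<in>{1..m}. A i j k * x j k) mod int p ^ k"
proof -
  have "mat_map (Zp p) n m A x i k = (\<Sum>j\<in>{1..m}. (A i j \<otimes>\<^bsub>Zp p\<^esub> x j) k) mod int p ^ k"
    unfolding mat_map_def using assms A
    by (simp, subst finsum_Zp_apply[OF p]) (auto simp: free_module_simps intro!: R.m_closed)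
  also have "\<dots> = (\<Sum>j\<in>{1..m}. (A i j k * x j k) mod int p ^ k) mod int p ^ k"
    by (simp add: Zp_mult_apply)
  finally show ?thesis by (simp add: mod_sum_eq)
qed

lemma mat_map_closed:
  assumes "x \<in> carrier (free_module (Zp p) m)"
  shows "mat_map (Zp p) n m A x \<in> carrier F"
  unfolding mat_map_def free_module_simps
  using assms A by (auto simp: free_module_simps intro!: R.finsum_closed R.m_closed)

lemma free_module_eqI:
  assumes "u \<in> carrier F" "v \<in> carrier F" "\<And>i k. i \<in> {1..n} \<Longrightarrow> u i k = v i k"
  shows "u = v"
proof (rule PiE_ext)
  show "u \<in> {1..n} \<rightarrow>\<^sub>E carrier (Zp p)" "v \<in> {1..n} \<rightarrow>\<^sub>E carrier (Zp p)"
    using assms(1,2) by (auto simp: free_module_simps)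
qed (use assms(3) in auto)

lemma smult_closed:
  "a \<in> carrier (Zp p) \<Longrightarrow> x \<in> carrier (free_module (Zp p) l) \<Longrightarrow>
    a \<odot>\<^bsub>free_module (Zp p) l\<^esub> x \<in> carrier (free_module (Zp p) l)"
  by (auto simp: free_module_simps)

lemma mat_map_add:
  assumes x: "x \<in> carrier (free_module (Zp p) m)" and y: "y \<in> carrier (free_module (Zp p) m)"
  shows "mat_map (Zp p) n m A (x \<oplus>\<^bsub>free_module (Zp p) m\<^esub> y)
       = mat_map (Zp p) n m A x \<oplus>\<^bsub>F\<^esub> mat_map (Zp p) n m A y"
proof (rule free_module_eqI)
  fix i k assume i: "i \<in> {1..n}"
  have "(\<Sum>j\<in>{1..m}. A i j k * ((x j k + y j k) mod int p ^ k)) mod int p ^ k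
      = (\<Sum>j\<in>{1..m}. A i j k * x j k + A i j k * y j k) mod int p ^ k"
    by (rule mod_sum_cong) (simp add: mod_simps algebra_simps)
  then show "mat_map (Zp p) n m A (x \<oplus>\<^bsub>free_module (Zp p) m\<^esub> y) i k
      = (mat_map (Zp p) n m A x \<oplus>\<^bsub>F\<^esub> mat_map (Zp p) n m A y) i k"
    using i x y mat_map_apply[OF D.add.m_closed[OF x y] i] mat_map_apply[OF x i] mat_map_apply[OF y i]
    by (simp add: free_module_simps Zp_add_apply mod_simps sum.distrib)
qed (use x y mat_map_closed in auto)

lemma mat_map_smult:
  assumes a: "a \<in> carrier (Zp p)" and x: "x \<in> carrier (free_module (Zp p) m)"
  shows "mat_map (Zp p) n m A (a \<odot>\<^bsub>free_module (Zp p) m\<^esub> x) = a \<odot>\<^bsub>F\<^esub> mat_map (Zp p) n m A x"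
proof (rule free_module_eqI)
  fix i k assume i: "i \<in> {1..n}"
  have "(\<Sum>j\<in>{1..m}. A i j k * ((a k * x j k) mod int p ^ k)) mod int p ^ k
      = (\<Sum>j\<in>{1..m}. a k * (A i j k * x j k)) mod int p ^ k"
    by (rule mod_sum_cong) (simp add: mod_mult_right_eq mult.left_commute)
  then show "mat_map (Zp p) n m A (a \<odot>\<^bsub>free_module (Zp p) m\<^esub> x) i k
      = (a \<odot>\<^bsub>F\<^esub> mat_map (Zp p) n m A x) i k"
    using i x mat_map_apply[OF smult_closed[OF a x] i] mat_map_apply[OF x i]
    by (simp add: free_module_simps Zp_mult_apply mod_simps sum_distrib_left)
qed (use a x mat_map_closed smult_closed in auto)

lemma abelian_subgroup_im: "abelian_subgroup im F"
proof (rule abelian_subgroupI3)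
  have "group_hom (add_monoid (free_module (Zp p) m)) (add_monoid F) (mat_map (Zp p) n m A)"
    unfolding group_hom_def group_hom_axioms_def
    using D.a_group F.a_group mat_map_add mat_map_closed by (auto simp: hom_def)
  then have "subgroup (mat_map (Zp p) n m A ` carrier (add_monoid (free_module (Zp p) m))) (add_monoid F)"
    by (rule group_hom.img_is_subgroup)
  then show "additive_subgroup im F" by (simp add: additive_subgroup_def)
  show "abelian_group F" by (rule F.abelian_group_axioms)
qed

sublocale S: abelian_subgroup im F by (rule abelian_subgroup_im)

lemma carrier_cok: "carrier (cok (Zp p) n m A) = (\<lambda>x. im +>\<^bsub>F\<^esub> x) ` carrier F"
  by (auto simp: cok_def quotient_module_def A_RCOSETS_def')

lemma cok_add:
  assumes "x \<in> carrier F" "y \<in> carrier F"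
  shows "(im +>\<^bsub>F\<^esub> x) \<oplus>\<^bsub>cok (Zp p) n m A\<^esub> (im +>\<^bsub>F\<^esub> y) = im +>\<^bsub>F\<^esub> (x \<oplus>\<^bsub>F\<^esub> y)"
  using S.a_rcos_sum[OF assms] by (simp add: cok_def quotient_module_def)

lemma coset_eq_iff:
  assumes "x \<in> carrier F" "y \<in> carrier F"
  shows "im +>\<^bsub>F\<^esub> x = im +>\<^bsub>F\<^esub> y \<longleftrightarrow> (\<exists>h\<in>im. y = h \<oplus>\<^bsub>F\<^esub> x)"
proof
  assume "im +>\<^bsub>F\<^esub> x = im +>\<^bsub>F\<^esub> y"
  then have "y \<in> im +>\<^bsub>F\<^esub> x" using S.a_rcos_self[OF assms(2)] by simp
  then show "\<exists>h\<in>im. y = h \<oplus>\<^bsub>F\<^esub> x" by (auto simp: a_r_coset_def')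
next
  assume "\<exists>h\<in>im. y = h \<oplus>\<^bsub>F\<^esub> x"
  then have "y \<in> im +>\<^bsub>F\<^esub> x" by (auto simp: a_r_coset_def')
  then show "im +>\<^bsub>F\<^esub> x = im +>\<^bsub>F\<^esub> y"
    using F.a_repr_independence assms(1) S.a_subgroup by blast
qed

lemma smult_add:
  assumes "a \<in> carrier (Zp p)" "x \<in> carrier F" "y \<in> carrier F"
  shows "a \<odot>\<^bsub>F\<^esub> (x \<oplus>\<^bsub>F\<^esub> y) = (a \<odot>\<^bsub>F\<^esub> x) \<oplus>\<^bsub>F\<^esub> (a \<odot>\<^bsub>F\<^esub> y)"
proof -
  have "x i \<in> carrier (Zp p)" "y i \<in> carrier (Zp p)" if "i \<in> {1..n}" for i
    using that assms by (auto simp: free_module_simps)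
  then show ?thesis
    using assms(1) unfolding free_module_simps by (intro restrict_ext) (simp add: R.r_distr)
qed

lemma cok_smult:
  assumes a: "a \<in> carrier (Zp p)" and x: "x \<in> carrier F"
  shows "a \<odot>\<^bsub>cok (Zp p) n m A\<^esub> (im +>\<^bsub>F\<^esub> x) = im +>\<^bsub>F\<^esub> (a \<odot>\<^bsub>F\<^esub> x)"
proof -
  have "im +>\<^bsub>F\<^esub> (a \<odot>\<^bsub>F\<^esub> y) = im +>\<^bsub>F\<^esub> (a \<odot>\<^bsub>F\<^esub> x)" if y: "y \<in> im +>\<^bsub>F\<^esub> x" for y
  proof -
    obtain h where h: "h \<in> im" "y = h \<oplus>\<^bsub>F\<^esub> x" using y by (auto simp: a_r_coset_def')
    have hc: "h \<in> carrier F" using h(1) mat_map_closed by auto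
    have ah: "a \<odot>\<^bsub>F\<^esub> h \<in> im"
      using h(1) mat_map_smult[OF a] smult_closed[OF a] by force
    have "a \<odot>\<^bsub>F\<^esub> y = (a \<odot>\<^bsub>F\<^esub> h) \<oplus>\<^bsub>F\<^esub> (a \<odot>\<^bsub>F\<^esub> x)"
      unfolding h(2) using a hc x by (rule smult_add)
    moreover have "y \<in> carrier F" unfolding h(2) using hc x by (rule F.add.m_closed)
    ultimately show ?thesis
      using ah coset_eq_iff[of "a \<odot>\<^bsub>F\<^esub> x" "a \<odot>\<^bsub>F\<^esub> y"] smult_closed[OF a] x by auto
  qed
  moreover have "x \<in> im +>\<^bsub>F\<^esub> x" by (rule S.a_rcos_self[OF x])
  ultimately have "(\<Union>y\<in>im +>\<^bsub>F\<^esub> x. im +>\<^bsub>F\<^esub> (a \<odot>\<^bsub>F\<^esub> y)) = im +>\<^bsub>F\<^esub> (a \<odot>\<^bsub>F\<^esub> x)" by blast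
  then show ?thesis by (simp add: cok_def quotient_module_def)
qed

end

section \<open>Surjections from the cokernel as generating tuples\<close>

text \<open>
  The product of the powers \<open>g i [^] z i\<close>: the image of the integer vector \<open>z\<close> under the homomorphism
  that sends the standard basis to \<open>g\<close>.
\<close>

definition pow_prod :: "('g, 'c) monoid_scheme \<Rightarrow> nat \<Rightarrow> (nat \<Rightarrow> 'g) \<Rightarrow> (nat \<Rightarrow> int) \<Rightarrow> 'g" where
  "pow_prod G n g z = (\<Otimes>\<^bsub>G\<^esub>i\<in>{1..n}. g i [^]\<^bsub>G\<^esub> z i)"

context comm_group
begin

lemma tuple_mem: "g \<in> tuples G n \<Longrightarrow> i \<in> {1..n} \<Longrightarrow> g i \<in> carrier G"
  by (auto simp: tuples_def)

lemma pow_prod_closed: "g \<in> tuples G n \<Longrightarrow> pow_prod G n g z \<in> carrier G"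
  unfolding pow_prod_def by (intro finprod_closed) (auto dest: tuple_mem)

lemma pow_prod_cong:
  assumes "g \<in> tuples G n" and "\<And>i. i \<in> {1..n} \<Longrightarrow> g i [^] z i = g i [^] z' i"
  shows "pow_prod G n g z = pow_prod G n g z'"
  unfolding pow_prod_def using assms by (intro finprod_cong') (auto dest: tuple_mem)

lemma pow_prod_add:
  assumes g: "g \<in> tuples G n"
  shows "pow_prod G n g (\<lambda>i. z i + z' i) = pow_prod G n g z \<otimes> pow_prod G n g z'"
proof -
  have "pow_prod G n g (\<lambda>i. z i + z' i) = (\<Otimes>i\<in>{1..n}. g i [^] z i \<otimes> g i [^] z' i)"
    unfolding pow_prod_def using g by (intro finprod_cong') (auto dest: tuple_mem simp: int_pow_mult)
  also have "\<dots> = pow_prod G n g z \<otimes> pow_prod G n g z'"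
    unfolding pow_prod_def using g by (intro finprod_multf) (auto dest: tuple_mem)
  finally show ?thesis .
qed

lemma pow_prod_zero: "pow_prod G n g (\<lambda>i. 0) = \<one>"
  unfolding pow_prod_def by (simp add: int_pow_0 finprod_one_eqI)

lemma finprod_int_pow:
  assumes "finite I" and "\<And>i. i \<in> I \<Longrightarrow> f i \<in> carrier G"
  shows "(\<Otimes>i\<in>I. f i [^] (c :: int)) = (\<Otimes>i\<in>I. f i) [^] c"
  using assms
proof (induction I rule: finite_induct)
  case (insert i I)
  have "(\<Otimes>i\<in>insert i I. f i [^] c) = f i [^] c \<otimes> (\<Otimes>i\<in>I. f i [^] c)"
    using insert by (intro finprod_insert) auto
  also have "\<dots> = (f i \<otimes> (\<Otimes>i\<in>I. f i)) [^] c"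
    using insert by (simp add: int_pow_distrib finprod_closed Pi_def)
  also have "f i \<otimes> (\<Otimes>i\<in>I. f i) = (\<Otimes>i\<in>insert i I. f i)"
    using insert by (intro finprod_insert[symmetric]) auto
  finally show ?case .
qed simp

lemma pow_prod_scale:
  assumes g: "g \<in> tuples G n"
  shows "pow_prod G n g (\<lambda>i. c * z i) = pow_prod G n g z [^] c"
proof -
  have "pow_prod G n g (\<lambda>i. c * z i) = (\<Otimes>i\<in>{1..n}. (g i [^] z i) [^] c)"
    unfolding pow_prod_def using g
    by (intro finprod_cong') (auto dest: tuple_mem simp: int_pow_pow mult.commute)
  also have "\<dots> = pow_prod G n g z [^] c"
    unfolding pow_prod_def using g by (intro finprod_int_pow) (auto dest: tuple_mem)
  finally show ?thesis .
qed

lemma pow_prod_unit: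
  assumes g: "g \<in> tuples G n" and i: "i \<in> {1..n}"
  shows "pow_prod G n g (\<lambda>j. if j = i then 1 else 0) = g i"
proof -
  have "pow_prod G n g (\<lambda>j. if j = i then 1 else 0) = (\<Otimes>j\<in>{1..n}. if i = j then g j else \<one>)"
    unfolding pow_prod_def using g by (intro finprod_cong') (auto dest: tuple_mem simp: int_pow_0 int_pow_1)
  also have "\<dots> = g i" using g i by (intro finprod_singleton) (auto dest: tuple_mem)
  finally show ?thesis .
qed

lemma int_pow_mod:
  assumes "x \<in> carrier G" and "x [^] (q :: int) = \<one>"
  shows "x [^] (z mod q) = x [^] z"
proof -
  have "x [^] z = x [^] (q * (z div q) + z mod q)" by simp
  also have "\<dots> = (x [^] q) [^] (z div q) \<otimes> x [^] (z mod q)"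
    using assms(1) by (simp only: int_pow_mult int_pow_pow)
  finally show ?thesis using assms by simp
qed

text \<open>
  If \<open>g\<close> kills all columns of a matrix, it kills their integer combinations.
\<close>

lemma pow_prod_sum_trivial:
  assumes g: "g \<in> tuples G n" and "finite J" and "\<And>j. j \<in> J \<Longrightarrow> pow_prod G n g (\<lambda>i. a i j) = \<one>"
  shows "pow_prod G n g (\<lambda>i. \<Sum>j\<in>J. a i j * c j) = \<one>"
  using assms(2,3)
proof (induction J rule: finite_induct)
  case empty
  then show ?case by (simp add: pow_prod_zero)
next
  case (insert j J)
  have "pow_prod G n g (\<lambda>i. \<Sum>j\<in>insert j J. a i j * c j)
      = pow_prod G n g (\<lambda>i. c j * a i j + (\<Sum>j\<in>J. a i j * c j))"
    using insert.hyps by (simp add: mult.commute)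
  also have "\<dots> = pow_prod G n g (\<lambda>i. a i j) [^] c j \<otimes> pow_prod G n g (\<lambda>i. \<Sum>j\<in>J. a i j * c j)"
    using g by (simp only: pow_prod_add pow_prod_scale)
  finally show ?case using insert by simp
qed

lemma pow_prod_in_generate:
  assumes g: "g \<in> tuples G n"
  shows "pow_prod G n g z \<in> generate G (g ` {1..n})"
proof -
  have sub: "subgroup (generate G (g ` {1..n})) G"
    using g by (intro generate_is_subgroup) (auto dest: tuple_mem)
  have "(\<Otimes>i\<in>I. g i [^] z i) \<in> generate G (g ` {1..n})" if "finite I" "I \<subseteq> {1..n}" for I
    using that
  proof (induction I rule: finite_induct)
    case empty
    then show ?case using sub by (simp add: subgroup.one_closed)
  next
    case (insert i I)
    have "g i \<in> generate G (g ` {1..n})" using insert by (auto intro: generate.incl)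
    then have "g i [^] z i \<in> generate G (g ` {1..n})" using sub by (simp add: subgroup_int_pow_closed)
    moreover have "(\<Otimes>i\<in>insert i I. g i [^] z i) = g i [^] z i \<otimes> (\<Otimes>i\<in>I. g i [^] z i)"
    proof (rule finprod_insert[OF insert.hyps])
      show "(\<lambda>i. g i [^] z i) \<in> I \<rightarrow> carrier G" "g i [^] z i \<in> carrier G"
        using insert.prems tuple_mem[OF g] by (auto intro!: int_pow_closed)
    qed
    ultimately show ?case using insert sub by (simp add: subgroup.m_closed)
  qed
  then show ?thesis by (simp add: pow_prod_def)
qed

lemma generate_imp_pow_prod:
  assumes g: "g \<in> tuples G n" and y: "y \<in> generate G (g ` {1..n})"
  shows "\<exists>z. y = pow_prod G n g z"
  using y
proof (induction rule: generate.induct)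
  case one
  then show ?case using pow_prod_zero by metis
next
  case (incl h)
  then show ?case using pow_prod_unit[OF g] by (metis imageE)
next
  case (inv h)
  then obtain i where i: "i \<in> {1..n}" "h = g i" by auto
  have "pow_prod G n g (\<lambda>j. (-1) * (if j = i then 1 else 0)) = g i [^] (-1 :: int)"
    unfolding pow_prod_scale[OF g] pow_prod_unit[OF g i(1)] ..
  also have "\<dots> = inv h" using i tuple_mem[OF g i(1)] by (simp add: int_pow_neg)
  finally show ?case by metis
next
  case (eng h1 h2)
  then obtain z1 z2 where "h1 = pow_prod G n g z1" "h2 = pow_prod G n g z2" by blast
  then show ?case using pow_prod_add[OF g, of z1 z2] by metis
qed

end

locale zp_cokernel = zp_matrix p n m A + G: comm_group G
  for p n m :: nat and A :: "nat \<Rightarrow> nat \<Rightarrow> padic" and G :: "('g, 'c) monoid_scheme" (structure) +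
  fixes K :: nat
  assumes K: "K = multiplicity p (order G)"
    and ord: "\<And>x. x \<in> carrier G \<Longrightarrow> x [^] int p ^ K = \<one>"
begin

abbreviation "Cok \<equiv> cok (Zp p) n m A"
abbreviation "Gm \<equiv> pgroup_module p G"

text \<open>
  The homomorphism to \<open>G\<close> that \<open>g\<close> defines on the free module. A \<open>p\<close>-adic coordinate acts on \<open>G\<close> through its
  residue modulo \<open>p ^ K\<close>.
\<close>

definition ev :: "(nat \<Rightarrow> 'g) \<Rightarrow> (nat \<Rightarrow> padic) \<Rightarrow> 'g" where
  "ev g x = pow_prod G n g (\<lambda>i. x i K)"

definition unit_vec :: "nat \<Rightarrow> nat \<Rightarrow> padic" where
  "unit_vec i = (\<lambda>j\<in>{1..n}. if j = i then \<one>\<^bsub>Zp p\<^esub> else \<zero>\<^bsub>Zp p\<^esub>)"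

definition basis_images :: "((nat \<Rightarrow> padic) set \<Rightarrow> 'g) \<Rightarrow> nat \<Rightarrow> 'g" where
  "basis_images f = (\<lambda>i\<in>{1..n}. f (im +>\<^bsub>F\<^esub> unit_vec i))"

definition killing_tuples :: "(nat \<Rightarrow> 'g) set" where
  "killing_tuples = {g \<in> generating_tuples G n. \<forall>j\<in>{1..m}. pow_prod G n g (\<lambda>i. A i j K) = \<one>}"

lemma Gm_simps: "carrier Gm = carrier G" "x \<oplus>\<^bsub>Gm\<^esub> y = x \<otimes> y" "a \<odot>\<^bsub>Gm\<^esub> x = x [^] a K"
  by (simp_all add: pgroup_module_def K)

lemma F_mem: "x \<in> carrier F \<Longrightarrow> i \<in> {1..n} \<Longrightarrow> x i \<in> carrier (Zp p)"
  by (auto simp: free_module_simps)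

lemma unit_vec_mem: "unit_vec i \<in> carrier F"
  by (auto simp: unit_vec_def free_module_simps)

lemma ev_add:
  assumes g: "g \<in> tuples G n" and "x \<in> carrier F" "y \<in> carrier F"
  shows "ev g (x \<oplus>\<^bsub>F\<^esub> y) = ev g x \<otimes> ev g y"
proof -
  have "ev g (x \<oplus>\<^bsub>F\<^esub> y) = pow_prod G n g (\<lambda>i. x i K + y i K)"
    unfolding ev_def using g
    by (rule G.pow_prod_cong) (use ord g in \<open>simp add: free_module_simps Zp_add_apply G.int_pow_mod G.tuple_mem\<close>)
  then show ?thesis unfolding ev_def using G.pow_prod_add[OF g] by simp
qed

lemma ev_smult:
  assumes g: "g \<in> tuples G n"
  shows "ev g (a \<odot>\<^bsub>F\<^esub> x) = ev g x [^] a K"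
proof -
  have "ev g (a \<odot>\<^bsub>F\<^esub> x) = pow_prod G n g (\<lambda>i. a K * x i K)"
    unfolding ev_def using g
    by (rule G.pow_prod_cong) (use ord g in \<open>simp add: free_module_simps Zp_mult_apply G.int_pow_mod G.tuple_mem\<close>)
  then show ?thesis unfolding ev_def using G.pow_prod_scale[OF g] by simp
qed

lemma ev_unit_vec:
  assumes g: "g \<in> tuples G n" and i: "i \<in> {1..n}"
  shows "ev g (unit_vec i) = g i"
proof -
  have "ev g (unit_vec i) = pow_prod G n g (\<lambda>j. if j = i then 1 else 0)"
    unfolding ev_def using g
    by (rule G.pow_prod_cong)
       (use ord g in \<open>auto simp: unit_vec_def Zp_one_apply Zp_zero_apply G.int_pow_mod G.tuple_mem G.int_pow_1\<close>)
  then show ?thesis using G.pow_prod_unit[OF g i] by simp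
qed

lemma ev_im:
  assumes g: "g \<in> tuples G n" and kill: "\<And>j. j \<in> {1..m} \<Longrightarrow> pow_prod G n g (\<lambda>i. A i j K) = \<one>" and h: "h \<in> im"
  shows "ev g h = \<one>"
proof -
  obtain x where x: "x \<in> carrier (free_module (Zp p) m)" "h = mat_map (Zp p) n m A x" using h by auto
  have "ev g h = pow_prod G n g (\<lambda>i. \<Sum>j\<in>{1..m}. A i j K * x j K)"
    unfolding ev_def x(2) using g
    by (rule G.pow_prod_cong) (use ord g x in \<open>simp add: mat_map_apply G.int_pow_mod G.tuple_mem\<close>)
  also have "\<dots> = \<one>" using g kill by (intro G.pow_prod_sum_trivial) auto
  finally show ?thesis .
qed

lemma Hom_on_cosets:
  assumes f: "f \<in> module_Hom (Zp p) Cok Gm"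
  shows "x \<in> carrier F \<Longrightarrow> f (im +>\<^bsub>F\<^esub> x) \<in> carrier G"
    and "x \<in> carrier F \<Longrightarrow> y \<in> carrier F \<Longrightarrow>
      f (im +>\<^bsub>F\<^esub> (x \<oplus>\<^bsub>F\<^esub> y)) = f (im +>\<^bsub>F\<^esub> x) \<otimes> f (im +>\<^bsub>F\<^esub> y)"
    and "a \<in> carrier (Zp p) \<Longrightarrow> x \<in> carrier F \<Longrightarrow> f (im +>\<^bsub>F\<^esub> (a \<odot>\<^bsub>F\<^esub> x)) = f (im +>\<^bsub>F\<^esub> x) [^] a K"
    and "f (im +>\<^bsub>F\<^esub> \<zero>\<^bsub>F\<^esub>) = \<one>"
proof -
  have f: "f \<in> carrier Cok \<rightarrow>\<^sub>E carrier G"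
    "\<And>X Y. X \<in> carrier Cok \<Longrightarrow> Y \<in> carrier Cok \<Longrightarrow> f (X \<oplus>\<^bsub>Cok\<^esub> Y) = f X \<otimes> f Y"
    "\<And>a X. a \<in> carrier (Zp p) \<Longrightarrow> X \<in> carrier Cok \<Longrightarrow> f (a \<odot>\<^bsub>Cok\<^esub> X) = f X [^] a K"
    using f by (auto simp: module_Hom_def Gm_simps)
  have mem: "im +>\<^bsub>F\<^esub> x \<in> carrier Cok" if "x \<in> carrier F" for x using that by (simp add: carrier_cok)
  show closed: "f (im +>\<^bsub>F\<^esub> x) \<in> carrier G" if "x \<in> carrier F" for x
    using f(1) mem[OF that] by (rule PiE_mem)
  show add: "f (im +>\<^bsub>F\<^esub> (x \<oplus>\<^bsub>F\<^esub> y)) = f (im +>\<^bsub>F\<^esub> x) \<otimes> f (im +>\<^bsub>F\<^esub> y)"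
    if "x \<in> carrier F" "y \<in> carrier F" for x y
    using f(2)[OF mem mem] that by (simp add: cok_add)
  show "f (im +>\<^bsub>F\<^esub> (a \<odot>\<^bsub>F\<^esub> x)) = f (im +>\<^bsub>F\<^esub> x) [^] a K"
    if "a \<in> carrier (Zp p)" "x \<in> carrier F" for a x
    using f(3)[OF that(1) mem[OF that(2)]] that by (simp add: cok_smult)
  have "f (im +>\<^bsub>F\<^esub> \<zero>\<^bsub>F\<^esub>) \<otimes> f (im +>\<^bsub>F\<^esub> \<zero>\<^bsub>F\<^esub>) = f (im +>\<^bsub>F\<^esub> \<zero>\<^bsub>F\<^esub>)"
    using add[OF F.zero_closed F.zero_closed] by simp
  then show "f (im +>\<^bsub>F\<^esub> \<zero>\<^bsub>F\<^esub>) = \<one>"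
    using closed[OF F.zero_closed] G.l_cancel_one by blast
qed

lemma basis_images_tuple:
  assumes f: "f \<in> module_Hom (Zp p) Cok Gm"
  shows "basis_images f \<in> tuples G n"
  using Hom_on_cosets(1)[OF f unit_vec_mem] by (auto simp: basis_images_def tuples_def)

text \<open>
  A vector is the sum of its coordinates times the basis vectors, and \<open>f\<close> respects sums and scalars. The
  induction adds one coordinate at a time.
\<close>

lemma Hom_eq_ev:
  assumes f: "f \<in> module_Hom (Zp p) Cok Gm" and x: "x \<in> carrier F"
  shows "f (im +>\<^bsub>F\<^esub> x) = ev (basis_images f) x"
proof -
  let ?t = "\<lambda>r. \<lambda>i\<in>{1..n}. if i \<le> r then x i else \<zero>\<^bsub>Zp p\<^esub>"
  let ?g = "basis_images f"
  have t: "?t r \<in> carrier F" for r using F_mem[OF x] unfolding free_module_simps by auto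
  have "f (im +>\<^bsub>F\<^esub> ?t r) = (\<Otimes>i\<in>{1..r}. ?g i [^] x i K)" if "r \<le> n" for r
    using that
  proof (induction r)
    case 0
    have "?t 0 = \<zero>\<^bsub>F\<^esub>" unfolding free_module_simps by (rule restrict_ext) auto
    then show ?case using Hom_on_cosets(4)[OF f] by simp
  next
    case (Suc r)
    have mem: "Suc r \<in> {1..n}" using Suc by simp
    have "?t (Suc r) = (x (Suc r) \<odot>\<^bsub>F\<^esub> unit_vec (Suc r)) \<oplus>\<^bsub>F\<^esub> ?t r"
      unfolding free_module_simps
    proof (rule restrict_ext)
      fix i assume i: "i \<in> {1..n}"
      then show "(if i \<le> Suc r then x i else \<zero>\<^bsub>Zp p\<^esub>)
          = (\<lambda>i\<in>{1..n}. x (Suc r) \<otimes>\<^bsub>Zp p\<^esub> unit_vec (Suc r) i) i \<oplus>\<^bsub>Zp p\<^esub> (\<lambda>i\<in>{1..n}. if i \<le> r then x i else \<zero>\<^bsub>Zp p\<^esub>) i"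
        using F_mem[OF x i] F_mem[OF x mem] by (auto simp: unit_vec_def le_Suc_eq)
    qed
    then have "f (im +>\<^bsub>F\<^esub> ?t (Suc r)) = ?g (Suc r) [^] x (Suc r) K \<otimes> f (im +>\<^bsub>F\<^esub> ?t r)"
      using Hom_on_cosets(2)[OF f smult_closed[OF F_mem[OF x mem] unit_vec_mem] t]
        Hom_on_cosets(3)[OF f F_mem[OF x mem] unit_vec_mem] mem
      by (simp add: basis_images_def)
    also have "\<dots> = (\<Otimes>i\<in>{1..Suc r}. ?g i [^] x i K)"
    proof -
      have IH: "f (im +>\<^bsub>F\<^esub> ?t r) = (\<Otimes>i\<in>{1..r}. ?g i [^] x i K)"
        by (rule Suc.IH) (use Suc.prems in simp)
      have ins: "{1..Suc r} = insert (Suc r) {1..r}" by auto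
      have mem_g: "?g i \<in> carrier G" if "i \<in> {1..Suc r}" for i
        using G.tuple_mem[OF basis_images_tuple[OF f]] that Suc.prems by auto
      have "(\<Otimes>i\<in>{1..Suc r}. ?g i [^] x i K)
          = ?g (Suc r) [^] x (Suc r) K \<otimes> (\<Otimes>i\<in>{1..r}. ?g i [^] x i K)"
        unfolding ins by (rule G.finprod_insert) (use mem_g in auto)
      then show ?thesis unfolding IH by (rule sym)
    qed
    finally show ?case .
  qed
  from this[of n] have "f (im +>\<^bsub>F\<^esub> ?t n) = ev ?g x" by (simp add: ev_def pow_prod_def)
  moreover have "?t n = x"
    using x by (intro free_module_eqI[OF t]) auto
  ultimately show ?thesis by simp
qed

lemma inj_basis_images: "inj_on basis_images (module_Hom (Zp p) Cok Gm)"
proof (rule inj_onI)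
  fix f f' assume f: "f \<in> module_Hom (Zp p) Cok Gm" "f' \<in> module_Hom (Zp p) Cok Gm"
    and eq: "basis_images f = basis_images f'"
  show "f = f'"
  proof (rule PiE_ext)
    show "f \<in> carrier Cok \<rightarrow>\<^sub>E carrier Gm" "f' \<in> carrier Cok \<rightarrow>\<^sub>E carrier Gm"
      using f by (auto simp: module_Hom_def)
    show "f X = f' X" if "X \<in> carrier Cok" for X
      using that Hom_eq_ev[OF f(1)] Hom_eq_ev[OF f(2)] eq by (auto simp: carrier_cok)
  qed
qed

lemma basis_images_Sur:
  assumes f: "f \<in> Sur (Zp p) Cok Gm"
  shows "basis_images f \<in> killing_tuples"
proof -
  have hom: "f \<in> module_Hom (Zp p) Cok Gm" and onto: "f ` carrier Cok = carrier G"
    using f by (auto simp: Sur_def Gm_simps)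
  let ?g = "basis_images f"
  note g = basis_images_tuple[OF hom]
  have "carrier G \<subseteq> generate G (?g ` {1..n})"
  proof
    fix y assume "y \<in> carrier G"
    then obtain x where "x \<in> carrier F" "y = f (im +>\<^bsub>F\<^esub> x)"
      using onto unfolding carrier_cok by blast
    then show "y \<in> generate G (?g ` {1..n})"
      using Hom_eq_ev[OF hom] G.pow_prod_in_generate[OF g] by (simp add: ev_def)
  qed
  moreover have "generate G (?g ` {1..n}) \<subseteq> carrier G"
    using g by (intro G.generate_incl) (auto dest: G.tuple_mem)
  ultimately have "?g \<in> generating_tuples G n" using g by (auto simp: generating_tuples_def)
  moreover have "pow_prod G n ?g (\<lambda>i. A i j K) = \<one>" if j: "j \<in> {1..m}" for j
  proof -
    define u where "u = (\<lambda>l\<in>{1..m}. if l = j then \<one>\<^bsub>Zp p\<^esub> else \<zero>\<^bsub>Zp p\<^esub>)"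
    have u: "u \<in> carrier (free_module (Zp p) m)" by (auto simp: u_def free_module_simps)
    define c where "c = mat_map (Zp p) n m A u"
    have c: "c \<in> im" "c \<in> carrier F" using u mat_map_closed by (auto simp: c_def)
    have "f (im +>\<^bsub>F\<^esub> c) = \<one>"
    proof -
      have "im +>\<^bsub>F\<^esub> \<zero>\<^bsub>F\<^esub> = im +>\<^bsub>F\<^esub> c"
        using coset_eq_iff[OF F.zero_closed c(2)] c by force
      then show ?thesis using Hom_on_cosets(4)[OF hom] by simp
    qed
    then have "ev ?g c = \<one>" using Hom_eq_ev[OF hom c(2)] by simp
    moreover have "ev ?g c = pow_prod G n ?g (\<lambda>i. A i j K)"
      unfolding ev_def using g
    proof (rule G.pow_prod_cong)
      fix i assume i: "i \<in> {1..n}"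
      have "(\<Sum>l\<in>{1..m}. A i l K * u l K) = (\<Sum>l\<in>{1..m}. if l = j then A i j K * (1 mod int p ^ K) else 0)"
        by (intro sum.cong) (auto simp: u_def Zp_one_apply Zp_zero_apply)
      then have "c i K = (A i j K * (1 mod int p ^ K)) mod int p ^ K"
        using j mat_map_apply[OF u i] by (simp add: c_def)
      then have "c i K = A i j K mod int p ^ K" by (simp add: mod_simps)
      then show "?g i [^] c i K = ?g i [^] A i j K"
        using ord G.int_pow_mod[of "?g i" "int p ^ K"] G.tuple_mem[OF g i] by simp
    qed
    ultimately show ?thesis by simp
  qed
  ultimately show ?thesis by (simp add: killing_tuples_def)
qed

text \<open>
  Since \<open>g\<close> kills the columns, \<open>ev g\<close> is trivial on the image of the matrix, so its value at any
  representative defines a function on cosets.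
\<close>

lemma killing_tuple_from_Sur:
  assumes g: "g \<in> killing_tuples"
  obtains f where "f \<in> Sur (Zp p) Cok Gm" "basis_images f = g"
proof -
  have gt: "g \<in> tuples G n" and gen: "generate G (g ` {1..n}) = carrier G"
    and kill: "\<And>j. j \<in> {1..m} \<Longrightarrow> pow_prod G n g (\<lambda>i. A i j K) = \<one>"
    using g by (auto simp: killing_tuples_def generating_tuples_def)
  define f where "f = (\<lambda>X\<in>carrier Cok. ev g (SOME x. x \<in> X))"
  have ev_c: "ev g x \<in> carrier G" for x unfolding ev_def by (rule G.pow_prod_closed[OF gt])
  have f: "f (im +>\<^bsub>F\<^esub> x) = ev g x" if x: "x \<in> carrier F" for x
  proof -
    have rep: "\<exists>h\<in>im. y = h \<oplus>\<^bsub>F\<^esub> x" if "y \<in> im +>\<^bsub>F\<^esub> x" for y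
      using that by (auto simp: a_r_coset_def')
    have "(SOME y. y \<in> im +>\<^bsub>F\<^esub> x) \<in> im +>\<^bsub>F\<^esub> x"
      using S.a_rcos_self[OF x] by (rule someI[where P = "\<lambda>y. y \<in> im +>\<^bsub>F\<^esub> x"])
    from rep[OF this]
    obtain h where h: "h \<in> im" "(SOME y. y \<in> im +>\<^bsub>F\<^esub> x) = h \<oplus>\<^bsub>F\<^esub> x" ..
    have hc: "h \<in> carrier F" using h(1) mat_map_closed by auto
    have "ev g (h \<oplus>\<^bsub>F\<^esub> x) = ev g x"
      using ev_add[OF gt hc x] ev_im[OF gt kill h(1)] ev_c by simp
    then show ?thesis using x h(2) by (simp add: f_def carrier_cok)
  qed
  have hom: "f \<in> module_Hom (Zp p) Cok Gm"
    unfolding module_Hom_def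
  proof (intro CollectI conjI ballI)
    show "f \<in> carrier Cok \<rightarrow>\<^sub>E carrier Gm" using ev_c by (auto simp: f_def Gm_simps)
    show "f (X \<oplus>\<^bsub>Cok\<^esub> Y) = f X \<oplus>\<^bsub>Gm\<^esub> f Y" if XY: "X \<in> carrier Cok" "Y \<in> carrier Cok" for X Y
    proof -
      obtain x y where xy: "x \<in> carrier F" "y \<in> carrier F" "X = im +>\<^bsub>F\<^esub> x" "Y = im +>\<^bsub>F\<^esub> y"
        using XY unfolding carrier_cok by auto
      show ?thesis
        using xy F.add.m_closed[OF xy(1,2)] f ev_add[OF gt] by (simp add: cok_add Gm_simps)
    qed
    show "f (a \<odot>\<^bsub>Cok\<^esub> X) = a \<odot>\<^bsub>Gm\<^esub> f X" if aX: "a \<in> carrier (Zp p)" "X \<in> carrier Cok" for a X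
    proof -
      obtain x where x: "x \<in> carrier F" "X = im +>\<^bsub>F\<^esub> x" using aX unfolding carrier_cok by auto
      show ?thesis
        using x aX smult_closed[OF aX(1) x(1)] f ev_smult[OF gt] by (simp add: cok_smult Gm_simps)
    qed
  qed
  have "carrier G \<subseteq> f ` carrier Cok"
  proof
    fix y assume "y \<in> carrier G"
    then obtain z where z: "y = pow_prod G n g z" using G.generate_imp_pow_prod[OF gt] gen by auto
    define x where "x = (\<lambda>i\<in>{1..n}. (\<lambda>k. z i mod int p ^ k))"
    have x: "x \<in> carrier F"
      using Zp_memI[OF p, of "\<lambda>_. z _"] by (auto simp: x_def free_module_simps)
    have "ev g x = pow_prod G n g z"
      unfolding ev_def using gt
      by (rule G.pow_prod_cong) (use ord gt in \<open>simp add: x_def G.int_pow_mod G.tuple_mem\<close>)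
    then show "y \<in> f ` carrier Cok" using f[OF x] x z by (auto simp: carrier_cok intro!: image_eqI)
  qed
  moreover have "f ` carrier Cok \<subseteq> carrier G" using ev_c by (auto simp: f_def)
  ultimately have "f \<in> Sur (Zp p) Cok Gm" using hom by (auto simp: Sur_def Gm_simps)
  moreover have "basis_images f = g"
  proof (rule PiE_ext)
    show "basis_images f \<in> {1..n} \<rightarrow>\<^sub>E carrier G" "g \<in> {1..n} \<rightarrow>\<^sub>E carrier G"
      using basis_images_tuple[OF hom] gt by (simp_all add: tuples_def)
    show "basis_images f i = g i" if "i \<in> {1..n}" for i
      using that f[OF unit_vec_mem] ev_unit_vec[OF gt that] by (simp add: basis_images_def)
  qed
  ultimately show thesis by (rule that)
qed

lemma card_Sur_cok: "card (Sur (Zp p) Cok Gm) = card killing_tuples"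
proof (rule bij_betw_same_card)
  have "Sur (Zp p) Cok Gm \<subseteq> module_Hom (Zp p) Cok Gm" by (auto simp: Sur_def)
  then have "inj_on basis_images (Sur (Zp p) Cok Gm)" using inj_basis_images by (rule inj_on_subset[rotated])
  moreover have "basis_images ` Sur (Zp p) Cok Gm = killing_tuples"
  proof
    show "basis_images ` Sur (Zp p) Cok Gm \<subseteq> killing_tuples"
      using basis_images_Sur by (rule image_subsetI)
    show "killing_tuples \<subseteq> basis_images ` Sur (Zp p) Cok Gm"
    proof
      fix g assume "g \<in> killing_tuples"
      then obtain f where "f \<in> Sur (Zp p) Cok Gm" "basis_images f = g"
        by (rule killing_tuple_from_Sur)
      then show "g \<in> basis_images ` Sur (Zp p) Cok Gm" by (intro image_eqI) auto
    qed
  qed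
  ultimately show "bij_betw basis_images (Sur (Zp p) Cok Gm) killing_tuples"
    by (simp add: bij_betw_def)
qed

end

section \<open>Random matrices over the p-adic integers\<close>

lemma Zp_of_nat_apply: "([q] \<cdot>\<^bsub>Zp p\<^esub> \<one>\<^bsub>Zp p\<^esub>) k = int q mod int p ^ k" for q :: nat
proof (induction q)
  case 0
  then show ?case by (simp add: add_pow_def Zp_def)
next
  case (Suc q)
  have "([Suc q] \<cdot>\<^bsub>Zp p\<^esub> \<one>\<^bsub>Zp p\<^esub>) k = (([q] \<cdot>\<^bsub>Zp p\<^esub> \<one>\<^bsub>Zp p\<^esub>) k + 1 mod int p ^ k) mod int p ^ k"
    by (simp add: add_pow_def Zp_def)
  then show ?case using Suc by (simp add: mod_simps ac_simps)
qed

text \<open>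
  A \<open>p\<close>-adic integer with first residue \<open>r\<close> differs from the constant \<open>r\<close> by a multiple of \<open>p\<close>: the quotient
  has residue \<open>(y (k + 1) - r) div p\<close> modulo \<open>p ^ k\<close>.
\<close>

lemma residue_class_is_coset:
  assumes p: "p > 0" and r: "0 \<le> r" "r < int p"
  shows "{y \<in> carrier (Zp p). y 1 = r} \<in> carrier (Zp p Quot (PIdl\<^bsub>Zp p\<^esub> ([p] \<cdot>\<^bsub>Zp p\<^esub> \<one>\<^bsub>Zp p\<^esub>)))"
proof -
  interpret R: cring "Zp p" by (rule cring_Zp[OF p])
  define a where "a = [p] \<cdot>\<^bsub>Zp p\<^esub> \<one>\<^bsub>Zp p\<^esub>"
  define x where "x = (\<lambda>k. r mod int p ^ k)"
  have a: "a \<in> carrier (Zp p)" by (simp add: a_def)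
  have ak: "a k = int p mod int p ^ k" for k by (simp add: a_def Zp_of_nat_apply)
  have x: "x \<in> carrier (Zp p)" using Zp_memI[OF p, of "\<lambda>_. r"] by (simp add: x_def)
  have "{y \<in> carrier (Zp p). y 1 = r} = (PIdl\<^bsub>Zp p\<^esub> a) +>\<^bsub>Zp p\<^esub> x"
  proof (rule subset_antisym; rule subsetI)
    fix y assume "y \<in> (PIdl\<^bsub>Zp p\<^esub> a) +>\<^bsub>Zp p\<^esub> x"
    then obtain z where z: "z \<in> carrier (Zp p)" "y = z \<otimes>\<^bsub>Zp p\<^esub> a \<oplus>\<^bsub>Zp p\<^esub> x"
      by (auto simp: a_r_coset_def' cgenideal_def)
    have "y 1 = r" using r by (simp add: z(2) Zp_add_apply Zp_mult_apply ak x_def)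
    then show "y \<in> {y \<in> carrier (Zp p). y 1 = r}" using z a x by simp
  next
    fix y assume "y \<in> {y \<in> carrier (Zp p). y 1 = r}"
    then have y: "y \<in> carrier (Zp p)" "y 1 = r" by auto
    \<comment> \<open>Division by \<open>p\<close> costs one residue, hence the shift of the index.\<close>
    define w where "w = (\<lambda>k. (y (Suc k) - r) div int p)"
    have w: "y (Suc k) = int p * w k + r" for k
    proof -
      have "y (Suc k) mod int p = r" using Zp_carrier_mod[OF y(1), of 1 "Suc k"] y(2) by simp
      then have "int p dvd y (Suc k) - r" using r by (simp add: mod_eq_dvd_iff[symmetric])
      then show ?thesis by (simp add: w_def)
    qed
    have z: "(\<lambda>k. w k mod int p ^ k) \<in> carrier (Zp p)"
    proof (rule Zp_memI[OF p])
      fix k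
      have "(int p * w (Suc k) + r) mod (int p * int p ^ k) = (int p * w k + r) mod (int p * int p ^ k)"
        using Zp_carrier_mod[OF y(1), of "Suc k" "Suc (Suc k)"] Zp_carrier_mod[OF y(1), of "Suc k" "Suc k"]
        unfolding w[symmetric] by simp
      then have "(int p * int p ^ k) dvd (int p * w (Suc k) + r) - (int p * w k + r)"
        by (simp only: mod_eq_dvd_iff)
      also have "(int p * w (Suc k) + r) - (int p * w k + r) = int p * (w (Suc k) - w k)"
        by (simp add: algebra_simps)
      finally have "int p ^ k dvd w (Suc k) - w k" using p by simp
      then show "w (Suc k) mod int p ^ k = w k mod int p ^ k" by (simp only: mod_eq_dvd_iff)
    qed
    have "y = (\<lambda>k. w k mod int p ^ k) \<otimes>\<^bsub>Zp p\<^esub> a \<oplus>\<^bsub>Zp p\<^esub> x"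
    proof
      fix k
      have "y k = (int p * w k + r) mod int p ^ k"
        using Zp_carrier_mod[OF y(1), of k "Suc k"] by (simp add: w)
      then show "y k = ((\<lambda>k. w k mod int p ^ k) \<otimes>\<^bsub>Zp p\<^esub> a \<oplus>\<^bsub>Zp p\<^esub> x) k"
        by (simp add: Zp_add_apply Zp_mult_apply ak x_def mod_simps mult.commute)
    qed
    then show "y \<in> (PIdl\<^bsub>Zp p\<^esub> a) +>\<^bsub>Zp p\<^esub> x"
      using z by (auto simp: a_r_coset_def' cgenideal_def)
  qed
  then show ?thesis using x by (auto simp: FactRing_def A_RCOSETS_def' a_def)
qed

lemma Zp_borel_cylinder: "{x \<in> carrier (Zp p). x k = c} \<in> sets (Zp_borel p)"
proof -
  have "continuous_on UNIV (\<lambda>x :: padic. x k)" by (rule continuous_on_product_coordinates)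
  then have "closed ((\<lambda>x :: padic. x k) -` {c})" by (intro closed_vimage) auto
  then have "carrier (Zp p) \<inter> (\<lambda>x :: padic. x k) -` {c} \<in> sets (Zp_borel p)"
    unfolding Zp_borel_def sets_restrict_space by (intro imageI borel_closed)
  moreover have "carrier (Zp p) \<inter> (\<lambda>x :: padic. x k) -` {c} = {x \<in> carrier (Zp p). x k = c}"
    by auto
  ultimately show ?thesis by simp
qed

definition residue_law :: "'w measure \<Rightarrow> ('w \<Rightarrow> padic) \<Rightarrow> nat \<Rightarrow> int \<Rightarrow> real" where
  "residue_law M y k c = measure M {\<omega> \<in> space M. y \<omega> k = c}"

context prob_space
begin

lemma Zp_valued:
  assumes "y \<in> measurable M (Zp_borel p)" "\<omega> \<in> space M"
  shows "y \<omega> \<in> carrier (Zp p)"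
  using measurable_space[OF assms] by (simp add: Zp_borel_def space_restrict_space)

lemma residue_event:
  assumes y: "y \<in> measurable M (Zp_borel p)"
  shows "{\<omega> \<in> space M. y \<omega> k = c} = y -` {x \<in> carrier (Zp p). x k = c} \<inter> space M"
    and "{\<omega> \<in> space M. y \<omega> k = c} \<in> events"
proof -
  show eq: "{\<omega> \<in> space M. y \<omega> k = c} = y -` {x \<in> carrier (Zp p). x k = c} \<inter> space M"
    using Zp_valued[OF y] by auto
  show "{\<omega> \<in> space M. y \<omega> k = c} \<in> events"
    unfolding eq using y Zp_borel_cylinder by (rule measurable_sets)
qed

lemma sum_residue_law:
  assumes y: "y \<in> measurable M (Zp_borel p)" and C: "finite C"
  shows "(\<Sum>c\<in>C. residue_law M y k c) = prob {\<omega> \<in> space M. y \<omega> k \<in> C}"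
proof -
  have "prob (\<Union>c\<in>C. {\<omega> \<in> space M. y \<omega> k = c}) = (\<Sum>c\<in>C. prob {\<omega> \<in> space M. y \<omega> k = c})"
    using C residue_event(2)[OF y]
    by (intro finite_measure_finite_Union) (auto simp: disjoint_family_on_def)
  moreover have "(\<Union>c\<in>C. {\<omega> \<in> space M. y \<omega> k = c}) = {\<omega> \<in> space M. y \<omega> k \<in> C}" by auto
  ultimately show ?thesis by (simp add: residue_law_def)
qed

text \<open>
  The exponent is at least \<open>1\<close>, so that the residue in question determines the residue modulo \<open>p\<close>. This is
  why the entries are reduced modulo \<open>p ^ Suc K\<close> rather than \<open>p ^ K\<close>, which is \<open>1\<close> for a trivial group.
\<close>

lemma balanced_residue_law:
  assumes p: "p > 0" and bal: "balanced p \<alpha> M y"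
  shows "balanced_weights p \<alpha> {0..<int (p ^ Suc k)} (residue_law M y (Suc k))"
  unfolding balanced_weights_def
proof (intro conjI ballI allI)
  have y: "y \<in> measurable M (Zp_borel p)"
    and lim: "\<And>r. r \<in> carrier (Zp p Quot (PIdl\<^bsub>Zp p\<^esub> ([p] \<cdot>\<^bsub>Zp p\<^esub> \<one>\<^bsub>Zp p\<^esub>))) \<Longrightarrow>
      prob {\<omega> \<in> space M. y \<omega> \<in> r} \<le> 1 - \<alpha>"
    using bal by (auto simp: balanced_def)
  have range: "y \<omega> (Suc k) \<in> {0..<int (p ^ Suc k)}" if "\<omega> \<in> space M" for \<omega>
  proof -
    have "\<forall>l. y \<omega> l \<in> {0..<int p ^ l}" using Zp_valued[OF y that] by (simp add: Zp_def)
    from spec[OF this, of "Suc k"] show ?thesis by simp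
  qed
  show "0 \<le> residue_law M y (Suc k) c" for c by (simp add: residue_law_def)
  have "{\<omega> \<in> space M. y \<omega> (Suc k) \<in> {0..<int (p ^ Suc k)}} = space M" using range by auto
  then show "sum (residue_law M y (Suc k)) {0..<int (p ^ Suc k)} = 1"
    using sum_residue_law[OF y, of "{0..<int (p ^ Suc k)}" "Suc k"] by (simp add: prob_space)
  fix r
  let ?C = "{c \<in> {0..<int (p ^ Suc k)}. [c = r] (mod int p)}"
  have "y \<omega> (Suc k) \<in> ?C \<longleftrightarrow> y \<omega> \<in> {x \<in> carrier (Zp p). x 1 = r mod int p}" if "\<omega> \<in> space M" for \<omega>
    using range[OF that] Zp_valued[OF y that] Zp_carrier_mod[OF Zp_valued[OF y that], of 1 "Suc k"]
    by (auto simp: cong_def)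
  then have "{\<omega> \<in> space M. y \<omega> (Suc k) \<in> ?C} = {\<omega> \<in> space M. y \<omega> \<in> {x \<in> carrier (Zp p). x 1 = r mod int p}}"
    by blast
  moreover have "finite ?C" by (rule finite_subset[of _ "{0..<int (p ^ Suc k)}"]) auto
  from sum_residue_law[OF y this]
  have "sum (residue_law M y (Suc k)) ?C = prob {\<omega> \<in> space M. y \<omega> (Suc k) \<in> ?C}" .
  ultimately have "sum (residue_law M y (Suc k)) ?C
      = prob {\<omega> \<in> space M. y \<omega> \<in> {x \<in> carrier (Zp p). x 1 = r mod int p}}"
    by (simp only:)
  also have "\<dots> \<le> 1 - \<alpha>" using p by (intro lim residue_class_is_coset) auto
  finally show "sum (residue_law M y (Suc k)) ?C \<le> 1 - \<alpha>" .
qed simp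

text \<open>
  The residues of the entries take finitely many values, and by independence the event that all of them
  are prescribed has a product as its probability. Summing over the prescribed matrices whose columns
  lie in the sets \<open>S j\<close> turns the product over columns of sums into a sum of products.
\<close>

lemma prob_columns:
  fixes A :: "nat \<Rightarrow> nat \<Rightarrow> 'a \<Rightarrow> padic"
  assumes p: "p > 0" and n: "n \<ge> 1" and m: "m \<ge> 1"
    and indep: "indep_vars (\<lambda>_. Zp_borel p) (\<lambda>(i, j). A i j) ({1..n} \<times> {1..m})"
  shows "prob {\<omega> \<in> space M. \<forall>j\<in>{1..m}. (\<lambda>i\<in>{1..n}. A i j \<omega> k) \<in> S j}
       = (\<Prod>j\<in>{1..m}. \<Sum>c\<in>{c \<in> {1..n} \<rightarrow>\<^sub>E {0..<int (p ^ k)}. c \<in> S j}. \<Prod>i\<in>{1..n}. residue_law M (A i j) k (c i))"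
    and "{\<omega> \<in> space M. \<forall>j\<in>{1..m}. (\<lambda>i\<in>{1..n}. A i j \<omega> k) \<in> S j} \<in> events"
proof -
  let ?I = "{1..n} \<times> {1..m}"
  let ?S = "\<lambda>j. {c \<in> {1..n} \<rightarrow>\<^sub>E {0..<int (p ^ k)}. c \<in> S j}"
  let ?D = "{1..m} \<rightarrow>\<^sub>E ({1..n} \<rightarrow>\<^sub>E {0..<int (p ^ k)})"
  define ev where "ev = (\<lambda>c :: nat \<Rightarrow> nat \<Rightarrow> int. \<Inter>(i, j)\<in>?I. {\<omega> \<in> space M. A i j \<omega> k = c j i})"
  have meas: "A i j \<in> measurable M (Zp_borel p)" if "i \<in> {1..n}" "j \<in> {1..m}" for i j
    using indep that by (auto simp: indep_vars_def)
  have I: "?I \<noteq> {}" "finite ?I" using n m by auto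
  have ev_prob: "prob (ev c) = (\<Prod>j\<in>{1..m}. \<Prod>i\<in>{1..n}. residue_law M (A i j) k (c j i))" for c
  proof -
    let ?X = "\<lambda>(i, j). {x \<in> carrier (Zp p). x k = c j i}"
    have cyl: "(case q of (i, j) \<Rightarrow> {\<omega> \<in> space M. A i j \<omega> k = c j i})
        = (case q of (i, j) \<Rightarrow> A i j) -` ?X q \<inter> space M" if q: "q \<in> ?I" for q
    proof -
      obtain i j where ij: "q = (i, j)" "i \<in> {1..n}" "j \<in> {1..m}" using q by auto
      show ?thesis unfolding ij(1) prod.case by (rule residue_event(1)[OF meas[OF ij(2,3)]])
    qed
    have "ev c = (\<Inter>q\<in>?I. (case q of (i, j) \<Rightarrow> A i j) -` ?X q \<inter> space M)"
      unfolding ev_def by (rule INF_cong[OF refl cyl])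
    also have "prob \<dots> = (\<Prod>q\<in>?I. prob ((case q of (i, j) \<Rightarrow> A i j) -` ?X q \<inter> space M))"
      by (rule indep_varsD[OF indep I subset_refl]) (auto simp: Zp_borel_cylinder)
    also have "\<dots> = (\<Prod>(i, j)\<in>?I. residue_law M (A i j) k (c j i))"
      by (rule prod.cong[OF refl], subst cyl[symmetric]) (auto simp: residue_law_def)
    also have "\<dots> = (\<Prod>i\<in>{1..n}. \<Prod>j\<in>{1..m}. residue_law M (A i j) k (c j i))"
      by (rule prod.cartesian_product[symmetric])
    also have "\<dots> = (\<Prod>j\<in>{1..m}. \<Prod>i\<in>{1..n}. residue_law M (A i j) k (c j i))"
      by (rule prod.swap)
    finally show ?thesis .
  qed
  have ev_sets: "ev c \<in> events" for c
    unfolding ev_def using I residue_event(2)[OF meas] by (intro sets.finite_INT) auto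
  have fin: "finite ({1..n} \<rightarrow>\<^sub>E {0..<int (p ^ k)})" by (intro finite_PiE) auto
  have finS: "finite (PiE {1..m} ?S)" using fin by (intro finite_PiE) auto
  have disj: "disjoint_family_on ev (PiE {1..m} ?S)"
  proof (unfold disjoint_family_on_def, intro ballI impI)
    fix c d assume cd: "c \<in> PiE {1..m} ?S" "d \<in> PiE {1..m} ?S" "c \<noteq> d"
    show "ev c \<inter> ev d = {}"
    proof (rule ccontr)
      assume "ev c \<inter> ev d \<noteq> {}"
      then obtain \<omega> where "\<omega> \<in> ev c" "\<omega> \<in> ev d" by auto
      then have eq: "c j i = d j i" if "i \<in> {1..n}" "j \<in> {1..m}" for i j
        using that unfolding ev_def by fastforce
      have "c = d"
      proof (rule PiE_ext[OF cd(1,2)])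
        fix j assume j: "j \<in> {1..m}"
        have "c j \<in> {1..n} \<rightarrow>\<^sub>E {0..<int (p ^ k)}" "d j \<in> {1..n} \<rightarrow>\<^sub>E {0..<int (p ^ k)}"
          using PiE_mem[OF cd(1) j] PiE_mem[OF cd(2) j] by auto
        then show "c j = d j" using eq[OF _ j] by (rule PiE_ext)
      qed
      then show False using cd(3) by simp
    qed
  qed
  have union: "{\<omega> \<in> space M. \<forall>j\<in>{1..m}. (\<lambda>i\<in>{1..n}. A i j \<omega> k) \<in> S j} = (\<Union>c\<in>PiE {1..m} ?S. ev c)"
  proof (rule subset_antisym; rule subsetI)
    fix \<omega> assume a: "\<omega> \<in> {\<omega> \<in> space M. \<forall>j\<in>{1..m}. (\<lambda>i\<in>{1..n}. A i j \<omega> k) \<in> S j}"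
    define c where "c = (\<lambda>j\<in>{1..m}. \<lambda>i\<in>{1..n}. A i j \<omega> k)"
    have "A i j \<omega> k \<in> {0..<int (p ^ k)}" if "i \<in> {1..n}" "j \<in> {1..m}" for i j
      using Zp_valued[OF meas[OF that], of \<omega>] a by (simp add: Zp_def)
    then have "c \<in> PiE {1..m} ?S" using a unfolding c_def by auto
    moreover have "\<omega> \<in> ev c" using a by (auto simp: ev_def c_def)
    ultimately show "\<omega> \<in> (\<Union>c\<in>PiE {1..m} ?S. ev c)" by blast
  next
    fix \<omega> assume "\<omega> \<in> (\<Union>c\<in>PiE {1..m} ?S. ev c)"
    then obtain c where c: "c \<in> PiE {1..m} ?S" "\<omega> \<in> ev c" by auto
    have eq: "\<omega> \<in> space M" "A i j \<omega> k = c j i" if "i \<in> {1..n}" "j \<in> {1..m}" for i j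
      using c(2) that unfolding ev_def by fastforce+
    have "(\<lambda>i\<in>{1..n}. A i j \<omega> k) \<in> S j" if j: "j \<in> {1..m}" for j
    proof -
      have cj: "c j \<in> {1..n} \<rightarrow>\<^sub>E {0..<int (p ^ k)}" "c j \<in> S j" using PiE_mem[OF c(1) j] by auto
      have "(\<lambda>i\<in>{1..n}. A i j \<omega> k) = (\<lambda>i\<in>{1..n}. c j i)" using eq(2)[OF _ j] by (intro restrict_ext)
      also have "\<dots> = c j" using cj(1) by (intro extensional_restrict) (auto simp: PiE_def)
      finally show ?thesis using cj(2) by simp
    qed
    moreover have "\<omega> \<in> space M" using eq(1)[of 1 1] n m by auto
    ultimately show "\<omega> \<in> {\<omega> \<in> space M. \<forall>j\<in>{1..m}. (\<lambda>i\<in>{1..n}. A i j \<omega> k) \<in> S j}" by auto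
  qed
  show "{\<omega> \<in> space M. \<forall>j\<in>{1..m}. (\<lambda>i\<in>{1..n}. A i j \<omega> k) \<in> S j} \<in> events"
    unfolding union using finS ev_sets by (intro sets.finite_UN) auto
  have "prob (\<Union>c\<in>PiE {1..m} ?S. ev c) = (\<Sum>c\<in>PiE {1..m} ?S. prob (ev c))"
    using finS ev_sets disj by (intro finite_measure_finite_Union) auto
  also have "\<dots> = (\<Sum>c\<in>PiE {1..m} ?S. \<Prod>j\<in>{1..m}. \<Prod>i\<in>{1..n}. residue_law M (A i j) k (c j i))"
    by (simp only: ev_prob)
  also have "\<dots> = (\<Prod>j\<in>{1..m}. \<Sum>c\<in>?S j. \<Prod>i\<in>{1..n}. residue_law M (A i j) k (c i))"
    using fin by (intro prod_sum_PiE[symmetric]) auto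
  finally show "prob {\<omega> \<in> space M. \<forall>j\<in>{1..m}. (\<lambda>i\<in>{1..n}. A i j \<omega> k) \<in> S j}
       = (\<Prod>j\<in>{1..m}. \<Sum>c\<in>?S j. \<Prod>i\<in>{1..n}. residue_law M (A i j) k (c i))"
    unfolding union .
qed

end

lemma (in comm_group) kill_prob_eq_sum:
  assumes "g \<in> tuples G n" and "finite C"
  shows "kill_prob G C n \<mu> g
       = (\<Sum>c\<in>{c \<in> {1..n} \<rightarrow>\<^sub>E C. pow_prod G n g c = \<one>}. \<Prod>i\<in>{1..n}. \<mu> i (c i))"
proof -
  have fin: "finite ({1..n} \<rightarrow>\<^sub>E C)" using assms(2) by (intro finite_PiE) auto
  have "kill_prob G C n \<mu> g
      = (\<Sum>c\<in>{1..n} \<rightarrow>\<^sub>E C. if pow_prod G n g c = \<one> then \<Prod>i\<in>{1..n}. \<mu> i (c i) else 0)"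
    unfolding kill_prob_def walk_mean_def pow_prod_def[symmetric]
    using pow_prod_closed[OF assms(1)] by (intro sum.cong) auto
  then show ?thesis by (simp only: sum.inter_filter[OF fin])
qed

text \<open>
  Pointwise the number of surjections is the number of generating tuples that kill all columns, and the
  expectation of this number is the sum of the probabilities of the events \<open>E g\<close>.
\<close>

lemma (in comm_group) expected_Sur_cok:
  assumes M: "prob_space M" and p: "prime p" and fin: "finite (carrier G)"
    and K: "K = multiplicity p (order G)" and ord: "\<And>x. x \<in> carrier G \<Longrightarrow> x [^] int p ^ K = \<one>"
    and n: "n \<ge> 1"
    and indep: "prob_space.indep_vars M (\<lambda>_. Zp_borel p) (\<lambda>(i, j). A i j) ({1..n} \<times> {1..n + u})"
  shows "prob_space.expectation M
          (\<lambda>\<omega>. real (card (Sur (Zp p) (cok (Zp p) n (n + u) (\<lambda>i j. A i j \<omega>)) (pgroup_module p G))))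
      = (\<Sum>g\<in>generating_tuples G n. \<Prod>j\<in>{1..n + u}.
          kill_prob G {0..<int (p ^ Suc K)} n (\<lambda>i. residue_law M (A i j) (Suc K)) g)"
proof -
  interpret prob_space M by (rule M)
  have p0: "p > 0" using p by (simp add: prime_gt_0_nat)
  define E where "E = (\<lambda>g. {\<omega> \<in> space M. \<forall>j\<in>{1..n + u}. (\<lambda>i\<in>{1..n}. A i j \<omega> (Suc K)) \<in> {c. pow_prod G n g c = \<one>}})"
  have meas: "A i j \<in> measurable M (Zp_borel p)" if "i \<in> {1..n}" "j \<in> {1..n + u}" for i j
    using indep that by (auto simp: indep_vars_def)
  have fint: "finite (generating_tuples G n)"
  proof (rule finite_subset)
    show "generating_tuples G n \<subseteq> {1..n} \<rightarrow>\<^sub>E carrier G"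
      by (auto simp: generating_tuples_def tuples_def)
    show "finite ({1..n} \<rightarrow>\<^sub>E carrier G)" using fin by (intro finite_PiE) auto
  qed
  have m: "n + u \<ge> 1" using n by simp
  note cols = prob_columns[OF p0 n m indep, where k = "Suc K"]
  have E_sets: "E g \<in> events" for g unfolding E_def by (rule cols(2))
  have card: "real (card (Sur (Zp p) (cok (Zp p) n (n + u) (\<lambda>i j. A i j \<omega>)) (pgroup_module p G)))
      = (\<Sum>g\<in>generating_tuples G n. indicator (E g) \<omega>)" if \<omega>: "\<omega> \<in> space M" for \<omega>
  proof -
    have mem: "A i j \<omega> \<in> carrier (Zp p)" if "i \<in> {1..n}" "j \<in> {1..n + u}" for i j
      using Zp_valued[OF meas[OF that] \<omega>] .
    interpret Z: zp_cokernel p n "n + u" "\<lambda>i j. A i j \<omega>" G K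
      by unfold_locales (use p0 mem K ord in auto)
    \<comment> \<open>Both residues act alike on \<open>G\<close>, whose exponent divides \<open>p ^ K\<close>.\<close>
    have "pow_prod G n g (\<lambda>i. A i j \<omega> K) = pow_prod G n g (\<lambda>i\<in>{1..n}. A i j \<omega> (Suc K))"
      if g: "g \<in> tuples G n" and j: "j \<in> {1..n + u}" for g j
      using g
    proof (rule pow_prod_cong)
      fix i assume i: "i \<in> {1..n}"
      have "g i [^] A i j \<omega> K = g i [^] (A i j \<omega> (Suc K) mod int p ^ K)"
        using Zp_carrier_mod[OF mem[OF i j], of K "Suc K"] by simp
      also have "\<dots> = g i [^] A i j \<omega> (Suc K)"
        using int_pow_mod[OF tuple_mem[OF g i] ord[OF tuple_mem[OF g i]]] .
      finally show "g i [^] A i j \<omega> K = g i [^] (\<lambda>i\<in>{1..n}. A i j \<omega> (Suc K)) i" using i by simp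
    qed
    then have "Z.killing_tuples = {g \<in> generating_tuples G n. \<omega> \<in> E g}"
      using \<omega> unfolding Z.killing_tuples_def E_def generating_tuples_def by auto
    then show ?thesis
      using fint Z.card_Sur_cok by (simp add: indicator_def sum.inter_filter[symmetric] of_bool_def)
  qed
  have "expectation (\<lambda>\<omega>. real (card (Sur (Zp p) (cok (Zp p) n (n + u) (\<lambda>i j. A i j \<omega>)) (pgroup_module p G))))
      = expectation (\<lambda>\<omega>. \<Sum>g\<in>generating_tuples G n. indicator (E g) \<omega>)"
    using card by (intro Bochner_Integration.integral_cong) auto
  also have "\<dots> = (\<Sum>g\<in>generating_tuples G n. expectation (indicator (E g)))"
    using E_sets by (intro Bochner_Integration.integral_sum integrable_real_indicator) (auto simp: emeasure_eq_measure)
  also have "\<dots> = (\<Sum>g\<in>generating_tuples G n. prob (E g))"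
    using E_sets sets.sets_into_space by (intro sum.cong refl) (simp add: Int_absorb2)
  also have "\<dots> = (\<Sum>g\<in>generating_tuples G n. \<Prod>j\<in>{1..n + u}.
          kill_prob G {0..<int (p ^ Suc K)} n (\<lambda>i. residue_law M (A i j) (Suc K)) g)"
    unfolding E_def cols(1)
    by (intro sum.cong prod.cong refl) (auto simp: kill_prob_eq_sum generating_tuples_def)
  finally show ?thesis .
qed

theorem theorem1p6:
  fixes p u :: nat
    and \<alpha> :: "nat \<Rightarrow> nat \<Rightarrow> real"
    and M :: "nat \<Rightarrow> 'w measure"
    and A :: "nat \<Rightarrow> nat \<Rightarrow> nat \<Rightarrow> 'w \<Rightarrow> padic"
    and G :: "('g, 'c) monoid_scheme"
  assumes "prime p"
    and "\<And>n i. n \<ge> 1 \<Longrightarrow> i \<in> {1..n + u} \<Longrightarrow> 0 < \<alpha> n i \<and> \<alpha> n i \<le> 1 / 2"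
    and "\<And>\<epsilon>. \<epsilon> > 0 \<Longrightarrow> (\<lambda>n. \<Sum>i=1..n + u. exp (- \<epsilon> * \<alpha> n i * real n)) \<longlonglongrightarrow> 0"
    and "\<And>n. n \<ge> 1 \<Longrightarrow> prob_space (M n)"
    and "\<And>n. n \<ge> 1 \<Longrightarrow>
           prob_space.indep_vars (M n) (\<lambda>_. Zp_borel p) (\<lambda>(i, j). A n i j) ({1..n} \<times> {1..n + u})"
    and "\<And>n j. n \<ge> 1 \<Longrightarrow> j \<in> {1..n + u} \<Longrightarrow> balanced_vector p (\<alpha> n j) (M n) n (\<lambda>i. A n i j)"
    and "comm_group G" and "finite (carrier G)" and "\<exists>k. order G = p ^ k"
  shows "(\<lambda>n. prob_space.expectation (M n)
            (\<lambda>\<omega>. real (card (Sur (Zp p) (cok (Zp p) n (n + u) (\<lambda>i j. A n i j \<omega>)) (pgroup_module p G)))))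
         \<longlonglongrightarrow> 1 / real (order G) ^ u"
proof -
  interpret comm_group G by fact
  note p = \<open>prime p\<close> and fin = \<open>finite (carrier G)\<close>
  define K where "K = multiplicity p (order G)"
  have p0: "p > 0" using p by (simp add: prime_gt_0_nat)
  have orderK: "order G = p ^ K"
    using assms(9) p by (auto simp: K_def multiplicity_same_power)
  have ord: "x [^]\<^bsub>G\<^esub> int p ^ K = \<one>\<^bsub>G\<^esub>" if x: "x \<in> carrier G" for x
  proof -
    have "x [^]\<^bsub>G\<^esub> int (order G) = \<one>\<^bsub>G\<^esub>" using pow_order_eq_1[OF x] by (simp add: int_pow_int)
    then show ?thesis by (simp add: orderK)
  qed
  have ord': "x [^]\<^bsub>G\<^esub> int (p ^ Suc K) = \<one>\<^bsub>G\<^esub>" if x: "x \<in> carrier G" for x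
  proof -
    have "x [^]\<^bsub>G\<^esub> int (p ^ Suc K) = (x [^]\<^bsub>G\<^esub> int p ^ K) [^]\<^bsub>G\<^esub> int p"
      using x by (simp add: int_pow_pow mult.commute)
    then show ?thesis using ord[OF x] by simp
  qed
  let ?\<mu> = "\<lambda>n j i. residue_law (M n) (A n i j) (Suc K)"
  have "(\<lambda>n. \<Sum>g\<in>generating_tuples G n. \<Prod>j\<in>{1..n + u}. kill_prob G {0..<int (p ^ Suc K)} n (?\<mu> n j) g)
      \<longlonglongrightarrow> 1 / real (order G) ^ u"
  proof (rule surjection_sum_tendsto[OF fin p refl ord'])
    fix n i j assume n: "n \<ge> 1" and i: "i \<in> {1..n}" and j: "j \<in> {1..n + u}"
    interpret prob_space "M n" using assms(4)[OF n] .
    have "balanced p (\<alpha> n j) (M n) (A n i j)"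
      using assms(6)[OF n j] i by (auto simp: balanced_vector_def)
    then show "balanced_weights p (\<alpha> n j) {0..<int (p ^ Suc K)} (?\<mu> n j i)"
      by (rule balanced_residue_law[OF p0])
  next
    fix n j assume "n \<ge> 1" "j \<in> {1..n + u}"
    then show "0 \<le> \<alpha> n j \<and> \<alpha> n j \<le> 1" using assms(2)[of n j] by auto
  qed (use assms(3) in auto)
  moreover have "\<forall>\<^sub>F n in sequentially.
      (\<Sum>g\<in>generating_tuples G n. \<Prod>j\<in>{1..n + u}. kill_prob G {0..<int (p ^ Suc K)} n (?\<mu> n j) g)
      = prob_space.expectation (M n)
            (\<lambda>\<omega>. real (card (Sur (Zp p) (cok (Zp p) n (n + u) (\<lambda>i j. A n i j \<omega>)) (pgroup_module p G))))"
    using eventually_ge_at_top[of 1]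
  proof eventually_elim
    case (elim n)
    show ?case
      by (rule expected_Sur_cok[symmetric, OF assms(4)[OF elim] p fin K_def ord elim assms(5)[OF elim]])
  qed
  ultimately show ?thesis by (rule Lim_transform_eventually)
qed

end
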